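(* Let $k\geq1$. The class of ${\mathrm{PCF}}^\Omega_k$-denotable procedures-in-environment $\Gamma\vdash p$ is the class generated inductively by the following rules: 1. If $\Gamma\vdash q_i$ is denotable for each $i<r$ and $x\in\Gamma$, then $\Gamma\vdash\lambda.\mathtt{case}\ x\,q_0\cdots q_{r-1}\ \mathtt{of}\ (j\Rightarrow j)$ is denotable. 2. If $\Gamma,x\vdash p$ is denotable, then $\Gamma\vdash\lambda x.p$ is denotable. 3. Each $\Gamma\vdash\lambda.n$ is denotable. 4. If $\Gamma\vdash p$ is denotable and $f:\mathbb{N}\rightharpoonup\mathbb{N}$, then $\Gamma\vdash p[i\mapsto f(i)]$ is denotable. 5. If $\Gamma\vdash p$, $\Gamma\vdash\lambda.d$ and $\Gamma\vdash\lambda.e$ are denotable, then $\Gamma\vdash p[0\mapsto d,\ i+1\mapsto e]$ is denotable. 6. If $\Gamma\vdash\lambda z^\sigma x_0^{\sigma_0}\cdots x_{r-1}^{\sigma_{r-1}}.e$ is denotable where $\sigma=\sigma_0,\ldots,\sigma_{r-1}\rightarrow\mathbb{N}$ is of level $\le k$, and $\Gamma\vdash q_i:\sigma_i$ is denotable for each $i<r$, then $\Gamma\vdash\lambda.\langle\!\langle\Pi_{\Gamma,Z}(e,\xi)\rangle\!\rangle$ is denotable, where $Z=z,\vec x$ is disjoint from $\Gamma$, $\xi(z)=\lambda\vec x.e$ and $\xi(x_i)=q_i$ for each $i$.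
   Context: Levels: ${\mathrm{lv}}(\mathbb{N})=0$, ${\mathrm{lv}}(\sigma\rightarrow\tau)=\max({\mathrm{lv}}\,\sigma+1,{\mathrm{lv}}\,\tau)$. ${\mathrm{PCF}}^\Omega$: simply typed $\lambda$-calculus over $\mathbb{N}$ with constants $\underline n$, $\mathit{suc},\mathit{pre}$, $\mathit{ifzero}$, $Y_\sigma:(\sigma\rightarrow\sigma)\rightarrow\sigma$ for all $\sigma$, and $C_f:\mathbb{N}\rightarrow\mathbb{N}$ for each partial $f:\mathbb{N}\rightharpoonup\mathbb{N}$; ${\mathrm{PCF}}^\Omega_k$ admits $Y_\sigma$ only for ${\mathrm{lv}}(\sigma)\le k$. NSPs: coinductively generated well-typed trees $p::=\lambda\vec x.e$, $e::=\bot\mid n\mid\mathtt{case}\ a\ \mathtt{of}\ (i\Rightarrow e_i\mid i\in\mathbb{N})$, $a::=x\,q_0\cdots q_{r-1}$, modulo $\alpha$; meta-terms add $P\vec Q$ and $\mathtt{case}\ G\ \mathtt{of}(\ldots)$ for arbitrary ground $G$, and $\langle\!\langle T\rangle\!\rangle$ is the limit of reduction by $\beta$, $\mathtt{case}\ \bot\rightsquigarrow\bot$, $\mathtt{case}\ n\ \mathtt{of}(i\Rightarrow E_i)\rightsquigarrow E_n$ and case-of-case commutation. Application $(\lambda x_0\cdots x_r.e)\cdot q=\lambda x_1\cdots x_r.\langle\!\langle e[x_0\mapsto q]\rangle\!\rangle$, $x^\eta=\lambda\vec z.\mathtt{case}\ x\vec z^{\,\eta}\ \mathtt{of}(i\Rightarrow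 i)$. The interpretation: $[\![x]\!]=x^\eta$, $[\![\underline n]\!]=\lambda.n$, $[\![\mathit{suc}]\!]=\lambda x.\mathtt{case}\ x\ \mathtt{of}(i\Rightarrow i+1)$, $[\![\mathit{pre}]\!]=\lambda x.\mathtt{case}\ x\ \mathtt{of}(0\Rightarrow0\mid i+1\Rightarrow i)$, $[\![\mathit{ifzero}]\!]=\lambda xyz.\mathtt{case}\ x\ \mathtt{of}(0\Rightarrow\mathtt{case}\ y\ \mathtt{of}(j\Rightarrow j)\mid i+1\Rightarrow\mathtt{case}\ z\ \mathtt{of}(j\Rightarrow j))$, $[\![C_f]\!]=\lambda x.\mathtt{case}\ x\ \mathtt{of}(i\Rightarrow f(i))$, $[\![Y_\sigma]\!]=\lambda g.F_\sigma[g]$, $F_\sigma[g]=\lambda\vec x.\mathtt{case}\ g(F_\sigma[g])\vec x^{\,\eta}\ \mathtt{of}(i\Rightarrow i)$, $[\![\lambda x.M]\!]_\Gamma=\lambda x.[\![M]\!]_{\Gamma,x}$, $[\![MN]\!]_\Gamma=[\![M]\!]_\Gamma\cdot[\![N]\!]_\Gamma$. $\Gamma\vdash p$ is ${\mathrm{PCF}}^\Omega_k$-denotable if $p=[\![M]\!]_\Gamma$ for some ${\mathrm{PCF}}^\Omega_k$ term $\Gamma\vdash M$. Rightward numeral leaves of $t$: $n$ in itself; those of $e$ in $\lambda\vec x.e$; those of each $e_i$ in $\mathtt{case}\ a\ \mathtt{of}(i\Rightarrow e_i)$; $t[i\mapsto e_i]$ replaces each rightward leaf $i$ by $e_i$ ($f(i)$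 read as $\bot$ if undefined). Plugging: for $\Gamma$, a list $Z$ of variables of level $\le k$ disjoint from $\Gamma$, $\Gamma,Z\vdash e$, and $\xi$ with $\Gamma,Z\vdash\xi(z):\sigma$ for $z^\sigma\in Z$, let $T^\circ$ replace each ground subterm $z\vec Q$ ($z\in Z$) of $T$ by $\bot$; $\Pi^0=e$, $\Pi^{m+1}=\Pi^m[z\mapsto\xi(z)\ \forall z\in Z]$, $\Pi_{\Gamma,Z}(e,\xi)=\bigsqcup_m(\Pi^m)^\circ$. *)

theory Defs
  imports Main "HOL-Library.BNF_Corec"
begin

datatype ty = N | Arr ty ty

fun lv :: "ty \<Rightarrow> nat" where
  "lv N = 0"
| "lv (Arr s t) = max (lv s + 1) (lv t)"

fun args :: "ty \<Rightarrow> ty list" where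
  "args N = []"
| "args (Arr s t) = s # args t"

definition arrs :: "ty list \<Rightarrow> ty" where
  "arrs ss = foldr Arr ss N"

text \<open>Variables are represented by de Bruijn levels: in an environment of length d
  the environment variables are 0..d-1; a lambda block with binder types bs occurring
  at depth D binds the variables D..D+length bs-1, and its body lives at depth
  D+length bs. Under this representation alpha-equivalent NSPs are equal.
  A procedure lambda xs.e is a pair (binder types, body).\<close>

codatatype nexp = Bot | Num nat | Case nat "(ty list \<times> nexp) list" "nat \<Rightarrow> nexp"
type_synonym nsp = "ty list \<times> nexp"

text \<open>Meta-terms. Ground meta-terms and meta-expressions are merged into one type:
  MCase G Es is case G of (i => E_i), MVar x Qs is x Qs, MApp P Qs is P Qs.\<close>

codatatype mexp = MBot | MNum nat | MCase mexp "nat \<Rightarrow> mexp"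
  | MVar nat "(ty list \<times> mexp) list" | MApp "ty list \<times> mexp" "(ty list \<times> mexp) list"
type_synonym mproc = "ty list \<times> mexp"

corec emb :: "nexp \<Rightarrow> mexp" where
  "emb e = (case e of Bot \<Rightarrow> MBot | Num n \<Rightarrow> MNum n
     | Case x qs es \<Rightarrow> MCase (MVar x (map (\<lambda>(bs,b). (bs, emb b)) qs)) (\<lambda>i. emb (es i)))"

definition embp :: "nsp \<Rightarrow> mproc" where
  "embp p = (fst p, emb (snd p))"

corec nren :: "(nat \<Rightarrow> nat) \<Rightarrow> nexp \<Rightarrow> nexp" where
  "nren \<rho> e = (case e of Bot \<Rightarrow> Bot | Num n \<Rightarrow> Num n
     | Case x qs es \<Rightarrow> Case (\<rho> x) (map (\<lambda>(bs,b). (bs, nren \<rho> b)) qs) (\<lambda>i. nren \<rho> (es i)))"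

definition nshift :: "nat \<Rightarrow> nat \<Rightarrow> nexp \<Rightarrow> nexp" where
  "nshift n k = nren (\<lambda>v. if v < n then v else v + k)"

definition nunshift :: "nat \<Rightarrow> nat \<Rightarrow> nexp \<Rightarrow> nexp" where
  "nunshift n k = nren (\<lambda>v. if v < n then v else v - k)"

corec mren :: "(nat \<Rightarrow> nat) \<Rightarrow> mexp \<Rightarrow> mexp" where
  "mren \<rho> e = (case e of MBot \<Rightarrow> MBot | MNum n \<Rightarrow> MNum n
     | MCase g es \<Rightarrow> MCase (mren \<rho> g) (\<lambda>i. mren \<rho> (es i))
     | MVar x qs \<Rightarrow> MVar (\<rho> x) (map (\<lambda>(bs,b). (bs, mren \<rho> b)) qs)
     | MApp (hs,h) qs \<Rightarrow> MApp (hs, mren \<rho> h) (map (\<lambda>(bs,b). (bs, mren \<rho> b)) qs))"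

definition mshiftp :: "nat \<Rightarrow> nat \<Rightarrow> mproc \<Rightarrow> mproc" where
  "mshiftp n k p = (fst p, mren (\<lambda>v. if v < n then v else v + k) (snd p))"

text \<open>Substitution on meta-terms: the variables lo..lo+r-1 are replaced by the meta-procedures
  sub 0,...,sub (r-1) (which live at depth s), variables >= lo+r are lowered by dec;
  k counts the binders passed so far (so the current target depth is s+k).\<close>
corec msub :: "nat \<Rightarrow> nat \<Rightarrow> nat \<Rightarrow> nat \<Rightarrow> (nat \<Rightarrow> mproc) \<Rightarrow> nat \<Rightarrow> mexp \<Rightarrow> mexp" where
  "msub lo r dec s sub k e = (case e of MBot \<Rightarrow> MBot | MNum n \<Rightarrow> MNum n
     | MCase g es \<Rightarrow> MCase (msub lo r dec s sub k g) (\<lambda>i. msub lo r dec s sub k (es i))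
     | MVar x qs \<Rightarrow>
         (if x < lo then MVar x (map (\<lambda>(bs,b). (bs, msub lo r dec s sub (k + length bs) b)) qs)
          else if x < lo + r then
            MApp (mshiftp s k (sub (x - lo))) (map (\<lambda>(bs,b). (bs, msub lo r dec s sub (k + length bs) b)) qs)
          else MVar (x - dec) (map (\<lambda>(bs,b). (bs, msub lo r dec s sub (k + length bs) b)) qs))
     | MApp (hs,h) qs \<Rightarrow> MApp (hs, msub lo r dec s sub (k + length hs) h)
           (map (\<lambda>(bs,b). (bs, msub lo r dec s sub (k + length bs) b)) qs))"

definition hstep :: "nat \<Rightarrow> mexp \<Rightarrow> mexp option" where
  "hstep D e = (case e of
      MCase g es \<Rightarrow> (case g of
          MBot \<Rightarrow> Some MBot
        | MNum n \<Rightarrow> Some (es n)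
        | MCase g' fs \<Rightarrow> Some (MCase g' (\<lambda>i. MCase (fs i) es))
        | MApp (hs,h) qs \<Rightarrow>
            (if length qs = length hs
             then Some (MCase (msub D (length hs) (length hs) D (\<lambda>j. qs ! j) 0 h) es)
             else None)
        | MVar _ _ \<Rightarrow> None)
    | _ \<Rightarrow> None)"

fun hiter :: "nat \<Rightarrow> nat \<Rightarrow> mexp \<Rightarrow> mexp" where
  "hiter D 0 e = e"
| "hiter D (Suc n) e = (case hstep D (hiter D n e) of None \<Rightarrow> hiter D n e | Some e' \<Rightarrow> e')"

definition is_hnf :: "mexp \<Rightarrow> bool" where
  "is_hnf e = (case e of MBot \<Rightarrow> True | MNum _ \<Rightarrow> True
      | MCase g _ \<Rightarrow> (case g of MVar _ _ \<Rightarrow> True | _ \<Rightarrow> False) | _ \<Rightarrow> False)"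

definition hnf :: "nat \<Rightarrow> mexp \<Rightarrow> mexp option" where
  "hnf D e = (if \<exists>n. is_hnf (hiter D n e)
              then Some (hiter D (LEAST n. is_hnf (hiter D n e)) e) else None)"

corec eval :: "nat \<Rightarrow> mexp \<Rightarrow> nexp" where
  "eval D e = (case hnf D e of None \<Rightarrow> Bot
     | Some h \<Rightarrow> (case h of MBot \<Rightarrow> Bot | MNum n \<Rightarrow> Num n
         | MCase g es \<Rightarrow> (case g of
              MVar x qs \<Rightarrow> Case x (map (\<lambda>(bs,b). (bs, eval (D + length bs) b)) qs) (\<lambda>i. eval D (es i))
            | _ \<Rightarrow> Bot)
         | _ \<Rightarrow> Bot))"

definition app :: "nat \<Rightarrow> nsp \<Rightarrow> nsp \<Rightarrow> nsp" where
  "app D p q = (case fst p of [] \<Rightarrow> ([], Bot)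
     | t # ts \<Rightarrow> (ts, eval (D + length ts)
                    (msub D 1 1 D (\<lambda>_. embp q) (length ts) (emb (snd p)))))"

lemma size_args_nth: "j < length (args s) \<Longrightarrow> size (args s ! j) < size s"
proof (induction s arbitrary: j)
  case N then show ?case by simp
next
  case (Arr s t) then show ?case by (cases j) fastforce+
qed

function eta :: "ty \<Rightarrow> nat \<Rightarrow> nat \<Rightarrow> nsp" where
  "eta s v D = (args s, Case v (map (\<lambda>j. eta (args s ! j) (D + j) (D + length (args s)))
                                   [0..<length (args s)]) Num)"
  by pat_completeness auto
termination
  by (relation "measure (\<lambda>(s,_,_). size s)") (auto intro: size_args_nth)

text \<open>body of F_sigma[g] (sigma with argument types ss, g at level g) as a procedure at depth D\<close>
corec Fb :: "ty list \<Rightarrow> nat \<Rightarrow> nat \<Rightarrow> nexp" where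
  "Fb ss g D = Case g ((ss, Fb ss g (D + length ss))
       # map (\<lambda>j. eta (ss ! j) (D + j) (D + length ss)) [0..<length ss]) Num"

datatype pcf = PVar nat | PNum nat | PSuc | PPre | PIfz | PY ty | PC "nat \<Rightarrow> nat option"
  | PLam ty pcf | PApp pcf pcf

inductive ptyped :: "nat \<Rightarrow> ty list \<Rightarrow> pcf \<Rightarrow> ty \<Rightarrow> bool" where
  "x < length G \<Longrightarrow> ptyped k G (PVar x) (G ! x)"
| "ptyped k G (PNum n) N"
| "ptyped k G PSuc (Arr N N)"
| "ptyped k G PPre (Arr N N)"
| "ptyped k G PIfz (Arr N (Arr N (Arr N N)))"
| "lv s \<le> k \<Longrightarrow> ptyped k G (PY s) (Arr (Arr s s) s)"
| "ptyped k G (PC f) (Arr N N)"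
| "ptyped k (G @ [s]) M t \<Longrightarrow> ptyped k G (PLam s M) (Arr s t)"
| "ptyped k G M (Arr s t) \<Longrightarrow> ptyped k G M' s \<Longrightarrow> ptyped k G (PApp M M') t"

definition lam1 :: "ty \<Rightarrow> nsp \<Rightarrow> nsp" where
  "lam1 s p = (s # fst p, snd p)"

primrec interp :: "ty list \<Rightarrow> pcf \<Rightarrow> nsp" where
  "interp G (PVar x) = eta (G ! x) x (length G)"
| "interp G (PNum n) = ([], Num n)"
| "interp G PSuc = ([N], Case (length G) [] (\<lambda>i. Num (i + 1)))"
| "interp G PPre = ([N], Case (length G) [] (\<lambda>i. Num (i - 1)))"
| "interp G PIfz = ([N, N, N], Case (length G) []
      (\<lambda>i. if i = 0 then Case (length G + 1) [] Num else Case (length G + 2) [] Num))"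
| "interp G (PY s) = (Arr s s # args s, Fb (args s) (length G) (length G + 1))"
| "interp G (PC f) = ([N], Case (length G) [] (\<lambda>i. case f i of None \<Rightarrow> Bot | Some m \<Rightarrow> Num m))"
| "interp G (PLam s M) = lam1 s (interp (G @ [s]) M)"
| "interp G (PApp M M') = app (length G) (interp G M) (interp G M')"

definition denotable :: "nat \<Rightarrow> ty list \<Rightarrow> ty \<Rightarrow> nsp \<Rightarrow> bool" where
  "denotable k G s p \<longleftrightarrow> (\<exists>M. ptyped k G M s \<and> interp G M = p)"

corec nrepl :: "(nat \<Rightarrow> nexp) \<Rightarrow> nexp \<Rightarrow> nexp" where
  "nrepl g e = (case e of Bot \<Rightarrow> Bot
     | Num n \<Rightarrow> (case g n of Bot \<Rightarrow> Bot | Num m \<Rightarrow> Num m | Case x qs es \<Rightarrow> Case x qs es)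
     | Case x qs es \<Rightarrow> Case x qs (\<lambda>i. nrepl g (es i)))"

text \<open>p[i |-> g i] for p in an environment of depth D, where each g i is an expression at depth D\<close>
definition rsub :: "nat \<Rightarrow> nsp \<Rightarrow> (nat \<Rightarrow> nexp) \<Rightarrow> nsp" where
  "rsub D p g = (fst p, nrepl (\<lambda>i. nshift D (length (fst p)) (g i)) (snd p))"

definition fnum :: "(nat \<Rightarrow> nat option) \<Rightarrow> nat \<Rightarrow> nexp" where
  "fnum f i = (case f i of None \<Rightarrow> Bot | Some m \<Rightarrow> Num m)"

corec mcirc :: "nat \<Rightarrow> nat \<Rightarrow> mexp \<Rightarrow> mexp" where
  "mcirc lo r e = (case e of MBot \<Rightarrow> MBot | MNum n \<Rightarrow> MNum n
     | MCase g es \<Rightarrow> MCase (mcirc lo r g) (\<lambda>i. mcirc lo r (es i))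
     | MVar x qs \<Rightarrow> (if lo \<le> x \<and> x < lo + r then MBot
                     else MVar x (map (\<lambda>(bs,b). (bs, mcirc lo r b)) qs))
     | MApp (hs,h) qs \<Rightarrow> MApp (hs, mcirc lo r h) (map (\<lambda>(bs,b). (bs, mcirc lo r b)) qs))"

coinductive mle :: "mexp \<Rightarrow> mexp \<Rightarrow> bool" where
  "mle MBot e"
| "mle (MNum n) (MNum n)"
| "mle g g' \<Longrightarrow> (\<And>i. mle (es i) (es' i)) \<Longrightarrow> mle (MCase g es) (MCase g' es')"
| "list_all2 (rel_prod (=) mle) qs qs' \<Longrightarrow> mle (MVar x qs) (MVar x qs')"
| "mle h h' \<Longrightarrow> list_all2 (rel_prod (=) mle) qs qs'
     \<Longrightarrow> mle (MApp (hs,h) qs) (MApp (hs,h') qs')"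

text \<open>Plugging Pi_{Gamma,Z}(e,xi): Gamma has length D, Z is the list of levels D..D+r-1,
  e is an expression at depth D+r and xi j is the procedure assigned to the j-th variable of Z
  (a procedure in environment Gamma,Z).\<close>
definition plug_approx :: "nat \<Rightarrow> nat \<Rightarrow> nexp \<Rightarrow> (nat \<Rightarrow> nsp) \<Rightarrow> nat \<Rightarrow> mexp" where
  "plug_approx D r e xi m =
     ((msub D r 0 (D + r) (\<lambda>j. embp (xi j)) 0) ^^ m) (emb e)"

definition plug :: "nat \<Rightarrow> nat \<Rightarrow> nexp \<Rightarrow> (nat \<Rightarrow> nsp) \<Rightarrow> mexp" where
  "plug D r e xi = (THE T. (\<forall>m. mle (mcirc D r (plug_approx D r e xi m)) T)
       \<and> (\<forall>U. (\<forall>m. mle (mcirc D r (plug_approx D r e xi m)) U) \<longrightarrow> mle T U))"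

inductive gen :: "nat \<Rightarrow> ty list \<Rightarrow> ty \<Rightarrow> nsp \<Rightarrow> bool" for k :: nat where
  rule1: "x < length G \<Longrightarrow> G ! x = arrs ss \<Longrightarrow> length qs = length ss
     \<Longrightarrow> (\<And>i. i < length ss \<Longrightarrow> gen k G (ss ! i) (qs ! i))
     \<Longrightarrow> gen k G N ([], Case x qs Num)"
| rule2: "gen k (G @ [s]) t p \<Longrightarrow> gen k G (Arr s t) (lam1 s p)"
| rule3: "gen k G N ([], Num n)"
| rule4: "gen k G s p \<Longrightarrow> gen k G s (rsub (length G) p (fnum f))"
| rule5: "gen k G s p \<Longrightarrow> gen k G N ([], d) \<Longrightarrow> gen k G N ([], e)
     \<Longrightarrow> gen k G s (rsub (length G) p (\<lambda>i. if i = 0 then d else e))"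
| rule6: "gen k G (Arr (arrs ss) (arrs ss)) (arrs ss # ss, e) \<Longrightarrow> lv (arrs ss) \<le> k
     \<Longrightarrow> length qs = length ss \<Longrightarrow> (\<And>i. i < length ss \<Longrightarrow> gen k G (ss ! i) (qs ! i))
     \<Longrightarrow> gen k G N ([], nunshift (length G) (length ss + 1)
            (eval (length G + length ss + 1)
               (plug (length G) (length ss + 1) e
                  (\<lambda>j. if j = 0 then (ss, nshift (length G + 1) (length ss) e)
                       else (fst (qs ! (j - 1)),
                             nshift (length G) (length ss + 1) (snd (qs ! (j - 1))))))))"

end

theory Submission
  imports Defs
begin

text \<open>
  The heart of the matter is that evaluation of infinite meta-terms is compositional: meta-terms with equal
  normal forms may be replaced by each other inside any substitution instance. To see this, close
  \<open>having equal normal forms\<close> under substitution and \<open>case\<close>, and show by induction on the number of head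
  reduction steps that related meta-terms reach related head normal forms. No typing is needed. Taking
  the closure coinductively also identifies recursive unfoldings: the fixed point
  \<open>F = \<lambda>x. case g F (x\<^sup>\<eta>) of (i \<Rightarrow> i)\<close> of \<open>g = \<lambda>z x. e\<close> agrees with \<open>W = \<lambda>x. e[z := W]\<close>, which is what plugging produces;
  thus rule 6 yields exactly the denotation of \<open>Y g q\<close>. Types enter only through the fact that
  denotable procedures are invariant under eta-expansion of their variables.

  Closure of the denotable procedures under the rules is then direct programming. Conversely, a
  Kripke logical relation with base case \<open>gen\<close> at ground type contains all denotations; reflection of
  variables (rule 1) and reification (rule 2) turn membership at any type into a derivation.
\<close>

section \<open>Simultaneous substitution\<close>

text \<open>The obstacle is that a substitution instance creates new head redexes, so the runs of
  two related instances need not correspond step by step. A cost measure resolves this: a run of an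
  instance splits into a run of the uninstantiated term and, if its head variable is substituted, a
  strictly cheaper run of the body of the procedure put there, followed by a strictly cheaper run of
  the selected branch. The first piece may be exchanged for a run of any term with the same normal
  form, however long, since only the cost on one side is the induction measure; divergence is then
  compared by symmetry. An application of wrong arity is stuck on both sides and evaluates to
  bottom, so types do not enter. Eta-expansion does enter the comparison of fixed points: the body
  of \<open>F\<close> hands the eta-expansions of its variables to \<open>g\<close>, whereas the
  plugged procedure keeps the variables themselves. Invariance under eta-expanding arbitrary sets of
  variables is a property of the tree alone, and it takes the place of typing derivations for
  infinite trees.\<close>

definition sh :: "nat \<Rightarrow> nat \<Rightarrow> nat \<Rightarrow> nat" where
  "sh n k v = (if v < n then v else v + k)"

text \<open>The number of binders is handed to the function, since substitution and evaluation need
  the depth of the body that they enter.\<close>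

definition pmap :: "(nat \<Rightarrow> 'a \<Rightarrow> 'b) \<Rightarrow> ty list \<times> 'a \<Rightarrow> ty list \<times> 'b" where
  "pmap f p = (fst p, f (length (fst p)) (snd p))"

lemma pmap_simps [simp]:
  "pmap f (bs, b) = (bs, f (length bs) b)" "fst (pmap f p) = fst p"
  "snd (pmap f p) = f (length (fst p)) (snd p)"
  by (simp_all add: pmap_def)

lemma pmap_pmap [simp]: "pmap f (pmap g p) = pmap (\<lambda>n x. f n (g n x)) p"
  by (simp add: pmap_def)

lemma case_prod_pmap:
  "(\<lambda>(bs, b). (bs, f (length bs) b)) = pmap f" "(\<lambda>(bs, b). (bs, g b)) = pmap (\<lambda>_. g)"
  by (auto simp: pmap_def fun_eq_iff)

section \<open>Coinduction up to equality\<close>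

definition prel :: "('a \<Rightarrow> 'b \<Rightarrow> bool) \<Rightarrow> ty list \<times> 'a \<Rightarrow> ty list \<times> 'b \<Rightarrow> bool" where
  "prel R p q \<longleftrightarrow> fst p = fst q \<and> R (snd p) (snd q)"

lemma prel_simps [simp]: "prel R (pmap f p) (pmap g q) \<longleftrightarrow>
    fst p = fst q \<and> R (f (length (fst p)) (snd p)) (g (length (fst q)) (snd q))"
  "prel R (bs, b) (cs, c) \<longleftrightarrow> bs = cs \<and> R b c"
  by (auto simp: prel_def)

lemma prel_eq: "prel R = rel_prod (=) R"
  by (auto simp: prel_def fun_eq_iff rel_prod_sel)

text \<open>One layer of a bisimulation in the form of introduction rules, so that a corecursive
  identity reduces to a case distinction on the outermost constructor.\<close>

inductive mbis :: "(mexp \<Rightarrow> mexp \<Rightarrow> bool) \<Rightarrow> mexp \<Rightarrow> mexp \<Rightarrow> bool" for R where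
  "mbis R MBot MBot"
| "mbis R (MNum n) (MNum n)"
| "R g g' \<Longrightarrow> (\<And>i. R (es i) (es' i)) \<Longrightarrow> mbis R (MCase g es) (MCase g' es')"
| "list_all2 (prel R) qs qs' \<Longrightarrow> mbis R (MVar x qs) (MVar x qs')"
| "prel R p p' \<Longrightarrow> list_all2 (prel R) qs qs' \<Longrightarrow> mbis R (MApp p qs) (MApp p' qs')"

lemma mexp_coind:
  assumes "R T T'" and step: "\<And>T T'. R T T' \<Longrightarrow> mbis (\<lambda>a b. R a b \<or> a = b) T T'"
  shows "T = T'"
proof -
  have "R T T' \<or> T = T'" using assms(1) by simp
  then show ?thesis
  proof (coinduction arbitrary: T T' rule: mexp.coinduct)
    case Eq_mexp
    have refl: "list_all2 (rel_prod (=) (\<lambda>a b. R a b \<or> a = b)) qs qs" for qs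
      by (rule list.rel_refl_strong) (simp add: rel_prod_sel)
    from Eq_mexp show ?case
    proof
      assume "R T T'"
      from step[OF this] show ?thesis
        by cases (auto simp: prel_eq rel_fun_def)
    next
      assume "T = T'"
      then show ?thesis by (auto simp: refl rel_prod_sel rel_fun_def)
    qed
  qed
qed

text \<open>The bisimulation consists of all pairs \<open>F k T\<close>, \<open>G k T\<close>; the
  index \<open>k\<close> varies because it grows under binders.\<close>

lemma mexp_fun_eqI:
  assumes "\<And>k T. mbis (\<lambda>a b. (\<exists>k T. a = F k T \<and> b = G k T) \<or> a = b) (F k T) (G k T)"
  shows "F k T = G k T"
  by (rule mexp_coind[where R = "\<lambda>a b. \<exists>k T. a = F k T \<and> b = G k T"]) (use assms in \<open>blast+\<close>)

inductive nbis :: "(nexp \<Rightarrow> nexp \<Rightarrow> bool) \<Rightarrow> nexp \<Rightarrow> nexp \<Rightarrow> bool" for R where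
  "nbis R Bot Bot"
| "nbis R (Num n) (Num n)"
| "list_all2 (prel R) qs qs' \<Longrightarrow> (\<And>i. R (es i) (es' i)) \<Longrightarrow> nbis R (Case x qs es) (Case x qs' es')"

lemma nexp_coind:
  assumes "R T T'" and step: "\<And>T T'. R T T' \<Longrightarrow> nbis (\<lambda>a b. R a b \<or> a = b) T T'"
  shows "T = T'"
proof -
  have "R T T' \<or> T = T'" using assms(1) by simp
  then show ?thesis
  proof (coinduction arbitrary: T T' rule: nexp.coinduct)
    case Eq_nexp
    have refl: "list_all2 (rel_prod (=) (\<lambda>a b. R a b \<or> a = b)) qs qs" for qs
      by (rule list.rel_refl_strong) (simp add: rel_prod_sel)
    from Eq_nexp show ?case
    proof
      assume "R T T'"
      from step[OF this] show ?thesis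
        by cases (auto simp: prel_eq rel_fun_def)
    next
      assume "T = T'"
      then show ?thesis by (auto simp: refl rel_prod_sel rel_fun_def)
    qed
  qed
qed

lemma nexp_fun_eqI:
  assumes "\<And>k T. nbis (\<lambda>a b. (\<exists>k T. a = F k T \<and> b = G k T) \<or> a = b) (F k T) (G k T)"
  shows "F k T = G k T"
  by (rule nexp_coind[where R = "\<lambda>a b. \<exists>k T. a = F k T \<and> b = G k T"]) (use assms in \<open>blast+\<close>)

lemma list_all2_map_same: "(\<And>x. x \<in> set xs \<Longrightarrow> R (f x) (g x)) \<Longrightarrow> list_all2 R (map f xs) (map g xs)"
  by (simp add: list.rel_map list.rel_refl_strong list_all2_same)

lemma emb_simps [simp]: "emb Bot = MBot" "emb (Num n) = MNum n"
  "emb (Case x qs es) = MCase (MVar x (map (pmap (\<lambda>_. emb)) qs)) (\<lambda>i. emb (es i))"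
  by (subst emb.code; simp add: case_prod_pmap)+

lemma embp_pmap: "embp = pmap (\<lambda>_. emb)"
  by (simp add: embp_def pmap_def fun_eq_iff)

lemma nren_simps [simp]: "nren \<rho> Bot = Bot" "nren \<rho> (Num n) = Num n"
  "nren \<rho> (Case x qs es) = Case (\<rho> x) (map (pmap (\<lambda>_. nren \<rho>)) qs) (\<lambda>i. nren \<rho> (es i))"
  by (subst nren.code; simp add: case_prod_pmap)+

lemma mren_simps [simp]: "mren \<rho> MBot = MBot" "mren \<rho> (MNum n) = MNum n"
  "mren \<rho> (MCase g es) = MCase (mren \<rho> g) (\<lambda>i. mren \<rho> (es i))"
  "mren \<rho> (MVar x qs) = MVar (\<rho> x) (map (pmap (\<lambda>_. mren \<rho>)) qs)"
  "mren \<rho> (MApp p qs) = MApp (pmap (\<lambda>_. mren \<rho>) p) (map (pmap (\<lambda>_. mren \<rho>)) qs)"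
  by (subst mren.code; simp add: case_prod_pmap split: prod.split)+

lemma mshiftp_pmap: "mshiftp n k = pmap (\<lambda>_. mren (sh n k))"
  by (simp add: mshiftp_def pmap_def fun_eq_iff sh_def[abs_def])

lemma nrepl_simps [simp]: "nrepl g Bot = Bot" "nrepl g (Num n) = g n"
  "nrepl g (Case x qs es) = Case x qs (\<lambda>i. nrepl g (es i))"
  by (subst nrepl.code; simp split: nexp.split)+

lemma mcirc_simps [simp]: "mcirc lo r MBot = MBot" "mcirc lo r (MNum n) = MNum n"
  "mcirc lo r (MCase g es) = MCase (mcirc lo r g) (\<lambda>i. mcirc lo r (es i))"
  "mcirc lo r (MVar x qs) = (if lo \<le> x \<and> x < lo + r then MBot
     else MVar x (map (pmap (\<lambda>_. mcirc lo r)) qs))"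
  "mcirc lo r (MApp p qs) = MApp (pmap (\<lambda>_. mcirc lo r) p) (map (pmap (\<lambda>_. mcirc lo r)) qs)"
  by (subst mcirc.code; simp add: case_prod_pmap split: prod.split)+

lemma msub_simps [simp]: "msub lo r dec s \<theta> k MBot = MBot" "msub lo r dec s \<theta> k (MNum n) = MNum n"
  "msub lo r dec s \<theta> k (MCase g es) = MCase (msub lo r dec s \<theta> k g) (\<lambda>i. msub lo r dec s \<theta> k (es i))"
  "msub lo r dec s \<theta> k (MVar x qs) =
     (if x < lo then MVar x (map (pmap (\<lambda>n. msub lo r dec s \<theta> (k + n))) qs)
      else if x < lo + r then MApp (mshiftp s k (\<theta> (x - lo))) (map (pmap (\<lambda>n. msub lo r dec s \<theta> (k + n))) qs)
      else MVar (x - dec) (map (pmap (\<lambda>n. msub lo r dec s \<theta> (k + n))) qs))"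
  "msub lo r dec s \<theta> k (MApp p qs) =
     MApp (pmap (\<lambda>n. msub lo r dec s \<theta> (k + n)) p) (map (pmap (\<lambda>n. msub lo r dec s \<theta> (k + n))) qs)"
  by (subst msub.code; simp add: case_prod_pmap(1)[where f = "\<lambda>n. msub lo r dec s \<theta> (k + n)"] split: prod.split)+

text \<open>Past the list, a level belongs to a binder inside the term and moves by the difference
  of the two depths. With de Bruijn levels the list therefore stays the same under binders; only the
  procedures in it must be shifted when inserted.\<close>

definition lk :: "nat \<Rightarrow> (nat + mproc) list \<Rightarrow> nat \<Rightarrow> nat + mproc" where
  "lk d us x = (if x < length us then us ! x else Inl (x - length us + d))"

text \<open>The entry \<open>us ! x\<close> is either a variable or a procedure at depth \<open>d\<close>; the source depth is
  \<open>length us\<close>, and all larger levels are bound variables.\<close>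
corec gs :: "nat \<Rightarrow> (nat + mproc) list \<Rightarrow> nat \<Rightarrow> mexp \<Rightarrow> mexp" where
  "gs d us k e = (case e of MBot \<Rightarrow> MBot | MNum n \<Rightarrow> MNum n
     | MCase g es \<Rightarrow> MCase (gs d us k g) (\<lambda>i. gs d us k (es i))
     | MVar x qs \<Rightarrow> (case lk d us x of
           Inl y \<Rightarrow> MVar y (map (\<lambda>(bs,b). (bs, gs d us (k + length bs) b)) qs)
         | Inr p \<Rightarrow> MApp (mshiftp d k p) (map (\<lambda>(bs,b). (bs, gs d us (k + length bs) b)) qs))
     | MApp (hs,h) qs \<Rightarrow> MApp (hs, gs d us (k + length hs) h)
           (map (\<lambda>(bs,b). (bs, gs d us (k + length bs) b)) qs))"

abbreviation gsp :: "nat \<Rightarrow> (nat + mproc) list \<Rightarrow> nat \<Rightarrow> mproc \<Rightarrow> mproc" where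
  "gsp d us k \<equiv> pmap (\<lambda>n. gs d us (k + n))"

lemma gs_simps [simp]: "gs d us k MBot = MBot" "gs d us k (MNum n) = MNum n"
  "gs d us k (MCase g es) = MCase (gs d us k g) (\<lambda>i. gs d us k (es i))"
  "gs d us k (MVar x qs) = (case lk d us x of Inl y \<Rightarrow> MVar y (map (gsp d us k) qs)
      | Inr p \<Rightarrow> MApp (mshiftp d k p) (map (gsp d us k) qs))"
  "gs d us k (MApp p qs) = MApp (gsp d us k p) (map (gsp d us k) qs)"
  by (subst gs.code; simp add: case_prod_pmap(1)[where f = "\<lambda>n. gs d us (k + n)"] split: prod.split sum.split)+

lemma mren_mren: "mren \<rho> (mren \<rho>' T) = mren (\<lambda>x. \<rho> (\<rho>' x)) T"
  by (rule mexp_fun_eqI[where F = "\<lambda>_::unit. \<lambda>T. mren \<rho> (mren \<rho>' T)"])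
    (case_tac T; auto intro!: mbis.intros list_all2_map_same)

lemma mren_id [simp]: "mren (\<lambda>x. x) T = T"
  by (rule mexp_fun_eqI[where F = "\<lambda>_::unit. \<lambda>T. mren (\<lambda>x. x) T" and G = "\<lambda>_ T. T"])
    (case_tac T; auto intro!: mbis.intros list_all2_map_same simp: list.rel_map list_all2_same prel_def)

lemma sh_sh: "mren (sh d k) (mren (sh d j) T) = mren (sh d (k + j)) T"
  by (subst mren_mren) (rule arg_cong[where f = "\<lambda>r. mren r T"], auto simp: sh_def)

lemma sh_0: "mren (sh d 0) T = T"
proof -
  have "sh d 0 = (\<lambda>x. x)" by (auto simp: sh_def)
  then show ?thesis by simp
qed

lemma sh_sh': "mren (sh (d + j) k) (mren (sh d j) T) = mren (sh d (k + j)) T"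
  by (subst mren_mren) (rule arg_cong[where f = "\<lambda>r. mren r T"], auto simp: sh_def)

text \<open>An entry \<open>Inl y\<close> with \<open>y \<ge> d\<close> would collide with the
  levels of bound variables, which \<open>sh d k\<close> moves.\<close>

definition okl :: "nat \<Rightarrow> (nat + mproc) list \<Rightarrow> bool" where
  "okl d us \<longleftrightarrow> (\<forall>y. Inl y \<in> set us \<longrightarrow> y < d)"

lemma okl_simps [simp]: "okl d []" "okl d (Inl y # us) \<longleftrightarrow> y < d \<and> okl d us"
  "okl d (Inr p # us) \<longleftrightarrow> okl d us"
  "okl d (us @ vs) \<longleftrightarrow> okl d us \<and> okl d vs"
  by (auto simp: okl_def)

lemma okl_maps [simp]: "okl d (map (\<lambda>x. Inr (f x)) xs)" "okl d (map Inr qs)"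
  "okl d (map (Inr \<circ> g) ys)" "okl d (map (Inr \<circ> h \<circ> h') zs)"
  "okl d (map Inl ns) \<longleftrightarrow> (\<forall>y\<in>set ns. y < d)"
  by (auto simp: okl_def)

lemma lk_shift:
  assumes "okl d us" "lk d us x = Inl y"
  shows "lk d us (sh (length us) k x) = Inl (sh d k y)"
proof (cases "x < length us")
  case True
  then have "Inl y \<in> set us" using assms(2) nth_mem[OF True] by (simp add: lk_def)
  then show ?thesis using True assms by (auto simp: lk_def okl_def sh_def)
next
  case False
  then show ?thesis using assms by (auto simp: lk_def sh_def)
qed

lemma lk_shift_Inr:
  assumes "lk d us x = Inr p"
  shows "lk d us (sh (length us) k x) = Inr p"
  using assms by (auto simp: lk_def sh_def split: if_splits)

text \<open>A shift by \<open>k\<close> moves only levels of bound variables, on which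
  \<open>lk\<close> is a translation; inserted procedures receive the shifts by \<open>j\<close> and
  by \<open>k\<close> as one shift by \<open>k + j\<close>.\<close>

lemma gs_sh:
  assumes "okl d us"
  shows "gs d us (k + j) (mren (sh (length us) k) T) = mren (sh d k) (gs d us j T)"
proof (rule mexp_fun_eqI[where F = "\<lambda>j T. gs d us (k + j) (mren (sh (length us) k) T)"
     and G = "\<lambda>j T. mren (sh d k) (gs d us j T)"], goal_cases)
  case (1 j T)
  show ?case
  proof (cases T)
    case (MVar x qs)
    show ?thesis
    proof (cases "lk d us x")
      case (Inl y)
      show ?thesis
        unfolding MVar using lk_shift[OF assms Inl, of k] Inl
        by simp (rule mbis.intros, auto intro!: list_all2_map_same simp: add.assoc, blast)
    next
      case (Inr p)
      show ?thesis
        unfolding MVar using lk_shift_Inr[OF Inr, of k] Inr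
        by simp (rule mbis.intros, auto intro!: list_all2_map_same simp: add.assoc mshiftp_pmap sh_sh, blast)
    qed
  qed (auto intro!: mbis.intros list_all2_map_same simp: add.assoc, blast+)
qed

definition cmp :: "nat \<Rightarrow> (nat + mproc) list \<Rightarrow> (nat + mproc) \<Rightarrow> (nat + mproc)" where
  "cmp d us u = (case u of Inl y \<Rightarrow> lk d us y | Inr p \<Rightarrow> Inr (gsp d us 0 p))"

lemma cmp_simps [simp]: "cmp d us (Inl y) = lk d us y" "cmp d us (Inr p) = Inr (gsp d us 0 p)"
  by (simp_all add: cmp_def)

text \<open>A procedure inserted by \<open>us\<close> has been shifted past the \<open>k\<close>
  binders before \<open>vs\<close> acts on it; \<open>gs_sh\<close> exchanges the two
  operations.\<close>

lemma gs_gs: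
  assumes "okl d vs"
  shows "gs d vs k (gs (length vs) us k T) = gs d (map (cmp d vs) us) k T"
proof (rule mexp_fun_eqI[where F = "\<lambda>k T. gs d vs k (gs (length vs) us k T)"
     and G = "\<lambda>k T. gs d (map (cmp d vs) us) k T"], goal_cases)
  case (1 k T)
  show ?case
  proof (cases T)
    case (MVar x qs)
    have lk: "lk d (map (cmp d vs) us) x = cmp d vs (lk (length vs) us x)"
    proof (cases "x < length us")
      case False
      then have "\<not> x - length us + length vs < length vs" by simp
      then show ?thesis using False by (simp add: lk_def cmp_def)
    qed (simp add: lk_def cmp_def)
    show ?thesis
    proof (cases "lk (length vs) us x")
      case (Inl y)
      show ?thesis unfolding MVar
        by (cases "lk d vs y") (auto simp: Inl lk intro!: mbis.intros list_all2_map_same simp: prel_def, blast+)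
    next
      case (Inr p)
      show ?thesis unfolding MVar
        by (auto simp: Inr lk mshiftp_pmap gs_sh[OF assms] intro!: mbis.intros list_all2_map_same simp: prel_def, (blast+)?)
    qed
  qed (auto intro!: mbis.intros list_all2_map_same, (blast+)?)
qed

text \<open>The same substitution seen from below \<open>n\<close> binders that now count as
  context: old entries are weakened, the new variables go to themselves. It reduces statements under
  binders to offset 0.\<close>

definition lift :: "nat \<Rightarrow> nat \<Rightarrow> (nat + mproc) list \<Rightarrow> (nat + mproc) list" where
  "lift d n us = map (map_sum id (mshiftp d n)) us @ map Inl [d..<d+n]"

lemma length_lift [simp]: "length (lift d n us) = length us + n"
  by (simp add: lift_def)

lemma okl_lift: "okl d us \<Longrightarrow> okl (d + n) (lift d n us)"
proof -
  have "y < d + n" if *: "okl d us" "Inl y \<in> map_sum id (mshiftp d n) ` set us" for y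
  proof -
    obtain u where "u \<in> set us" "map_sum id (mshiftp d n) u = Inl y" using *(2) by (metis imageE)
    then show ?thesis using *(1) by (cases u rule: sum.exhaust) (auto simp: okl_def)
  qed
  then show "okl d us \<Longrightarrow> okl (d + n) (lift d n us)"
    by (auto simp: lift_def) (auto simp: okl_def)
qed

lemma lk_lift: "lk (d + n) (lift d n us) x = map_sum id (mshiftp d n) (lk d us x)"
  by (auto simp: lk_def lift_def nth_append)

lemma gs_lift: "gs d us (n + k) T = gs (d + n) (lift d n us) k T"
proof (rule mexp_fun_eqI[where F = "\<lambda>k. gs d us (n + k)" and G = "\<lambda>k. gs (d + n) (lift d n us) k"], goal_cases)
  case (1 k T)
  show ?case
  proof (cases T)
    case (MVar x qs)
    show ?thesis unfolding MVar
      by (cases "lk d us x") (auto simp: lk_lift mshiftp_pmap sh_sh' add.assoc add.commute[of k n] intro!: mbis.intros list_all2_map_same simp: prel_def, metis+)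
  qed (auto simp: add.assoc intro!: mbis.intros list_all2_map_same, (blast+)?)
qed

corollary gs_lift0: "gs d us n T = gs (d + n) (lift d n us) 0 T"
  using gs_lift[of d us n 0] by simp

abbreviation idl :: "nat \<Rightarrow> (nat + mproc) list" where
  "idl n \<equiv> map Inl [0..<n]"

lemma gs_ren:
  assumes "\<And>x. lk d us x = Inl (\<rho> x)"
  shows "gs d us k T = mren \<rho> T"
  by (rule mexp_fun_eqI[where F = "\<lambda>k. gs d us k" and G = "\<lambda>k. mren \<rho>"])
    (case_tac T; auto simp: assms intro!: mbis.intros list_all2_map_same; blast)

lemma lk_idl: "lk d (idl n) x = Inl (if x < n then x else x - n + d)"
  by (simp add: lk_def)

lemma gs_idl_sh: "gs (n + m) (idl n) k T = mren (sh n m) T"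
  by (rule gs_ren) (auto simp: lk_idl sh_def)

lemma gs_idl [simp]: "gs n (idl n) k T = T"
  using gs_ren[of n "idl n" "\<lambda>x. x" k T] by (simp add: lk_idl)

text \<open>The equation on \<open>dec\<close> expresses that a bound level goes to
  \<open>x - dec = x - (lo + r) + s\<close>. It covers contraction, where \<open>dec = r\<close> and
  \<open>s = lo\<close>, as well as the choice \<open>dec = 0\<close>,
  \<open>s = lo + r\<close>.\<close>

lemma msub_gs:
  assumes "us = idl lo @ map (\<lambda>j. Inr (sub j)) [0..<r]" "dec + s = lo + r"
  shows "msub lo r dec s sub k T = gs s us k T"
proof (rule mexp_fun_eqI[where F = "\<lambda>k. msub lo r dec s sub k" and G = "\<lambda>k. gs s us k"], goal_cases)
  case (1 k T)
  have lk: "lk s us x = (if x < lo then Inl x else if x < lo + r then Inr (sub (x - lo)) else Inl (x - dec))" for x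
    using assms(2) by (auto simp: lk_def assms(1) nth_append)
  show ?case
    by (cases T) (auto simp: lk mshiftp_pmap intro!: mbis.intros list_all2_map_same simp: prel_def, blast+)
qed

section \<open>Head evaluation\<close>

datatype (discs_sels) head = HNum nat | HCase nat "mproc list" "nat \<Rightarrow> mexp"

abbreviation beta :: "nat \<Rightarrow> mproc list \<Rightarrow> mexp \<Rightarrow> mexp" where
  "beta D qs \<equiv> gs D (idl D @ map Inr qs) 0"

text \<open>Head reduction in big-step form. The index is a cost that is strictly smaller in every
  premise, not the number of \<open>hstep\<close> steps. A bare variable counts as scrutinised by
  the trivial branches \<open>MNum\<close>.\<close>

inductive cv :: "nat \<Rightarrow> nat \<Rightarrow> mexp \<Rightarrow> head \<Rightarrow> bool" for D where
  cvNum: "cv D 0 (MNum n) (HNum n)"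
| cvVar: "cv D 0 (MVar x qs) (HCase x qs MNum)"
| cvApp: "length qs = length hs \<Longrightarrow> cv D n (beta D qs h) H \<Longrightarrow> cv D (Suc n) (MApp (hs, h) qs) H"
| cvCase1: "cv D n g (HNum j) \<Longrightarrow> cv D m (es j) H \<Longrightarrow> cv D (Suc (n + m)) (MCase g es) H"
| cvCase2: "cv D n g (HCase x qs fs) \<Longrightarrow> cv D (Suc n) (MCase g es) (HCase x qs (\<lambda>i. MCase (fs i) es))"

inductive_cases cv_BotE: "cv D n MBot H"
inductive_cases cv_NumE: "cv D n (MNum m) H"
inductive_cases cv_VarE: "cv D n (MVar x qs) H"
inductive_cases cv_AppE: "cv D n (MApp p qs) H"
inductive_cases cv_CaseE: "cv D n (MCase g es) H"

lemma cv_det: "cv D n T H \<Longrightarrow> cv D n' T H' \<Longrightarrow> H' = H"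
proof (induction arbitrary: n' H' rule: cv.induct)
  case (cvNum n) then show ?case by (auto elim: cv_NumE)
next
  case (cvVar x qs) then show ?case by (auto elim: cv_VarE)
next
  case (cvApp qs hs n h H)
  from cvApp.prems show ?case by (rule cv_AppE) (use cvApp.IH in simp)
next
  case (cvCase1 n g j m es H)
  from cvCase1.prems show ?case
  proof (rule cv_CaseE)
    fix n1 j1 m1 assume "cv D n1 g (HNum j1)" "cv D m1 (es j1) H'"
    then show ?thesis using cvCase1.IH by auto
  next
    fix n1 x qs fs assume "cv D n1 g (HCase x qs fs)"
    then show ?thesis using cvCase1.IH(1) by auto
  qed
next
  case (cvCase2 n g x qs fs es)
  from cvCase2.prems show ?case
  proof (rule cv_CaseE)
    fix n1 j1 assume "cv D n1 g (HNum j1)"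
    then show ?thesis using cvCase2.IH by auto
  next
    fix n1 x1 qs1 fs1 assume "cv D n1 g (HCase x1 qs1 fs1)" "H' = HCase x1 qs1 (\<lambda>i. MCase (fs1 i) es)"
    then show ?thesis using cvCase2.IH by auto
  qed
qed

definition whd :: "nat \<Rightarrow> mexp \<Rightarrow> head option" where
  "whd D T = (if \<exists>n H. cv D n T H then Some (THE H. \<exists>n. cv D n T H) else None)"

lemma whd_Some: "whd D T = Some H \<longleftrightarrow> (\<exists>n. cv D n T H)"
proof
  assume "\<exists>n. cv D n T H"
  then obtain n where n: "cv D n T H" by blast
  have "(THE H. \<exists>n. cv D n T H) = H" using n cv_det by (intro the_equality) blast+
  then show "whd D T = Some H" using n by (auto simp: whd_def)
next
  assume a: "whd D T = Some H"
  then obtain n H' where n: "cv D n T H'" by (auto simp: whd_def split: if_splits)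
  have "(THE H. \<exists>n. cv D n T H) = H'" using n cv_det by (intro the_equality) blast+
  then show "\<exists>n. cv D n T H" using a n by (auto simp: whd_def split: if_splits)
qed

lemma whd_None: "whd D T = None \<longleftrightarrow> (\<forall>n H. \<not> cv D n T H)"
  by (auto simp: whd_def)

text \<open>On an application or variable that is not scrutinised by a \<open>case\<close>, \<open>eval\<close> returns \<open>Bot\<close>, so it is not
  compositional on arbitrary meta-terms. The variant \<open>ev\<close> is, and it agrees with \<open>eval\<close> on meta-terms of sort
  \<open>Expr\<close>, where such ground terms occur only below a \<open>case\<close>.\<close>
corec ev :: "nat \<Rightarrow> mexp \<Rightarrow> nexp" where
  "ev D T = (case whd D T of None \<Rightarrow> Bot | Some H \<Rightarrow> (case H of HNum n \<Rightarrow> Num n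
     | HCase x qs fs \<Rightarrow> Case x (map (\<lambda>(bs,b). (bs, ev (D + length bs) b)) qs) (\<lambda>i. ev D (fs i))))"

abbreviation evp :: "nat \<Rightarrow> mproc \<Rightarrow> nsp" where
  "evp D \<equiv> pmap (\<lambda>n. ev (D + n))"

lemma ev_HNum: "cv D n T (HNum m) \<Longrightarrow> ev D T = Num m"
  using whd_Some[of D T "HNum m"] by (subst ev.code) auto

lemma ev_HCase: "cv D n T (HCase x qs fs) \<Longrightarrow> ev D T = Case x (map (evp D) qs) (\<lambda>i. ev D (fs i))"
  using whd_Some[of D T "HCase x qs fs"]
  by (subst ev.code) (auto simp: case_prod_pmap(1)[where f = "\<lambda>n. ev (D + n)"])

lemma ev_None: "(\<And>n H. \<not> cv D n T H) \<Longrightarrow> ev D T = Bot"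
  using whd_None[of D T] by (subst ev.code) auto

lemma ev_cases:
  obtains (bot) "\<And>n H. \<not> cv D n T H" "ev D T = Bot"
  | (num) n m where "cv D n T (HNum m)" "ev D T = Num m"
  | ("case") n x qs fs where "cv D n T (HCase x qs fs)" "ev D T = Case x (map (evp D) qs) (\<lambda>i. ev D (fs i))"
proof (cases "\<exists>n H. cv D n T H")
  case True
  then obtain n H where "cv D n T H" by blast
  then show thesis by (cases H) (use ev_HNum ev_HCase num "case" in blast)+
next
  case False
  then show thesis using bot ev_None by blast
qed

lemma ev_simps [simp]: "ev D MBot = Bot" "ev D (MNum n) = Num n"
  "ev D (MVar x qs) = Case x (map (evp D) qs) Num"
proof -
  show "ev D MBot = Bot" by (rule ev_None) (auto elim: cv_BotE)
  show "ev D (MNum n) = Num n" by (rule ev_HNum[OF cvNum])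
  then show "ev D (MVar x qs) = Case x (map (evp D) qs) Num"
    using ev_HCase[OF cvVar, of D x qs] by (simp add: ev_HNum[OF cvNum])
qed

lemma ev_same_cv:
  assumes "\<And>H. (\<exists>n. cv D n T H) \<longleftrightarrow> (\<exists>n. cv D n T' H)" shows "ev D T = ev D T'"
proof (cases D T rule: ev_cases)
  case bot
  then have "\<not> cv D n T' H" for n H using assms by blast
  then show ?thesis using bot(2) ev_None by simp
next
  case (num n m)
  then obtain n' where "cv D n' T' (HNum m)" using assms by blast
  then show ?thesis using num(2) ev_HNum by simp
next
  case ("case" n x qs fs)
  then obtain n' where "cv D n' T' (HCase x qs fs)" using assms by blast
  then show ?thesis using "case"(2) ev_HCase by simp
qed

lemma ev_App: "length qs = length hs \<Longrightarrow> ev D (MApp (hs, h) qs) = ev D (beta D qs h)"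
  by (rule ev_same_cv) (auto elim!: cv_AppE intro: cvApp)

text \<open>Case commutation pushes the branches to the rightward leaves of the scrutinee, so only
  the normal forms of scrutinee and branches matter. This turns reasoning about \<open>case\<close>
  into algebra of \<open>nrepl\<close>.\<close>

lemma ev_Case: "ev D (MCase g es) = nrepl (\<lambda>i. ev D (es i)) (ev D g)"
proof (rule nexp_fun_eqI[where F = "\<lambda>_::unit. \<lambda>g. ev D (MCase g es)" and G = "\<lambda>_ g. nrepl (\<lambda>i. ev D (es i)) (ev D g)"])
  fix g
  let ?R = "\<lambda>a b. (\<exists>(k::unit) g. a = ev D (MCase g es) \<and> b = nrepl (\<lambda>i. ev D (es i)) (ev D g)) \<or> a = b"
  show "nbis ?R (ev D (MCase g es)) (nrepl (\<lambda>i. ev D (es i)) (ev D g))"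
  proof (cases D g rule: ev_cases)
    case bot
    then have "ev D (MCase g es) = Bot" by (intro ev_None) (auto elim: cv_CaseE)
    then show ?thesis using bot by (auto intro: nbis.intros)
  next
    case (num n m)
    have "ev D (MCase g es) = ev D (es m)"
    proof (rule ev_same_cv)
      fix H
      show "(\<exists>n. cv D n (MCase g es) H) = (\<exists>n. cv D n (es m) H)"
      proof
        assume "\<exists>n. cv D n (MCase g es) H"
        then show "\<exists>n. cv D n (es m) H"
          using num(1) by (auto elim!: cv_CaseE dest: cv_det)
      qed (use num(1) cvCase1 in blast)
    qed
    moreover have "nbis ?R t t" for t
      by (cases t) (auto intro!: nbis.intros list.rel_refl simp: prel_def)
    ultimately show ?thesis using num by simp
  next
    case ("case" n x qs fs)
    show ?thesis
      by (simp add: ev_HCase[OF cvCase2[OF "case"(1)]] "case"(2))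
        (rule nbis.intros, auto intro!: list.rel_refl simp: prel_def)
  qed
qed

lemma nrepl_nrepl: "nrepl f (nrepl g e) = nrepl (\<lambda>i. nrepl f (g i)) e"
proof (rule nexp_fun_eqI[where F = "\<lambda>_::unit. \<lambda>e. nrepl f (nrepl g e)" and G = "\<lambda>_ e. nrepl (\<lambda>i. nrepl f (g i)) e"], goal_cases)
  case (1 _ e)
  have refl: "nbis (\<lambda>a b. R a b \<or> a = b) t t" for t R
    by (cases t) (auto intro!: nbis.intros list.rel_refl simp: prel_def)
  show ?case
    by (cases e) (auto intro!: refl nbis.intros list.rel_refl simp: prel_def)
qed

lemma nrepl_Num [simp]: "nrepl Num e = e"
proof (rule nexp_fun_eqI[where F = "\<lambda>_::unit. \<lambda>e. nrepl Num e" and G = "\<lambda>_ e. e"], goal_cases)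
  case (1 _ e)
  show ?case
    by (cases e) (auto intro!: nbis.intros list.rel_refl simp: prel_def)
qed

lemma ev_Case_MNum [simp]: "ev D (MCase g MNum) = ev D g"
  by (simp add: ev_Case)

lemma ev_emb [simp]: "ev D (emb e) = e"
proof (rule nexp_fun_eqI[where F = "\<lambda>D e. ev D (emb e)" and G = "\<lambda>D e. e"], goal_cases)
  case (1 D e)
  show ?case
    by (cases e) (auto intro!: nbis.intros list.rel_refl_strong simp: prel_def ev_Case list.rel_map, blast)
qed

section \<open>Agreement of \<open>ev\<close> with \<open>eval\<close> on meta-terms of sort
  \<open>Expr\<close>\<close>

datatype msort = Ground | Expr

coinductive wfm :: "msort \<Rightarrow> mexp \<Rightarrow> bool" where
  wfm_Bot: "wfm c MBot"
| wfm_Num: "wfm c (MNum n)"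
| wfm_Case: "wfm Ground g \<Longrightarrow> \<forall>i. wfm Expr (es i) \<Longrightarrow> wfm c (MCase g es)"
| wfm_Var: "\<forall>q\<in>set qs. wfm Expr (snd q) \<Longrightarrow> wfm Ground (MVar x qs)"
| wfm_App: "wfm Expr (snd p) \<Longrightarrow> \<forall>q\<in>set qs. wfm Expr (snd q) \<Longrightarrow> wfm Ground (MApp p qs)"

lemma wfm_simps [simp]: "wfm b MBot" "wfm b (MNum n)"
  "wfm b (MCase g es) \<longleftrightarrow> wfm Ground g \<and> (\<forall>i. wfm Expr (es i))"
  "wfm b (MVar x qs) \<longleftrightarrow> b = Ground \<and> (\<forall>q\<in>set qs. wfm Expr (snd q))"
  "wfm b (MApp p qs) \<longleftrightarrow> b = Ground \<and> wfm Expr (snd p) \<and> (\<forall>q\<in>set qs. wfm Expr (snd q))"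
  by (subst wfm.simps; auto)+

lemma wfm_emb [simp]: "wfm b (emb e)"
proof -
  \<comment> \<open>The second disjunct is for the scrutinees inside \<open>emb e\<close>, which are
    not themselves of the form \<open>emb e\<close>.\<close>
  have "\<exists>e. (T = emb e) \<or> (b = Ground \<and> (\<exists>x qs. T = MVar x (map (pmap (\<lambda>_. emb)) qs))) \<Longrightarrow> wfm b T" for T
  proof (coinduction arbitrary: b T)
    case wfm
    then show ?case
    proof (elim exE disjE conjE)
      fix e assume "T = emb e"
      then show ?thesis by (cases e) auto
    qed auto
  qed
  then show ?thesis by blast
qed

lemma wfm_mren: "wfm b T \<Longrightarrow> wfm b (mren \<rho> T)"
proof -
  have "\<exists>T. U = mren \<rho> T \<and> wfm b T \<Longrightarrow> wfm b U" for U
  proof (coinduction arbitrary: b U)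
    case wfm
    then obtain T where "U = mren \<rho> T" "wfm b T" by blast
    then show ?case by (cases T) auto
  qed
  then show "wfm b T \<Longrightarrow> wfm b (mren \<rho> T)" by blast
qed

lemma wfm_gs: 
  assumes "\<And>p. Inr p \<in> set us \<Longrightarrow> wfm Expr (snd p)" 
  shows "wfm b T \<Longrightarrow> wfm b (gs d us k T)"
proof -
  have lk: "lk d us x = Inr p \<Longrightarrow> wfm Expr (mren \<rho> (snd p))" for x p \<rho>
    using assms[of p] wfm_mren by (auto simp: lk_def split: if_splits) (metis nth_mem)
  have "\<exists>k T. U = gs d us k T \<and> wfm b T \<Longrightarrow> wfm b U" for U
  proof (coinduction arbitrary: b U)
    case wfm
    then obtain k T where UT: "U = gs d us k T" "wfm b T" by blast
    show ?case 
    proof (cases T)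
      case (MVar x qs)
      then show ?thesis using UT
        by (cases "lk d us x") (auto simp: mshiftp_pmap dest: lk, (metis (no_types))?)
    qed (use UT in auto)
  qed
  then show "wfm b T \<Longrightarrow> wfm b (gs d us k T)" by blast
qed

lemma msub_beta:
  "length hs = length qs \<Longrightarrow> msub D (length hs) (length hs) D (\<lambda>j. qs ! j) 0 h = beta D qs h"
proof (subst msub_gs[OF refl])
  assume "length hs = length qs"
  have "map (\<lambda>j. Inr (qs ! j)) [0..<length qs] = map Inr qs"
    by (rule nth_equalityI) auto
  then show "length hs = length qs \<Longrightarrow> gs D (idl D @ map (\<lambda>j. Inr (qs ! j)) [0..<length hs]) 0 h = beta D qs h"
    by metis
qed simp

text \<open>Under \<open>ev\<close>, case commutation becomes associativity of leaf replacement, and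
  beta becomes \<open>ev_App\<close>.\<close>

lemma hstep_ev: "hstep D T = Some T' \<Longrightarrow> ev D T' = ev D T"
  by (auto simp: hstep_def ev_Case nrepl_nrepl msub_beta ev_App split: mexp.splits prod.splits if_splits)

lemma wfm_Ground: "wfm Expr T \<Longrightarrow> wfm Ground T"
  by (cases T) auto

lemma hstep_wfm: "hstep D T = Some T' \<Longrightarrow> wfm Expr T \<Longrightarrow> wfm Expr T'"
  by (auto simp: hstep_def msub_beta split: mexp.splits prod.splits if_splits
      intro!: wfm_Ground wfm_gs) (metis snd_conv)

abbreviation hred :: "nat \<Rightarrow> mexp \<Rightarrow> mexp \<Rightarrow> bool" where
  "hred D \<equiv> (\<lambda>a b. hstep D a = Some b)\<^sup>*\<^sup>*"

lemma hred_hiter: "hred D T T' \<Longrightarrow> \<exists>m. hiter D m T = T'"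
proof (induction rule: rtranclp_induct)
  case base
  show ?case by (rule exI[of _ 0]) simp
next
  case (step y z)
  then obtain m where "hiter D m T = y" by blast
  then have "hiter D (Suc m) T = z" using step by simp
  then show ?case by blast
qed

text \<open>\<open>hstep\<close> contracts the scrutinee of an enclosing \<open>case\<close> only,
  so a run of \<open>g\<close> is simulated inside one. The branches \<open>es\<close> are arbitrary
  because case commutation accumulates them.\<close>

lemma cv_hred: "cv D n g H \<Longrightarrow> (case H of HNum j \<Rightarrow> hred D (MCase g es) (es j)
   | HCase x qs fs \<Rightarrow> \<exists>es'. hred D (MCase g es) (MCase (MVar x qs) es'))"
proof (induction arbitrary: es rule: cv.induct)
  case (cvNum n) then show ?case by (auto simp: hstep_def)
next
  case (cvVar x qs) then show ?case by auto
next
  case (cvApp qs hs n h H)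
  have "hstep D (MCase (MApp (hs, h) qs) es) = Some (MCase (beta D qs h) es)"
    using cvApp.hyps by (simp add: hstep_def msub_beta)
  then show ?case using cvApp.IH[of es]
    by (cases H) (auto intro: converse_rtranclp_into_rtranclp)
next
  case (cvCase1 n g j m fs H)
  have "hstep D (MCase (MCase g fs) es) = Some (MCase g (\<lambda>i. MCase (fs i) es))"
    by (simp add: hstep_def)
  then have "hred D (MCase (MCase g fs) es) (MCase (fs j) es)"
    using cvCase1.IH(1)[of "\<lambda>i. MCase (fs i) es"] by (auto intro: converse_rtranclp_into_rtranclp)
  then show ?case using cvCase1.IH(2)[of es] by (cases H) (auto dest: rtranclp_trans)
next
  case (cvCase2 n g x qs gs fs)
  have "hstep D (MCase (MCase g fs) es) = Some (MCase g (\<lambda>i. MCase (fs i) es))"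
    by (simp add: hstep_def)
  then show ?case
    using cvCase2.IH(1)[of "\<lambda>i. MCase (fs i) es"] by (auto intro: converse_rtranclp_into_rtranclp)
qed

text \<open>Sort \<open>Expr\<close> excludes a bare variable or application at the top, which
  \<open>hstep\<close> leaves alone and \<open>is_hnf\<close> rejects.\<close>

lemma cv_hnf: "cv D n T H \<Longrightarrow> wfm Expr T \<Longrightarrow> \<exists>T'. hred D T T' \<and> is_hnf T'"
proof (induction rule: cv.induct)
  case (cvNum n) then show ?case by (auto simp: is_hnf_def intro!: exI[of _ "MNum n"])
next
  case (cvCase1 n g j m es H)
  then obtain T' where "hred D (es j) T'" "is_hnf T'" by auto
  then show ?case using cv_hred[OF cvCase1.hyps(1), of es] by (auto dest: rtranclp_trans)
next
  case (cvCase2 n g x qs fs es)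
  then obtain es' where "hred D (MCase g es) (MCase (MVar x qs) es')"
    using cv_hred[OF cvCase2.hyps(1), of es] by auto
  moreover have "is_hnf (MCase (MVar x qs) es')" by (simp add: is_hnf_def)
  ultimately show ?case by blast
qed auto

lemma hiter_ev: "wfm Expr T \<Longrightarrow> wfm Expr (hiter D m T) \<and> ev D (hiter D m T) = ev D T"
  by (induction m) (auto split: option.splits dest: hstep_ev hstep_wfm)

lemma eval_None: "hnf D T = None \<Longrightarrow> eval D T = Bot"
  by (subst eval.code) simp

lemma eval_Some: "hnf D T = Some MBot \<Longrightarrow> eval D T = Bot" "hnf D T = Some (MNum n) \<Longrightarrow> eval D T = Num n"
  "hnf D T = Some (MCase (MVar x qs) es) \<Longrightarrow>
     eval D T = Case x (map (pmap (\<lambda>n. eval (D + n))) qs) (\<lambda>i. eval D (es i))"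
  by (subst eval.code; simp add: case_prod_pmap(1)[where f = "\<lambda>n. eval (D + n)"])+

text \<open>Head steps preserve \<open>ev\<close>, so it can be read off the head normal form; if
  there is none, \<open>cv_hnf\<close> rules out a big-step result as well and both sides are
  bottom.\<close>

lemma eval_ev: "wfm Expr T \<Longrightarrow> eval D T = ev D T"
proof -
  let ?R = "\<lambda>a b. \<exists>D T. a = eval D T \<and> b = ev D T \<and> wfm Expr T"
  have step: "nbis (\<lambda>a b. ?R a b \<or> a = b) (eval D T) (ev D T)" if wf: "wfm Expr T" for D T
  proof (cases "hnf D T")
    case None
    have "\<not> cv D n T H" for n H
    proof
      assume "cv D n T H"
      then obtain T' where "hred D T T'" "is_hnf T'" using cv_hnf wf by blast
      then show False using None hred_hiter by (fastforce simp: hnf_def split: if_splits)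
    qed
    then show ?thesis by (simp add: ev_None eval_None[OF None] nbis.intros)
  next
    case (Some h)
    then obtain m where m: "h = hiter D m T" "is_hnf h"
      by (metis (mono_tags, lifting) LeastI_ex hnf_def option.distinct(1) option.inject)
    have h: "wfm Expr h" "ev D T = ev D h" using hiter_ev[OF wf] m by auto
    consider "h = MBot" | n where "h = MNum n" | x qs es where "h = MCase (MVar x qs) es"
      using m(2) by (auto simp: is_hnf_def split: mexp.splits)
    then show ?thesis
    proof cases
      case 3
      have "ev D T = Case x (map (evp D) qs) (\<lambda>i. ev D (es i))"
        by (simp add: h(2) 3 ev_Case)
      then show ?thesis using h(1) 3 Some
        by (auto simp: eval_Some intro!: nbis.intros list_all2_map_same) (metis snd_conv)
    qed (use Some h in \<open>auto simp: eval_Some intro!: nbis.intros\<close>)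
  qed
  assume "wfm Expr T"
  then show ?thesis
    by (intro nexp_coind[where R = ?R]) (use step in blast)+
qed

section \<open>Compositionality of evaluation\<close>

lemma lk_append_left: "y < length us \<Longrightarrow> lk e (us @ vs) y = lk e us y"
  by (simp add: lk_def nth_append)

lemma map_lk_upt: "length us = n \<Longrightarrow> map (lk e us) [0..<n] = us"
  by (rule nth_equalityI) (auto simp: lk_def)

lemma map_cmp_idl [simp]: "length us = n \<Longrightarrow> map (cmp e us) (idl n) = us"
  using map_lk_upt[of us n e] by (simp add: comp_def)

text \<open>The shifted term does not mention the levels of \<open>vs\<close>, so composition with
  the inclusion of the first levels drops these entries.\<close>

lemma gs_weaken:
  assumes "okl e (us @ vs)"
  shows "gs e (us @ vs) k (mren (sh (length us) (length vs)) T) = gs e us k T"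
proof -
  have "map (cmp e (us @ vs)) (idl (length us)) = us"
    by (rule nth_equalityI) (auto simp: lk_def nth_append)
  then show ?thesis
    using gs_gs[OF assms, of k "idl (length us)" T]
    by (simp add: gs_idl_sh)
qed

lemma map_cmp_lift:
  assumes "length us = d" "length vs = n" "okl e (us @ vs)" "okl d ws"
  shows "map (cmp e (us @ vs)) (lift d n ws) = map (cmp e us) ws @ vs"
proof -
  have "cmp e (us @ vs) (map_sum id (mshiftp d n) u) = cmp e us u" if "u \<in> set ws" for u
  proof (cases u rule: sum.exhaust)
    case (Inl y)
    then have "y < d" using assms(4) that by (auto simp: okl_def)
    then show ?thesis using Inl assms by (simp add: lk_append_left)
  next
    case (Inr p)
    then show ?thesis using gs_weaken[OF assms(3)] assms(1,2) by (auto simp: mshiftp_pmap pmap_def)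
  qed
  moreover have "map (lk e (us @ vs)) [d..<d+n] = vs"
    using assms by (intro nth_equalityI) (auto simp: lk_def nth_append)
  ultimately show ?thesis by (simp add: lift_def comp_def)
qed

text \<open>This is the situation of a beta step: the inner substitution has gone below
  \<open>n\<close> binders whose variables the outer one fills by \<open>vs\<close>. The procedures
  of \<open>ws\<close> were weakened past these binders and never see \<open>vs\<close>.\<close>

lemma gs_gs_lift:
  assumes "length us = d" "length vs = n" "okl e (us @ vs)" "okl d ws"
  shows "gs e (us @ vs) 0 (gs d ws n T) = gs e (map (cmp e us) ws @ vs) 0 T"
  using gs_gs[OF assms(3), of 0 "lift d n ws" T] assms
  by (simp add: gs_lift0[of d ws n] map_cmp_lift)

lemma map_cmp_idl_id: "okl d ws \<Longrightarrow> map (cmp d (idl d)) ws = ws"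
proof -
  have "cmp d (idl d) u = u" if "u \<in> set ws" "okl d ws" for u
    using that by (cases u rule: sum.exhaust) (auto simp: okl_def lk_idl)
  then show "okl d ws \<Longrightarrow> map (cmp d (idl d)) ws = ws"
    by (simp add: map_idI)
qed

text \<open>Both sides fuse into one substitution that sends the context through \<open>us\<close>
  and the bound variables to the instances of \<open>rs\<close>.\<close>

lemma beta_gs:
  assumes "okl d us"
  shows "gs d us 0 (beta (length us) rs h) = beta d (map (gsp d us 0) rs) (gs d us (length rs) h)"
proof -
  have "gs d us 0 (beta (length us) rs h) = gs d (us @ map (\<lambda>r. Inr (gsp d us 0 r)) rs) 0 h"
    using gs_gs[OF assms, of 0 "idl (length us) @ map Inr rs" h] map_lk_upt[of us "length us" d]
    by (simp add: comp_def)
  moreover have "beta d (map (gsp d us 0) rs) (gs d us (length rs) h)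
      = gs d (us @ map (\<lambda>r. Inr (gsp d us 0 r)) rs) 0 h"
    using assms by (subst gs_gs_lift) (auto simp: map_cmp_idl_id comp_def okl_def)
  ultimately show ?thesis by simp
qed

text \<open>Evaluating a substitution instance first evaluates the term itself, and only then,
  if the head variable is substituted, enters the procedure substituted for it.\<close>
definition cont :: "nat \<Rightarrow> (nat + mproc) list \<Rightarrow> nat \<Rightarrow> head \<Rightarrow> head \<Rightarrow> bool" where
  "cont d us n Hb H = (case Hb of HNum j \<Rightarrow> H = HNum j
     | HCase x qs fs \<Rightarrow> (case lk d us x of
         Inl y \<Rightarrow> (\<exists>fs'. H = HCase y (map (gsp d us 0) qs) fs' \<and> (\<forall>i. ev d (fs' i) = ev d (gs d us 0 (fs i))))
       | Inr p \<Rightarrow> (\<exists>n1 Hp. n1 \<le> n \<and> cv d n1 (MApp p (map (gsp d us 0) qs)) Hp \<and>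
           (case Hp of HNum j \<Rightarrow> (\<exists>n2<n. cv d n2 (gs d us 0 (fs j)) H)
             | HCase y rs ks \<Rightarrow> (\<exists>ks'. H = HCase y rs ks' \<and>
                 (\<forall>i. ev d (ks' i) = ev d (MCase (ks i) (\<lambda>j. gs d us 0 (fs j)))))))))"

lemma cont_mono:
  assumes "cont d us n Hb H" "n \<le> n'" shows "cont d us n' Hb H"
proof (cases Hb)
  case (HNum j)
  then show ?thesis using assms by (simp add: cont_def)
next
  case (HCase x qs fs)
  show ?thesis
  proof (cases "lk d us x")
    case (Inl y)
    then show ?thesis using assms by (simp add: HCase cont_def)
  next
    case (Inr p)
    obtain n1 Hp where n1: "n1 \<le> n" "cv d n1 (MApp p (map (gsp d us 0) qs)) Hp"
      "case Hp of HNum j \<Rightarrow> (\<exists>n2<n. cv d n2 (gs d us 0 (fs j)) H)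
             | HCase y rs ks \<Rightarrow> (\<exists>ks'. H = HCase y rs ks' \<and>
                 (\<forall>i. ev d (ks' i) = ev d (MCase (ks i) (\<lambda>j. gs d us 0 (fs j)))))"
      using assms(1) by (auto simp: HCase cont_def Inr)
    have "case Hp of HNum j \<Rightarrow> (\<exists>n2<n'. cv d n2 (gs d us 0 (fs j)) H)
             | HCase y rs ks \<Rightarrow> (\<exists>ks'. H = HCase y rs ks' \<and>
                 (\<forall>i. ev d (ks' i) = ev d (MCase (ks i) (\<lambda>j. gs d us 0 (fs j)))))"
      using n1(3) assms(2) by (cases Hp) (auto intro: less_le_trans)
    then show ?thesis unfolding HCase cont_def head.case Inr sum.case
      using n1(1,2) assms(2) by (blast intro: order_trans)
  qed
qed

lemma mshiftp_0 [simp]: "mshiftp d 0 p = p"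
  by (simp add: mshiftp_pmap pmap_def sh_0)

text \<open>Induction on the cost with a case distinction on \<open>B\<close>. The bound for the
  inserted application is weak because \<open>B\<close> may be the variable itself, but its beta
  step makes the body strictly cheaper; the bound for the branch is strict. The induction in
  \<open>sim_cv\<close> consumes exactly these bounds.\<close>

lemma cv_gs:
  assumes "okl d us" "cv d n (gs d us 0 B) H"
  shows "\<exists>m Hb. cv (length us) m B Hb \<and> cont d us n Hb H"
  using assms(2)
proof (induction n arbitrary: B H rule: less_induct)
  case (less n)
  show ?case
  proof (cases B)
    case MBot
    then show ?thesis using less.prems by (auto elim: cv_BotE)
  next
    case (MNum j)
    then show ?thesis using less.prems by (auto elim!: cv_NumE simp: cont_def intro!: exI cvNum)
  next
    case (MVar x qs)
    have B: "cv (length us) 0 B (HCase x qs MNum)" unfolding MVar by (rule cvVar)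
    have "cont d us n (HCase x qs MNum) H"
    proof (cases "lk d us x")
      case (Inl y)
      then show ?thesis using less.prems by (auto simp: MVar cont_def elim!: cv_VarE)
    next
      case (Inr p)
      have cvp: "cv d n (MApp p (map (gsp d us 0) qs)) H" using less.prems by (simp add: MVar Inr)
      then have "n > 0" by (auto elim: cv_AppE)
      then show ?thesis using cvp Inr
        unfolding cont_def head.case Inr sum.case
        by (intro exI[of _ n] exI[of _ H] conjI) (auto simp: ev_Case intro!: exI[of _ 0] cvNum split: head.splits)
    qed
    then show ?thesis using B by blast
  next
    case (MApp p rs)
    obtain hs h where p: "p = (hs, h)" by force
    obtain n' where n': "n = Suc n'" "length rs = length hs"
      "cv d n' (beta d (map (gsp d us 0) rs) (gs d us (length hs) h)) H"
      using less.prems by (auto simp: MApp p elim!: cv_AppE)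
    have "cv d n' (gs d us 0 (beta (length us) rs h)) H"
      using n' beta_gs[OF assms(1), of rs h] by simp
    from less.IH[OF _ this] n'(1)
    obtain m Hb where "cv (length us) m (beta (length us) rs h) Hb" "cont d us n' Hb H" by auto
    then show ?thesis using n' by (auto simp: MApp p intro!: exI cvApp intro: cont_mono)
  next
    case (MCase g es)
    let ?es = "\<lambda>i. gs d us 0 (es i)"
    have "cv d n (MCase (gs d us 0 g) ?es) H" using less.prems by (simp add: MCase)
    then show ?thesis
    proof (rule cv_CaseE)
      fix n1 j n2 assume n: "n = Suc (n1 + n2)" and g: "cv d n1 (gs d us 0 g) (HNum j)"
        and e: "cv d n2 (?es j) H"
      obtain m Hg where Hg: "cv (length us) m g Hg" "cont d us n1 Hg (HNum j)"
        using less.IH[OF _ g] n by auto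
      show ?thesis
      proof (cases Hg)
        case (HNum l)
        then have "l = j" using Hg by (simp add: cont_def)
        obtain m' Hb where "cv (length us) m' (es j) Hb" "cont d us n2 Hb H"
          using less.IH[OF _ e] n by auto
        moreover have "cont d us n Hb H" using calculation(2) by (rule cont_mono) (use n in simp)
        ultimately show ?thesis using Hg HNum \<open>l = j\<close> unfolding MCase by (blast intro: cvCase1)
      next
        case (HCase x qs fs)
        obtain p where p: "lk d us x = Inr p" using Hg(2) HCase by (auto simp: cont_def split: sum.splits)
        obtain a Hp where "a \<le> n1" "cv d a (MApp p (map (gsp d us 0) qs)) Hp"
          "case Hp of HNum l \<Rightarrow> (\<exists>n2<n1. cv d n2 (gs d us 0 (fs l)) (HNum j))
             | HCase y rs ks \<Rightarrow> (\<exists>ks'. HNum j = HCase y rs ks' \<and>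
                 (\<forall>i. ev d (ks' i) = ev d (MCase (ks i) (\<lambda>j. gs d us 0 (fs j)))))"
          using Hg(2) unfolding HCase cont_def head.case p sum.case by blast
        then obtain l b where a: "a \<le> n1" "cv d a (MApp p (map (gsp d us 0) qs)) (HNum l)"
          "b < n1" "cv d b (gs d us 0 (fs l)) (HNum j)"
          by (auto split: head.splits)
        have "cv d (Suc (b + n2)) (gs d us 0 (MCase (fs l) es)) H"
          using cvCase1[where es = ?es, OF a(4) e] by simp
        \<comment> \<open>The strict bound \<open>b < n1\<close> pays for the \<open>case\<close>
          added around the branch.\<close>
        moreover have "Suc (b + n2) < n" "a \<le> n" using a n by auto
        ultimately have "cont d us n (HCase x qs (\<lambda>i. MCase (fs i) es)) H"
          unfolding cont_def head.case p sum.case using a(2)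
          by (intro exI[of _ a] exI[of _ "HNum l"]) auto
        then show ?thesis using cvCase2[OF Hg(1)[unfolded HCase]] unfolding MCase by blast
      qed
    next
      fix n1 y rs ks assume n: "n = Suc n1" and g: "cv d n1 (gs d us 0 g) (HCase y rs ks)"
        and H: "H = HCase y rs (\<lambda>i. MCase (ks i) ?es)"
      obtain m Hg where Hg: "cv (length us) m g Hg" "cont d us n1 Hg (HCase y rs ks)"
        using less.IH[OF _ g] n by auto
      show ?thesis
      proof (cases Hg)
        case (HNum l)
        then show ?thesis using Hg by (simp add: cont_def)
      next
        case (HCase x qs fs)
        have "cont d us n (HCase x qs (\<lambda>i. MCase (fs i) es)) H"
        proof (cases "lk d us x")
          case (Inl z)
          then show ?thesis using Hg(2) by (auto simp: HCase cont_def H ev_Case)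
        next
          case (Inr p)
          obtain a Hp where a: "a \<le> n1" "cv d a (MApp p (map (gsp d us 0) qs)) Hp"
            and Hp: "case Hp of HNum j \<Rightarrow> (\<exists>n2<n1. cv d n2 (gs d us 0 (fs j)) (HCase y rs ks))
             | HCase y' rs' ks' \<Rightarrow> (\<exists>ks''. HCase y rs ks = HCase y' rs' ks'' \<and>
                 (\<forall>i. ev d (ks'' i) = ev d (MCase (ks' i) (\<lambda>j. gs d us 0 (fs j)))))"
            using Hg(2) by (auto simp: HCase cont_def Inr)
          show ?thesis
          proof (cases Hp)
            case (HNum l)
            then obtain n2 where n2: "n2 < n1" "cv d n2 (gs d us 0 (fs l)) (HCase y rs ks)" using Hp by auto
            have "cv d (Suc n2) (gs d us 0 (MCase (fs l) es)) H"
              using cvCase2[OF n2(2), of ?es] by (simp add: H)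
            then show ?thesis using a n2(1) n unfolding cont_def head.case Inr sum.case
              by (intro exI[of _ a] exI[of _ Hp]) (auto simp: HNum)
          next
            case (HCase y' rs' ks')
            then show ?thesis using a n Hp unfolding cont_def head.case Inr sum.case
              by (intro exI[of _ a] exI[of _ Hp]) (auto simp: H ev_Case nrepl_nrepl)
          qed
        qed
        then show ?thesis using cvCase2[OF Hg(1)[unfolded HCase]] unfolding MCase by blast
      qed
    qed
  qed
qed

text \<open>The converse of \<open>cont\<close>, without bounds. The target property is a parameter
  so that \<open>conv_mono\<close> can carry a statement back from a beta reduct or a selected
  branch. After an inserted procedure with a variable head, branches are fixed only up to
  \<open>ev\<close>, hence the existential \<open>ks'\<close>.\<close>

definition conv :: "nat \<Rightarrow> (nat + mproc) list \<Rightarrow> head \<Rightarrow> (head \<Rightarrow> bool) \<Rightarrow> bool" where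
  "conv d us Hb P \<longleftrightarrow> (case Hb of HNum j \<Rightarrow> P (HNum j)
     | HCase x qs fs \<Rightarrow> (case lk d us x of
         Inl y \<Rightarrow> P (HCase y (map (gsp d us 0) qs) (\<lambda>i. gs d us 0 (fs i)))
       | Inr p \<Rightarrow> (\<forall>n1 Hp. cv d n1 (MApp p (map (gsp d us 0) qs)) Hp \<longrightarrow>
           (case Hp of HNum j \<Rightarrow> (\<forall>n2 H. cv d n2 (gs d us 0 (fs j)) H \<longrightarrow> P H)
             | HCase y rs ks \<Rightarrow> (\<exists>ks'. P (HCase y rs ks') \<and>
                 (\<forall>i. ev d (ks' i) = ev d (MCase (ks i) (\<lambda>j. gs d us 0 (fs j)))))))))"

lemma conv_mono:
  assumes "conv d us Hb P" "\<And>H. P H \<Longrightarrow> Q H" shows "conv d us Hb Q"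
proof (cases Hb)
  case (HNum j)
  then show ?thesis using assms by (simp add: conv_def)
next
  case (HCase x qs fs)
  show ?thesis
  proof (cases "lk d us x")
    case (Inl y)
    then show ?thesis using assms by (simp add: conv_def HCase)
  next
    case (Inr p)
    show ?thesis
      using assms(1) unfolding conv_def HCase head.case Inr sum.case
      by (elim all_forward imp_forward) (auto split: head.splits dest: assms(2))
  qed
qed

lemma cv_gs_conv:
  assumes "okl d us"
  shows "cv (length us) m B Hb \<Longrightarrow> conv d us Hb (\<lambda>H. \<exists>n. cv d n (gs d us 0 B) H)"
proof (induction rule: cv.induct)
  case (cvNum n)
  then show ?case by (auto simp: conv_def intro!: cv.intros exI)
next
  case (cvVar x qs)
  show ?case
  proof (cases "lk d us x")
    case (Inl y)
    then show ?thesis by (auto simp: conv_def intro!: exI cv.cvVar)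
  next
    case (Inr p)
    then show ?thesis by (auto simp: conv_def ev_Case elim!: cv_NumE split: head.splits)
  qed
next
  case (cvApp qs hs n h H)
  have "cv d (Suc n') (gs d us 0 (MApp (hs, h) qs)) H'" if "cv d n' (gs d us 0 (beta (length us) qs h)) H'" for n' H'
    using that cvApp.hyps beta_gs[OF assms, of qs h] by (auto intro!: cv.cvApp)
  then show ?case by (intro conv_mono[OF cvApp.IH]) blast
next
  case (cvCase1 n g j m es H)
  obtain n1 where g: "cv d n1 (gs d us 0 g) (HNum j)" using cvCase1.IH(1) by (auto simp: conv_def)
  have "cv d (Suc (n1 + n')) (gs d us 0 (MCase g es)) H'" if "cv d n' (gs d us 0 (es j)) H'" for n' H'
    using that g by (auto intro!: cv.cvCase1)
  then show ?case by (intro conv_mono[OF cvCase1.IH(2)]) blast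
next
  case (cvCase2 n g x qs fs es)
  let ?es = "\<lambda>i. gs d us 0 (es i)"
  show ?case
  proof (cases "lk d us x")
    case (Inl y)
    then obtain n' where "cv d n' (gs d us 0 g) (HCase y (map (gsp d us 0) qs) (\<lambda>i. gs d us 0 (fs i)))"
      using cvCase2.IH by (auto simp: conv_def)
    from cv.cvCase2[OF this, of ?es] show ?thesis using Inl by (auto simp: conv_def)
  next
    case (Inr p)
    note IH = cvCase2.IH[unfolded conv_def head.case Inr sum.case, rule_format]
    show ?thesis unfolding conv_def head.case Inr sum.case
    proof (intro allI impI)
      fix n1 Hp assume "cv d n1 (MApp p (map (gsp d us 0) qs)) Hp"
      note IH = IH[OF this]
      show "case Hp of HNum j \<Rightarrow> \<forall>n2 H. cv d n2 (gs d us 0 (MCase (fs j) es)) H \<longrightarrow>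
               (\<exists>n. cv d n (gs d us 0 (MCase g es)) H)
          | HCase y rs ks \<Rightarrow> \<exists>ks'. (\<exists>n. cv d n (gs d us 0 (MCase g es)) (HCase y rs ks')) \<and>
                (\<forall>i. ev d (ks' i) = ev d (MCase (ks i) (\<lambda>j. gs d us 0 (MCase (fs j) es))))"
      proof (cases Hp)
        case (HNum j)
        note IH = IH[unfolded HNum head.case, rule_format]
        show ?thesis unfolding HNum head.case gs_simps
        proof (intro allI impI)
          fix n2 H assume "cv d n2 (MCase (gs d us 0 (fs j)) ?es) H"
          then show "\<exists>n. cv d n (MCase (gs d us 0 g) ?es) H"
          proof (rule cv_CaseE)
            fix a i b assume "cv d a (gs d us 0 (fs j)) (HNum i)" "cv d b (?es i) H"
            then show ?thesis using IH cv.cvCase1[where es = ?es] by blast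
          next
            fix a y rs ks assume "cv d a (gs d us 0 (fs j)) (HCase y rs ks)" "H = HCase y rs (\<lambda>i. MCase (ks i) ?es)"
            then show ?thesis using IH cv.cvCase2[where es = ?es] by blast
          qed
        qed
      next
        case (HCase y rs ks)
        obtain n' ks' where k: "cv d n' (gs d us 0 g) (HCase y rs ks')"
          "\<forall>i. ev d (ks' i) = ev d (MCase (ks i) (\<lambda>j. gs d us 0 (fs j)))"
          using IH by (auto simp: HCase)
        then show ?thesis unfolding HCase head.case gs_simps
          using cv.cvCase2[OF k(1), of ?es]
          by (intro exI[of _ "\<lambda>i. MCase (ks' i) ?es"]) (auto simp: ev_Case nrepl_nrepl)
      qed
    qed
  qed
qed

section \<open>The similarity relation and its stability under substitution\<close>

definition prd :: "(nat \<Rightarrow> mexp \<Rightarrow> mexp \<Rightarrow> bool) \<Rightarrow> nat \<Rightarrow> mproc \<Rightarrow> mproc \<Rightarrow> bool" where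
  "prd R d p p' \<longleftrightarrow> fst p = fst p' \<and> R (d + length (fst p)) (snd p) (snd p')"

definition erel :: "(nat \<Rightarrow> mexp \<Rightarrow> mexp \<Rightarrow> bool) \<Rightarrow> nat \<Rightarrow> nat + mproc \<Rightarrow> nat + mproc \<Rightarrow> bool" where
  "erel R d = rel_sum (=) (prd R d)"

lemma erel_simps [simp]: "erel R d (Inl y) (Inl y') \<longleftrightarrow> y = y'" "erel R d (Inr p) (Inr p') \<longleftrightarrow> prd R d p p'"
  "\<not> erel R d (Inl y) (Inr p)" "\<not> erel R d (Inr p) (Inl y)"
  by (simp_all add: erel_def)

lemma prd_mono: "(\<And>d x y. R d x y \<Longrightarrow> R' d x y) \<Longrightarrow> prd R d p q \<Longrightarrow> prd R' d p q"
  by (auto simp: prd_def)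

lemma erel_mono: "(\<And>d x y. R d x y \<Longrightarrow> R' d x y) \<Longrightarrow> erel R d u v \<Longrightarrow> erel R' d u v"
  unfolding erel_def by (erule sum.rel_mono_strong) (auto intro: prd_mono)

lemma list_erel_mono [mono]: "(\<And>d x y. R d x y \<longrightarrow> R' d x y) \<Longrightarrow>
    list_all2 (erel R d) us vs \<longrightarrow> list_all2 (erel R' d) us vs"
  by (auto elim!: list_all2_mono intro: erel_mono)

text \<open>The redex sits in a trivial \<open>case\<close>, which is the form that the body of
  \<open>F\<close> takes once a procedure replaces its variable \<open>g\<close>.\<close>

definition guard :: "nat \<Rightarrow> mexp \<Rightarrow> mexp \<Rightarrow> bool" where
  "guard d T T0 \<longleftrightarrow> T = T0 \<or> (\<exists>hs h qs. T = MCase (MApp (hs, h) qs) MNum \<and> length qs = length hs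
      \<and> T0 = beta d qs h)"

text \<open>The closure of ev-equality under substitution is taken coinductively, so that two procedures
  which unfold recursively into related bodies are related. The optional head redex in \<open>guard\<close> is sound
  because each use of \<open>sim_sub\<close> can only skip one of them.\<close>
coinductive sim :: "nat \<Rightarrow> mexp \<Rightarrow> mexp \<Rightarrow> bool" where
  sim_sub: "guard d T (gs d us 0 B) \<Longrightarrow> guard d T' (gs d us' 0 B') \<Longrightarrow>
     ev (length us) B = ev (length us) B' \<Longrightarrow> okl d us \<Longrightarrow> okl d us' \<Longrightarrow>
     list_all2 (erel sim d) us us' \<Longrightarrow> sim d T T'"
| sim_case: "sim d g g' \<Longrightarrow> (\<And>i. sim d (es i) (es' i)) \<Longrightarrow> sim d (MCase g es) (MCase g' es')"

lemma erel_converse: "list_all2 (erel (\<lambda>d x y. R d y x) d) us us' \<longleftrightarrow> list_all2 (erel R d) us' us"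
proof -
  have "erel (\<lambda>d x y. R d y x) d u u' \<longleftrightarrow> erel R d u' u" for u u'
    by (cases u; cases u') (auto simp: prd_def)
  then show ?thesis by (auto simp: list_all2_conv_all_nth)
qed

text \<open>One layer of \<open>sim\<close> with the recursive occurrences as a parameter, so that
  coinductive steps are proved by introduction rules.\<close>

inductive simF :: "(nat \<Rightarrow> mexp \<Rightarrow> mexp \<Rightarrow> bool) \<Rightarrow> nat \<Rightarrow> mexp \<Rightarrow> mexp \<Rightarrow> bool" for R where
  simF_sub: "guard d T (gs d us 0 B) \<Longrightarrow> guard d T' (gs d us' 0 B') \<Longrightarrow>
     ev (length us) B = ev (length us) B' \<Longrightarrow> okl d us \<Longrightarrow> okl d us' \<Longrightarrow>
     list_all2 (erel R d) us us' \<Longrightarrow> simF R d T T'"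
| simF_case: "R d g g' \<Longrightarrow> (\<And>i. R d (es i) (es' i)) \<Longrightarrow> simF R d (MCase g es) (MCase g' es')"

lemma sim_coind:
  assumes "X d T T'"
    and step: "\<And>d T T'. X d T T' \<Longrightarrow> simF (\<lambda>d T T'. X d T T' \<or> sim d T T') d T T'"
  shows "sim d T T'"
  using assms(1) by (rule sim.coinduct) (drule step, simp only: simF.simps)

lemma sim_simF: "sim d T T' \<Longrightarrow> simF sim d T T'"
  by (subst (asm) sim.simps) (simp only: simF.simps)

text \<open>Needed because \<open>sim_cv\<close> follows runs of the left-hand term only.\<close>

lemma sim_sym: "sim d T T' \<Longrightarrow> sim d T' T"
proof (rule sim_coind[where X = "\<lambda>d T T'. sim d T' T"])
  fix d T T' assume "sim d T' T"
  then have "simF sim d T' T" by (rule sim_simF)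
  then show "simF (\<lambda>d T T'. sim d T' T \<or> sim d T T') d T T'"
  proof cases
    case (simF_sub us B us' B')
    have "list_all2 (erel (\<lambda>d x y. sim d y x) d) us' us"
      by (rule iffD2[OF erel_converse simF_sub(6)])
    then have "list_all2 (erel (\<lambda>d T T'. sim d T' T \<or> sim d T T') d) us' us"
      by (rule list_all2_mono) (erule erel_mono[rotated], blast)
    moreover have "length us' = length us" using list_all2_lengthD[OF simF_sub(6)] by simp
    ultimately show ?thesis
      by (intro simF.simF_sub[OF simF_sub(2,1) _ simF_sub(5,4)]) (simp_all add: simF_sub(3))
  next
    case (simF_case g g' es es')
    show ?thesis unfolding simF_case(1,2)
      by (rule simF.simF_case; rule disjI1; rule simF_case)
  qed
qed

lemma guard_gs: "okl d us \<Longrightarrow> guard (length us) T T0 \<Longrightarrow> guard d (gs d us 0 T) (gs d us 0 T0)"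
  unfolding guard_def
proof (elim disjE exE conjE)
  fix hs h qs assume "okl d us" "T = MCase (MApp (hs, h) qs) MNum" "length qs = length hs" "T0 = beta (length us) qs h"
  then show "gs d us 0 T = gs d us 0 T0 \<or> (\<exists>hs h qs. gs d us 0 T = MCase (MApp (hs, h) qs) MNum \<and>
      length qs = length hs \<and> gs d us 0 T0 = beta d qs h)"
    by (intro disjI2 exI[of _ hs] exI[of _ "gs d us (length hs) h"] exI[of _ "map (gsp d us 0) qs"])
      (simp add: beta_gs)
qed simp

text \<open>Variable entries select related entries of \<open>vs\<close>; procedure entries are
  instantiated below their binders. The resulting relation \<open>R'\<close> may be larger than
  \<open>R\<close> and \<open>Q\<close>, as coinduction up to \<open>sim\<close> requires.\<close>

lemma erel_cmp:
  assumes "list_all2 (erel R d) vs vs'" "okl (length vs) us" "list_all2 (erel Q (length vs)) us us'"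
    and RR: "\<And>d x y. R d x y \<Longrightarrow> R' d x y"
    and QR: "\<And>n T T'. Q (length vs + n) T T' \<Longrightarrow> R' (d + n) (gs d vs n T) (gs d vs' n T')"
  shows "list_all2 (erel R' d) (map (cmp d vs) us) (map (cmp d vs') us')"
proof -
  have "erel R' d (cmp d vs u) (cmp d vs' u')" if u: "u \<in> set us" "erel Q (length vs) u u'" for u u'
  proof (cases u rule: sum.exhaust)
    case (Inl y)
    then have "u' = Inl y" using u(2) by (cases u') auto
    moreover have "y < length vs" using Inl u(1) assms(2) by (auto simp: okl_def)
    moreover have "length vs = length vs'" using assms(1) by (rule list_all2_lengthD)
    moreover have "erel R d (vs ! y) (vs' ! y)"
      using assms(1) calculation(2) by (rule list_all2_nthD)
    then have "erel R' d (vs ! y) (vs' ! y)" by (rule erel_mono[rotated]) (erule RR)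
    ultimately show ?thesis using Inl by (simp add: lk_def)
  next
    case (Inr p)
    then obtain p' where "u' = Inr p'" using u(2) by (cases u') auto
    then show ?thesis using Inr u(2) QR by (auto simp: prd_def)
  qed
  then show ?thesis using assms(3)
    by (auto simp: list_all2_conv_all_nth)
qed

lemma okl_cmp: "okl d vs \<Longrightarrow> okl (length vs) us \<Longrightarrow> okl d (map (cmp d vs) us)"
proof -
  have "y < d" if a: "okl d vs" "okl (length vs) us" "u \<in> set us" "cmp d vs u = Inl y" for u y
    using a by (cases u rule: sum.exhaust) (auto simp: okl_def lk_def split: if_splits, metis nth_mem)
  then show "okl d vs \<Longrightarrow> okl (length vs) us \<Longrightarrow> okl d (map (cmp d vs) us)"
    unfolding okl_def[of d "map _ _"] by (metis (no_types, lifting) image_iff list.set_map)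
qed

text \<open>\<open>V\<close> must be closed under \<open>lift\<close> because substitution continues
  in the bodies of the procedures listed in a \<open>sim_sub\<close> step. Leaving \<open>V\<close>
  open lets one coinduction serve twice: for renamings and, once these have given stability under
  weakening, for all related lists.\<close>

lemma sim_gs_family:
  fixes V :: "nat \<Rightarrow> (nat + mproc) list \<Rightarrow> (nat + mproc) list \<Rightarrow> bool"
  assumes V: "\<And>d vs vs'. V d vs vs' \<Longrightarrow> okl d vs \<and> okl d vs' \<and> list_all2 (erel sim d) vs vs'"
    and Vl: "\<And>d n vs vs'. V d vs vs' \<Longrightarrow> V (d + n) (lift d n vs) (lift d n vs')"
    and "V d vs vs'" "sim (length vs) T T'"
  shows "sim d (gs d vs 0 T) (gs d vs' 0 T')"
proof (rule sim_coind[where X = "\<lambda>d U U'. \<exists>vs vs' T T'. U = gs d vs 0 T \<and> U' = gs d vs' 0 T' \<and> V d vs vs' \<and> sim (length vs) T T'"])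
  let ?X = "\<lambda>d U U'. (\<exists>vs vs' T T'. U = gs d vs 0 T \<and> U' = gs d vs' 0 T' \<and> V d vs vs' \<and> sim (length vs) T T') \<or> sim d U U'"
  fix d U U'
  assume "\<exists>vs vs' T T'. U = gs d vs 0 T \<and> U' = gs d vs' 0 T' \<and> V d vs vs' \<and> sim (length vs) T T'"
  then obtain vs vs' T T' where U: "U = gs d vs 0 T" "U' = gs d vs' 0 T'" and VV: "V d vs vs'" and "sim (length vs) T T'"
    by blast
  note v = V[OF VV]
  have len: "length vs' = length vs" using v list_all2_lengthD by force
  from \<open>sim (length vs) T T'\<close> have "simF sim (length vs) T T'" by (rule sim_simF)
  then have "simF ?X d (gs d vs 0 T) (gs d vs' 0 T')"
  proof cases
    case (simF_sub us B us' B')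
    show ?thesis
    proof (rule simF.simF_sub)
      show "guard d (gs d vs 0 T) (gs d (map (cmp d vs) us) 0 B)"
        using guard_gs[OF _ simF_sub(1), of d] gs_gs[of d vs 0 us B] v by simp
      show "guard d (gs d vs' 0 T') (gs d (map (cmp d vs') us') 0 B')"
        using guard_gs[of d vs' T' "gs (length vs) us' 0 B'"] gs_gs[of d vs' 0 us' B'] v len simF_sub(2) by simp
      show "list_all2 (erel ?X d) (map (cmp d vs) us) (map (cmp d vs') us')"
      proof (rule erel_cmp[where R = sim and Q = sim])
        \<comment> \<open>Procedures of the composed lists are compared below their \<open>n\<close>
          binders, where the lifted pair of lists takes over.\<close>
        fix n T T' assume "sim (length vs + n) T T'"
        then show "?X (d + n) (gs d vs n T) (gs d vs' n T')"
          using Vl[OF VV, of n] unfolding gs_lift0[of d _ n]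
          by (intro disjI1 exI[of _ "lift d n vs"] exI[of _ "lift d n vs'"] exI[of _ T] exI[of _ T']) simp
      qed (use v simF_sub in auto)
      show "okl d (map (cmp d vs) us)" "okl d (map (cmp d vs') us')"
        using okl_cmp v simF_sub len by auto
    qed (use simF_sub(3) in simp)
  next
    case (simF_case g g' es es')
    show ?thesis unfolding simF_case(1,2) gs_simps
    proof (rule simF.simF_case)
      show "?X d (gs d vs 0 g) (gs d vs' 0 g')" using simF_case(3) VV by blast
      show "?X d (gs d vs 0 (es i)) (gs d vs' 0 (es' i))" for i using simF_case(4)[of i] VV by blast
    qed
  qed
  then show "simF ?X d U U'" unfolding U .
qed (use assms(3,4) in blast)

lemma erel_lift:
  assumes "list_all2 (erel R d) us us'"
    and "\<And>m T T'. R (d + m) T T' \<Longrightarrow> R' (d + n + m) (mren (sh d n) T) (mren (sh d n) T')"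
  shows "list_all2 (erel R' (d + n)) (lift d n us) (lift d n us')"
proof -
  have "erel R' (d + n) (map_sum id (mshiftp d n) u) (map_sum id (mshiftp d n) u')" if "erel R d u u'" for u u'
    using that assms(2) by (cases u; cases u') (auto simp: prd_def mshiftp_pmap)
  then show ?thesis unfolding lift_def using assms(1)
    by (intro list_all2_appendI) (auto simp: list_all2_conv_all_nth)
qed

text \<open>Renamings are entrywise equal, so their use of \<open>sim_gs_family\<close> needs no
  prior knowledge of \<open>sim\<close>. For arbitrary related lists, closure under
  \<open>lift\<close> rests on this result.\<close>

lemma sim_ren:
  assumes "sim (d + m) T T'"
  shows "sim (d + n + m) (mren (sh d n) T) (mren (sh d n) T')"
proof -
  let ?V = "\<lambda>d vs vs'. vs = vs' \<and> (\<exists>ys. (vs :: (nat + mproc) list) = map Inl ys \<and> (\<forall>y\<in>set ys. y < (d::nat)))"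
  have "sim (d + n + m) (gs (d + n + m) (lift (d + n) m (idl d)) 0 T) (gs (d + n + m) (lift (d + n) m (idl d)) 0 T')"
  proof (rule sim_gs_family[where V = ?V])
    fix d vs vs' assume "?V d vs vs'"
    then show "okl d vs \<and> okl d vs' \<and> list_all2 (erel sim d) vs vs'"
      by (auto simp: list_all2_conv_all_nth)
  next
    fix d n vs vs' assume "?V d vs vs'"
    then obtain ys where ys: "vs = map Inl ys" "vs' = map Inl ys" "\<forall>y\<in>set ys. y < d" by blast
    have "lift d n vs = map Inl (ys @ [d..<d+n])" by (simp add: lift_def ys)
    then show "?V (d + n) (lift d n vs) (lift d n vs')" using ys
      by (intro conjI exI[of _ "ys @ [d..<d+n]"]) auto
  next
    show "?V (d + n + m) (lift (d + n) m (idl d)) (lift (d + n) m (idl d))"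
      by (intro conjI refl exI[of _ "[0..<d] @ [d + n..<d + n + m]"]) (auto simp: lift_def)
  qed (use assms in \<open>simp add: lift_def\<close>)
  then show ?thesis
    by (simp add: gs_lift0[symmetric] gs_idl_sh)
qed

lemma sim_lift: "list_all2 (erel sim d) us us' \<Longrightarrow> list_all2 (erel sim (d + n)) (lift d n us) (lift d n us')"
  by (erule erel_lift) (rule sim_ren)

lemma sim_gs:
  assumes "okl d vs" "okl d vs'" "list_all2 (erel sim d) vs vs'" "sim (length vs + n) T T'"
  shows "sim (d + n) (gs d vs n T) (gs d vs' n T')"
  unfolding gs_lift0[of d vs n] gs_lift0[of d vs' n]
  by (rule sim_gs_family[where V = "\<lambda>d vs vs'. okl d vs \<and> okl d vs' \<and> list_all2 (erel sim d) vs vs'"])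
    (use assms in \<open>auto intro: okl_lift sim_lift\<close>)

lemma sim_subI:
  assumes "ev (length us) B = ev (length us) B'" "okl d us" "okl d us'" "list_all2 (erel sim d) us us'"
  shows "sim d (gs d us 0 B) (gs d us' 0 B')"
  by (rule sim_sub[OF _ _ assms]) (simp_all add: guard_def)

text \<open>Both terms are identity instances of terms with equal normal forms.\<close>

lemma sim_ev: "ev d T = ev d T' \<Longrightarrow> sim d T T'"
  using sim_subI[of "idl d" T T' d "idl d"] by (simp add: list_all2_conv_all_nth)


section \<open>Related terms have equal normal forms\<close>

definition heq :: "nat \<Rightarrow> head \<Rightarrow> head \<Rightarrow> bool" where
  "heq d H H' \<longleftrightarrow> (case H of HNum j \<Rightarrow> H' = HNum j
     | HCase x qs fs \<Rightarrow> (\<exists>fs'. H' = HCase x qs fs' \<and> (\<forall>i. ev d (fs i) = ev d (fs' i))))"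

lemma heq_refl [simp]: "heq d H H"
  by (auto simp: heq_def split: head.splits)

text \<open>Skipping the redex does not raise the cost, so the induction measure survives; only the
  branches change, by a trivial \<open>case\<close> that \<open>ev\<close> ignores.\<close>

lemma guard_cv:
  assumes "guard d T T0" "cv d n T H"
  shows "\<exists>n0\<le>n. \<exists>H0. cv d n0 T0 H0 \<and> heq d H0 H"
  using assms(1) unfolding guard_def
proof (elim disjE exE conjE)
  assume "T = T0" then show ?thesis using assms(2) by (intro exI[of _ n] conjI exI[of _ H]) simp_all
next
  fix hs h qs assume T: "T = MCase (MApp (hs, h) qs) MNum" "length qs = length hs" "T0 = beta d qs h"
  from assms(2)[unfolded T(1)] show ?thesis
  proof (rule cv_CaseE)
    fix n1 j n2 assume n: "n = Suc (n1 + n2)" and h: "cv d n1 (MApp (hs, h) qs) (HNum j)" and "cv d n2 (MNum j) H"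
    then have "H = HNum j" by (auto elim: cv_NumE)
    from h obtain n0 where "n1 = Suc n0" "cv d n0 T0 H" by (rule cv_AppE) (auto simp: T \<open>H = HNum j\<close>)
    then show ?thesis using n heq_refl by (intro exI[of _ n0]) auto
  next
    fix n1 x rs fs assume n: "n = Suc n1" and h: "cv d n1 (MApp (hs, h) qs) (HCase x rs fs)"
      and H: "H = HCase x rs (\<lambda>i. MCase (fs i) MNum)"
    from h obtain n0 where "n1 = Suc n0" "cv d n0 T0 (HCase x rs fs)" by (rule cv_AppE) (auto simp: T)
    then show ?thesis using n by (intro exI[of _ n0] conjI exI[of _ "HCase x rs fs"]) (auto simp: H heq_def)
  qed
qed

lemma guard_cv_conv:
  assumes "guard d T T0" "cv d n T0 H0"
  shows "\<exists>n H. cv d n T H \<and> heq d H0 H"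
  using assms(1) unfolding guard_def
proof (elim disjE exE conjE)
  assume "T = T0" then show ?thesis using assms(2) heq_refl by blast
next
  fix hs h qs assume T: "T = MCase (MApp (hs, h) qs) MNum" "length qs = length hs" "T0 = beta d qs h"
  have h: "cv d (Suc n) (MApp (hs, h) qs) H0" using cvApp[OF T(2)] assms(2) T(3) by blast
  show ?thesis
  proof (cases H0)
    case (HNum j)
    have "cv d (Suc (Suc n + 0)) T (HNum j)" unfolding T(1)
      by (rule cvCase1) (use h HNum in \<open>auto intro: cvNum\<close>)
    then show ?thesis using HNum heq_refl by blast
  next
    case (HCase x rs fs)
    show ?thesis unfolding T(1)
      by (intro exI conjI, rule cvCase2[OF h[unfolded HCase]]) (simp add: HCase heq_def)
  qed
qed

text \<open>Branches are compared through \<open>F\<close> and \<open>F'\<close> because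
  \<open>cont\<close> and \<open>conv\<close> may determine them only up to \<open>ev\<close>, and
  \<open>sim\<close> is not yet known to absorb equality of normal forms.\<close>

definition hrel :: "nat \<Rightarrow> head \<Rightarrow> head \<Rightarrow> bool" where
  "hrel d H H' \<longleftrightarrow> (case H of HNum j \<Rightarrow> H' = HNum j
     | HCase x qs fs \<Rightarrow> (\<exists>qs' fs'. H' = HCase x qs' fs' \<and> list_all2 (prd sim d) qs qs' \<and>
         (\<forall>i. \<exists>F F'. ev d (fs i) = ev d F \<and> ev d (fs' i) = ev d F' \<and> sim d F F')))"

lemma hrel_HNum [simp]: "hrel d (HNum j) H' \<longleftrightarrow> H' = HNum j"
  by (simp add: hrel_def)

lemma hrel_heq:
  assumes "hrel d H0 H0'" "heq d H0 H" "heq d H0' H'" shows "hrel d H H'"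
proof (cases H0)
  case (HNum j)
  then show ?thesis using assms by (simp add: heq_def)
next
  case (HCase x qs fs)
  then obtain qs' fs' where 1: "H0' = HCase x qs' fs'" "list_all2 (prd sim d) qs qs'"
    "\<And>i. \<exists>F F'. ev d (fs i) = ev d F \<and> ev d (fs' i) = ev d F' \<and> sim d F F'"
    using assms(1) by (auto simp: hrel_def)
  obtain gs where 2: "H = HCase x qs gs" "\<And>i. ev d (fs i) = ev d (gs i)"
    using assms(2) HCase by (auto simp: heq_def)
  obtain gs' where 3: "H' = HCase x qs' gs'" "\<And>i. ev d (fs' i) = ev d (gs' i)"
    using assms(3) 1 by (auto simp: heq_def)
  show ?thesis using 1 by (simp add: 2(1) 3(1) hrel_def 2(2)[symmetric] 3(2)[symmetric])
qed

lemma ev_eq_head: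
  assumes "ev D B = ev D B'" "cv D m B H"
  shows "\<exists>m' H'. cv D m' B' H' \<and> (case H of HNum j \<Rightarrow> H' = HNum j
     | HCase x qs fs \<Rightarrow> (\<exists>qs' fs'. H' = HCase x qs' fs' \<and> map (evp D) qs = map (evp D) qs' \<and>
         (\<forall>i. ev D (fs i) = ev D (fs' i))))"
proof (cases H)
  case (HNum j)
  then show ?thesis using assms ev_HNum[of D m B j] by (cases D B' rule: ev_cases) auto
next
  case (HCase x qs fs)
  have "ev D B' = Case x (map (evp D) qs) (\<lambda>i. ev D (fs i))" using assms ev_HCase HCase by auto
  then show ?thesis using HCase
    by (cases D B' rule: ev_cases) (auto simp: fun_eq_iff, metis)
qed

lemma hrel_HCaseI:
  assumes "list_all2 (prd sim d) qs qs'"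
    "\<And>i. \<exists>F F'. ev d (fs i) = ev d F \<and> ev d (fs' i) = ev d F' \<and> sim d F F'"
  shows "hrel d (HCase x qs fs) (HCase x qs' fs')"
  using assms by (simp add: hrel_def)

text \<open>Induction on the cost of the left run. For \<open>sim_sub\<close> the run is split by
  \<open>cv_gs\<close>; \<open>ev_eq_head\<close> replaces the part that belongs to \<open>B\<close>
  by a run of \<open>B'\<close> of unknown length, and the induction hypothesis is applied only to
  what follows: the body of the inserted procedure, then the branch. \<open>cv_gs_conv\<close>
  reassembles a run of the right-hand instance.\<close>

lemma sim_cv: "sim d T T' \<Longrightarrow> cv d n T H \<Longrightarrow> \<exists>n' H'. cv d n' T' H' \<and> hrel d H H'"
proof (induction n arbitrary: d T T' H rule: less_induct)
  case (less n)
  from less.prems(1) have "simF sim d T T'" by (rule sim_simF)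
  then show ?case
  proof cases
    case (simF_sub us B us' B')
    let ?g = "gs d us 0" and ?g' = "gs d us' 0" and ?D = "length us"
    note okl = simF_sub(4,5)
    have len: "length us' = ?D" using list_all2_lengthD[OF simF_sub(6)] by simp
    have sub: "sim d (?g C) (?g' C')" if "ev ?D C = ev ?D C'" for C C'
      by (rule sim_subI[OF that okl simF_sub(6)])
    \<comment> \<open>Arguments with equal normal forms are \<open>sim\<close>-related before the
      substitution, and \<open>sim_gs\<close> relates their instances.\<close>
    have subp: "list_all2 (prd sim d) (map (gsp d us 0) qs) (map (gsp d us' 0) qs')"
      if e: "map (evp ?D) qs = map (evp ?D) qs'" for qs qs'
    proof -
      have l: "length qs = length qs'" using e by (rule map_eq_imp_length_eq)
      have "prd sim d (gsp d us 0 (qs ! i)) (gsp d us' 0 (qs' ! i))" if i: "i < length qs" for i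
      proof -
        have e: "evp ?D (qs ! i) = evp ?D (qs' ! i)" using e i l by (metis nth_map)
        then have f: "fst (qs ! i) = fst (qs' ! i)" by (metis pmap_simps(2))
        have "sim (?D + length (fst (qs ! i))) (snd (qs ! i)) (snd (qs' ! i))"
          by (rule sim_ev) (use e f in \<open>simp add: pmap_def\<close>)
        from sim_gs[OF okl simF_sub(6) this] show ?thesis by (simp add: prd_def f)
      qed
      then show ?thesis using l by (simp add: list_all2_conv_all_nth)
    qed
    obtain n0 H0 where n0: "n0 \<le> n" "cv d n0 (?g B) H0" "heq d H0 H"
      using guard_cv[OF simF_sub(1) less.prems(2)] by blast
    have "\<exists>n' H'. cv d n' (?g' B') H' \<and> hrel d H0 H'"
    proof -
      obtain m Hb where Hb: "cv ?D m B Hb" "cont d us n0 Hb H0" using cv_gs[OF okl(1) n0(2)] by blast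
      obtain m' Hb' where Hb': "cv ?D m' B' Hb'" and eq: "case Hb of HNum j \<Rightarrow> Hb' = HNum j
         | HCase x qs fs \<Rightarrow> (\<exists>qs' fs'. Hb' = HCase x qs' fs' \<and> map (evp ?D) qs = map (evp ?D) qs' \<and>
             (\<forall>i. ev ?D (fs i) = ev ?D (fs' i)))"
        using ev_eq_head[OF simF_sub(3) Hb(1)] by blast
      have cvn: "conv d us' Hb' (\<lambda>H. \<exists>n. cv d n (?g' B') H)"
        using cv_gs_conv[OF okl(2), of m' B' Hb'] Hb' len by simp
      show ?thesis
      proof (cases Hb)
        case (HNum j)
        then show ?thesis using eq Hb(2) cvn by (auto simp: cont_def conv_def)
      next
        case (HCase x qs fs)
        obtain qs' fs' where Hb'_eq: "Hb' = HCase x qs' fs'" and qs: "map (evp ?D) qs = map (evp ?D) qs'"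
          and fs: "\<And>i. ev ?D (fs i) = ev ?D (fs' i)" using eq HCase by auto
        note cont = Hb(2)[unfolded HCase cont_def head.case]
        note cvn = cvn[unfolded Hb'_eq conv_def head.case]
        have lk: "erel sim d (lk d us x) (lk d us' x)"
          using list_all2_nthD[OF simF_sub(6)] len by (simp add: lk_def)
        show ?thesis
        proof (cases "lk d us x")
          case (Inl y)
          then have "lk d us' x = Inl y" using lk by (cases "lk d us' x") auto
          then obtain n' where n': "cv d n' (?g' B') (HCase y (map (gsp d us' 0) qs') (\<lambda>i. ?g' (fs' i)))"
            using cvn by auto
          obtain ks where H0: "H0 = HCase y (map (gsp d us 0) qs) ks" and ks: "\<And>i. ev d (ks i) = ev d (?g (fs i))"
            using cont Inl by auto
          have "hrel d H0 (HCase y (map (gsp d us' 0) qs') (\<lambda>i. ?g' (fs' i)))"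
            unfolding H0 by (rule hrel_HCaseI[OF subp[OF qs]]) (use ks sub[OF fs] in blast)
          then show ?thesis using n' by blast
        next
          case (Inr p)
          then obtain p' where p': "lk d us' x = Inr p'" "prd sim d p p'" using lk by (cases "lk d us' x") auto
          obtain bs C C' where C: "p = (bs, C)" "p' = (bs, C')" "sim (d + length bs) C C'"
            using p'(2) by (cases p; cases p') (auto simp: prd_def)
          obtain n1 Hp where n1: "n1 \<le> n0" "cv d n1 (MApp p (map (gsp d us 0) qs)) Hp" and
            Hp: "case Hp of HNum j \<Rightarrow> (\<exists>n2<n0. cv d n2 (?g (fs j)) H0)
             | HCase y rs ks \<Rightarrow> (\<exists>ks'. H0 = HCase y rs ks' \<and>
                 (\<forall>i. ev d (ks' i) = ev d (MCase (ks i) (\<lambda>j. ?g (fs j)))))"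
            using cont unfolding Inr sum.case by blast
          obtain n2 where n2: "n1 = Suc n2" "length qs = length bs" "cv d n2 (beta d (map (gsp d us 0) qs) C) Hp"
            using n1(2) unfolding C by (auto elim!: cv_AppE)
          have len_qs: "length qs' = length qs" using qs map_eq_imp_length_eq by metis
          have "sim d (beta d (map (gsp d us 0) qs) C) (beta d (map (gsp d us' 0) qs') C')"
          proof -
            have "list_all2 (erel sim d) (idl d @ map Inr (map (gsp d us 0) qs)) (idl d @ map Inr (map (gsp d us' 0) qs'))"
              using subp[OF qs] by (intro list_all2_appendI) (auto simp: list_all2_conv_all_nth)
            from sim_gs[OF _ _ this, of 0 C C'] show ?thesis using C(3) n2(2) by auto
          qed
          \<comment> \<open>The beta step has used one unit of cost, so \<open>n2 < n\<close> and
            the induction hypothesis applies to the two bodies.\<close>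
          then obtain m1 Hp' where m1: "cv d m1 (beta d (map (gsp d us' 0) qs') C') Hp'" "hrel d Hp Hp'"
            using less.IH[OF _ _ n2(3)] n0(1) n1(1) n2(1) by (meson Suc_le_lessD le_trans)
          have m1': "cv d (Suc m1) (MApp p' (map (gsp d us' 0) qs')) Hp'"
            unfolding C by (rule cvApp) (use m1 n2 len_qs in auto)
          note cvn = cvn[unfolded p'(1) sum.case, rule_format, OF m1']
          show ?thesis
          proof (cases Hp)
            case (HNum j)
            then have "Hp' = HNum j" using m1(2) by simp
            obtain n3 where n3: "n3 < n0" "cv d n3 (?g (fs j)) H0" using Hp HNum by auto
            obtain n4 H4 where "cv d n4 (?g' (fs' j)) H4" "hrel d H0 H4"
              using less.IH[OF _ sub[OF fs] n3(2)] n3(1) n0(1) by (meson less_le_trans)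
            then show ?thesis using cvn[unfolded \<open>Hp' = HNum j\<close> head.case] by blast
          next
            case (HCase y rs ks)
            obtain rs' ks' where Hp': "Hp' = HCase y rs' ks'" "list_all2 (prd sim d) rs rs'"
              and ks: "\<And>i. \<exists>F F'. ev d (ks i) = ev d F \<and> ev d (ks' i) = ev d F' \<and> sim d F F'"
              using m1(2) HCase by (auto simp: hrel_def)
            obtain ls where ls: "H0 = HCase y rs ls" "\<And>i. ev d (ls i) = ev d (MCase (ks i) (\<lambda>j. ?g (fs j)))"
              using Hp HCase by auto
            obtain n' ls' where ls': "cv d n' (?g' B') (HCase y rs' ls')"
              "\<And>i. ev d (ls' i) = ev d (MCase (ks' i) (\<lambda>j. ?g' (fs' j)))"
              using cvn Hp'(1) by auto
            have "hrel d H0 (HCase y rs' ls')" unfolding ls(1)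
            proof (rule hrel_HCaseI[OF Hp'(2)])
              fix i
              obtain F F' where F: "ev d (ks i) = ev d F" "ev d (ks' i) = ev d F'" "sim d F F'" using ks by blast
              show "\<exists>F F'. ev d (ls i) = ev d F \<and> ev d (ls' i) = ev d F' \<and> sim d F F'"
                using F by (intro exI[of _ "MCase F (\<lambda>j. ?g (fs j))"] exI[of _ "MCase F' (\<lambda>j. ?g' (fs' j))"])
                  (auto simp: ls(2) ls'(2) ev_Case intro: sim_case sub[OF fs])
            qed
            then show ?thesis using ls'(1) by blast
          qed
        qed
      qed
    qed
    then obtain n' H0' where "cv d n' (?g' B') H0'" "hrel d H0 H0'" by blast
    moreover then obtain n'' H' where "cv d n'' T' H'" "heq d H0' H'"
      using guard_cv_conv[OF simF_sub(2)] by blast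
    ultimately show ?thesis using hrel_heq n0(3) by blast
  next
    case (simF_case g g' es es')
    from less.prems(2)[unfolded simF_case] show ?thesis
    proof (rule cv_CaseE)
      fix n1 j n2 assume n: "n = Suc (n1 + n2)" "cv d n1 g (HNum j)" "cv d n2 (es j) H"
      obtain m1 where m1: "cv d m1 g' (HNum j)"
        using less.IH[OF _ simF_case(3) n(2)] n(1) by auto
      obtain m2 H' where m2: "cv d m2 (es' j) H'" "hrel d H H'"
        using less.IH[OF _ simF_case(4) n(3)] n(1) by auto
      show ?thesis unfolding simF_case(2) using cvCase1[OF m1, of m2 es'] m2 by blast
    next
      fix n1 x qs fs assume n: "n = Suc n1" "cv d n1 g (HCase x qs fs)" and H: "H = HCase x qs (\<lambda>i. MCase (fs i) es)"
      obtain m1 H1 where m1: "cv d m1 g' H1" "hrel d (HCase x qs fs) H1"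
        using less.IH[OF _ simF_case(3) n(2)] n(1) by auto
      then obtain qs' fs' where H1: "H1 = HCase x qs' fs'" "list_all2 (prd sim d) qs qs'"
        and fs: "\<And>i. \<exists>F F'. ev d (fs i) = ev d F \<and> ev d (fs' i) = ev d F' \<and> sim d F F'"
        by (auto simp: hrel_def)
      have "hrel d H (HCase x qs' (\<lambda>i. MCase (fs' i) es'))" unfolding H
      proof (rule hrel_HCaseI[OF H1(2)])
        fix i
        obtain F F' where F: "ev d (fs i) = ev d F" "ev d (fs' i) = ev d F'" "sim d F F'" using fs by blast
        show "\<exists>F F'. ev d (MCase (fs i) es) = ev d F \<and> ev d (MCase (fs' i) es') = ev d F' \<and> sim d F F'"
          using F by (intro exI[of _ "MCase F es"] exI[of _ "MCase F' es'"])
            (auto simp: ev_Case intro: sim_case simF_case)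
      qed
      then show ?thesis using cvCase2[OF m1(1)[unfolded H1]] unfolding simF_case(2) by blast
    qed
  qed
qed

theorem sim_imp_ev_eq: "sim d T T' \<Longrightarrow> ev d T = ev d T'"
proof (rule nexp_coind[where R = "\<lambda>a b. \<exists>d T T'. a = ev d T \<and> b = ev d T' \<and> sim d T T'"])
  let ?R = "\<lambda>a b. (\<exists>d T T'. a = ev d T \<and> b = ev d T' \<and> sim d T T') \<or> a = b"
  fix a b assume "\<exists>d T T'. a = ev d T \<and> b = ev d T' \<and> sim d T T'"
  then obtain d T T' where ab: "a = ev d T" "b = ev d T'" and sim: "sim d T T'" by blast
  show "nbis ?R a b"
  proof (cases d T rule: ev_cases)
    case bot
    \<comment> \<open>A run of \<open>T'\<close> would give one of \<open>T\<close> by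
      symmetry.\<close>
    have "\<not> cv d n T' H" for n H using sim_cv[OF sim_sym[OF sim]] bot(1) by blast
    then show ?thesis using bot(2) ev_None by (simp add: ab nbis.intros)
  next
    case (num n m)
    then obtain n' where "cv d n' T' (HNum m)" using sim_cv[OF sim] by fastforce
    then show ?thesis using num(2) ev_HNum by (simp add: ab nbis.intros)
  next
    case ("case" n x qs fs)
    obtain n' H' where "cv d n' T' H'" "hrel d (HCase x qs fs) H'"
      using sim_cv[OF sim "case"(1)] by blast
    then obtain qs' fs' where c: "cv d n' T' (HCase x qs' fs')" "list_all2 (prd sim d) qs qs'"
      "\<And>i. \<exists>F F'. ev d (fs i) = ev d F \<and> ev d (fs' i) = ev d F' \<and> sim d F F'"
      by (auto simp: hrel_def)
    have "list_all2 (prel ?R) (map (evp d) qs) (map (evp d) qs')"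
      unfolding list.rel_map using c(2)
      by (rule list_all2_mono) (auto simp: prd_def, blast)
    moreover have "?R (ev d (fs i)) (ev d (fs' i))" for i using c(3)[of i] by auto
    ultimately show ?thesis unfolding ab "case"(2) ev_HCase[OF c(1)] by (rule nbis.intros)
  qed
qed blast

text \<open>Equal normal forms are \<open>sim\<close>-related, \<open>sim\<close> is stable under
  substitution, and related terms have equal normal forms. From here on this is the rule for
  exchanging normal forms inside substitution instances.\<close>

lemma ev_gs_cong:
  assumes "ev (length us + n) B = ev (length us + n) B'" "okl d us" "okl d us'"
    "list_all2 (erel (\<lambda>d T T'. ev d T = ev d T') d) us us'"
  shows "ev (d + n) (gs d us n B) = ev (d + n) (gs d us' n B')"
proof (rule sim_imp_ev_eq, rule sim_gs)
  show "list_all2 (erel sim d) us us'"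
    using assms(4) by (rule list_all2_mono) (erule erel_mono[rotated], erule sim_ev)
qed (use assms sim_ev in auto)

section \<open>Plugging\<close>

lemma pmap_ident: "pmap (\<lambda>_ x. x) p = p" "pmap (\<lambda>_. id) p = p"
  by (simp_all add: pmap_def)

section \<open>The order on meta-terms\<close>

inductive mleF :: "(mexp \<Rightarrow> mexp \<Rightarrow> bool) \<Rightarrow> mexp \<Rightarrow> mexp \<Rightarrow> bool" for R where
  "mleF R MBot e"
| "mleF R (MNum n) (MNum n)"
| "R g g' \<Longrightarrow> (\<And>i. R (es i) (es' i)) \<Longrightarrow> mleF R (MCase g es) (MCase g' es')"
| "list_all2 (prel R) qs qs' \<Longrightarrow> mleF R (MVar x qs) (MVar x qs')"
| "prel R p p' \<Longrightarrow> list_all2 (prel R) qs qs' \<Longrightarrow> mleF R (MApp p qs) (MApp p' qs')"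

lemma mle_coind:
  assumes "X T U" and step: "\<And>T U. X T U \<Longrightarrow> mleF X T U"
  shows "mle T U"
  using assms(1)
proof (rule mle.coinduct)
  fix T U assume "X T U"
  from step[OF this]
  show "(\<exists>e. T = MBot \<and> U = e) \<or> (\<exists>n. T = MNum n \<and> U = MNum n) \<or>
    (\<exists>g g' es es'. T = MCase g es \<and> U = MCase g' es' \<and> (X g g' \<or> mle g g') \<and>
        (\<forall>x. X (es x) (es' x) \<or> mle (es x) (es' x))) \<or>
    (\<exists>qs qs' x. T = MVar x qs \<and> U = MVar x qs' \<and> list_all2 (rel_prod (=) (\<lambda>x1 x2. X x1 x2 \<or> mle x1 x2)) qs qs') \<or>
    (\<exists>h h' qs qs' hs. T = MApp (hs, h) qs \<and> U = MApp (hs, h') qs' \<and> (X h h' \<or> mle h h') \<and>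
        list_all2 (rel_prod (=) (\<lambda>x1 x2. X x1 x2 \<or> mle x1 x2)) qs qs')"
  proof cases
    case 1 then show ?thesis by blast
  next
    case 2 then show ?thesis by blast
  next
    case 3 then show ?thesis by blast
  next
    case (4 qs qs' x)
    have "list_all2 (rel_prod (=) (\<lambda>x1 x2. X x1 x2 \<or> mle x1 x2)) qs qs'"
      using 4(3) by (rule list_all2_mono) (auto simp: prel_def rel_prod_sel)
    then show ?thesis using 4 by blast
  next
    case (5 p p' qs qs')
    have "list_all2 (rel_prod (=) (\<lambda>x1 x2. X x1 x2 \<or> mle x1 x2)) qs qs'"
      using 5(4) by (rule list_all2_mono) (auto simp: prel_def rel_prod_sel)
    moreover obtain hs h h' where "p = (hs, h)" "p' = (hs, h')" "X h h'"
      using 5(3) by (cases p; cases p') (auto simp: prel_def)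
    ultimately show ?thesis using 5 by blast
  qed
qed

lemma mle_mleF: "mle T U \<Longrightarrow> mleF mle T U"
  by (erule mle.cases) (auto simp: prel_eq[symmetric] intro!: mleF.intros)

lemma mle_antisym: "mle T U \<Longrightarrow> mle U T \<Longrightarrow> T = U"
proof (rule mexp_coind[where R = "\<lambda>T U. mle T U \<and> mle U T"])
  fix T U assume "mle T U \<and> mle U T"
  then have "mleF mle T U" "mleF mle U T" by (auto intro: mle_mleF)
  then show "mbis (\<lambda>a b. mle a b \<and> mle b a \<or> a = b) T U"
  proof cases
    case 1
    then show ?thesis using \<open>mleF mle U T\<close> by (auto elim: mleF.cases intro: mbis.intros)
  next
    case 2
    then show ?thesis by (auto intro: mbis.intros)
  next
    case (3 g g' es es')
    then show ?thesis using \<open>mleF mle U T\<close> by (auto elim!: mleF.cases intro!: mbis.intros)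
  next
    case (4 qs qs' x)
    have "list_all2 (prel mle) qs' qs" using \<open>mleF mle U T\<close> 4 by (auto elim: mleF.cases)
    then show ?thesis unfolding 4(1,2) using 4(3)
      by (intro mbis.intros) (auto simp: list_all2_conv_all_nth prel_def)
  next
    case (5 p p' qs qs')
    have "prel mle p' p" "list_all2 (prel mle) qs' qs" using \<open>mleF mle U T\<close> 5 by (auto elim: mleF.cases)
    then show ?thesis unfolding 5(1,2) using 5(3,4)
      by (intro mbis.intros) (auto simp: list_all2_conv_all_nth prel_def)
  qed
qed blast

text \<open>The lub in the definition of plugging is the term obtained by substituting corecursively for all
  variables of \<open>Z\<close>.\<close>
corec pl :: "nat \<Rightarrow> nat \<Rightarrow> (nat \<Rightarrow> nsp) \<Rightarrow> nat \<Rightarrow> mexp \<Rightarrow> mexp" where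
  "pl D r xi k e = (case e of MBot \<Rightarrow> MBot | MNum n \<Rightarrow> MNum n
     | MCase g es \<Rightarrow> MCase (pl D r xi k g) (\<lambda>i. pl D r xi k (es i))
     | MVar x qs \<Rightarrow> (if D \<le> x \<and> x < D + r
         then MApp (fst (xi (x - D)), pl D r xi (k + length (fst (xi (x - D))))
                 (mren (sh (D + r) k) (emb (snd (xi (x - D))))))
               (map (\<lambda>(bs,b). (bs, pl D r xi (k + length bs) b)) qs)
         else MVar x (map (\<lambda>(bs,b). (bs, pl D r xi (k + length bs) b)) qs))
     | MApp (hs,h) qs \<Rightarrow> MApp (hs, pl D r xi (k + length hs) h)
           (map (\<lambda>(bs,b). (bs, pl D r xi (k + length bs) b)) qs))"

abbreviation plp :: "nat \<Rightarrow> nat \<Rightarrow> (nat \<Rightarrow> nsp) \<Rightarrow> nat \<Rightarrow> mproc \<Rightarrow> mproc" where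
  "plp D r xi k \<equiv> pmap (\<lambda>n. pl D r xi (k + n))"

lemma pl_simps [simp]: "pl D r xi k MBot = MBot" "pl D r xi k (MNum n) = MNum n"
  "pl D r xi k (MCase g es) = MCase (pl D r xi k g) (\<lambda>i. pl D r xi k (es i))"
  "pl D r xi k (MVar x qs) = (if D \<le> x \<and> x < D + r
     then MApp (plp D r xi k (mshiftp (D + r) k (embp (xi (x - D))))) (map (plp D r xi k) qs)
     else MVar x (map (plp D r xi k) qs))"
  "pl D r xi k (MApp p qs) = MApp (plp D r xi k p) (map (plp D r xi k) qs)"
  by (subst pl.code; simp add: case_prod_pmap(1)[where f = "\<lambda>n. pl D r xi (k + n)"] mshiftp_pmap embp_pmap pmap_def split: prod.split)+

section \<open>Plugging as a least upper bound and as a substitution\<close>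

context
  fixes D r :: nat and xi :: "nat \<Rightarrow> nsp" and M
  defines "M \<equiv> msub D r 0 (D + r) (\<lambda>j. embp (xi j))"
begin

lemma M_iter: "(M k ^^ m) MBot = MBot" "(M k ^^ m) (MNum n) = MNum n"
  "(M k ^^ m) (MCase g es) = MCase ((M k ^^ m) g) (\<lambda>i. (M k ^^ m) (es i))"
  "\<not> (D \<le> x \<and> x < D + r) \<Longrightarrow> (M k ^^ m) (MVar x qs) = MVar x (map (pmap (\<lambda>n. M (k + n) ^^ m)) qs)"
  "(M k ^^ m) (MApp p qs) = MApp (pmap (\<lambda>n. M (k + n) ^^ m) p) (map (pmap (\<lambda>n. M (k + n) ^^ m)) qs)"
  by (induction m) (auto simp: M_def pmap_ident comp_def intro!: map_idI[symmetric])

text \<open>One round is spent on the variable itself, so \<open>m\<close> rounds remain inside the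
  inserted procedure, while the arguments still undergo all \<open>Suc m\<close>.\<close>

lemma M_iter_Var: "D \<le> x \<Longrightarrow> x < D + r \<Longrightarrow> (M k ^^ Suc m) (MVar x qs) =
   MApp (pmap (\<lambda>n. M (k + n) ^^ m) (mshiftp (D + r) k (embp (xi (x - D)))))
     (map (pmap (\<lambda>n. M (k + n) ^^ Suc m)) qs)"
proof -
  assume x: "D \<le> x" "x < D + r"
  have "(M k ^^ Suc m) (MVar x qs) = (M k ^^ m) (M k (MVar x qs))"
    by (simp only: funpow_Suc_right comp_apply)
  also have "M k (MVar x qs) = MApp (mshiftp (D + r) k (embp (xi (x - D)))) (map (pmap (\<lambda>n. M (k + n))) qs)"
    using x by (simp add: M_def)
  finally show ?thesis
    by (simp add: M_iter(5) funpow_Suc_right del: funpow.simps) (simp add: pmap_def)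
qed

text \<open>After \<open>m\<close> rounds the remaining variables of \<open>Z\<close> are cut to
  bottom, exactly where \<open>pl\<close> goes on.\<close>

lemma mle_pl: "mle (mcirc D r ((M k ^^ m) T)) (pl D r xi k T)"
proof (rule mle_coind[where X = "\<lambda>a b. \<exists>k m T. a = mcirc D r ((M k ^^ m) T) \<and> b = pl D r xi k T"])
  let ?X = "\<lambda>a b. \<exists>k m T. a = mcirc D r ((M k ^^ m) T) \<and> b = pl D r xi k T"
  fix a b assume "?X a b"
  then obtain k m T where ab: "a = mcirc D r ((M k ^^ m) T)" "b = pl D r xi k T" by blast
  show "mleF ?X a b"
  proof (cases T)
    case (MVar x qs)
    show ?thesis
    proof (cases "D \<le> x \<and> x < D + r")
      case False
      then show ?thesis unfolding ab MVar
        by (subst M_iter(4)) (auto intro!: mleF.intros list_all2_map_same, blast+)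
    next
      case True
      show ?thesis
      proof (cases m)
        case 0
        then show ?thesis using True unfolding ab MVar by (auto intro: mleF.intros)
      next
        case (Suc m')
        then show ?thesis using True unfolding ab MVar Suc
          by (subst M_iter_Var) (auto simp del: funpow.simps intro!: mleF.intros list_all2_map_same, blast+)
      qed
    qed
  qed (simp only: ab M_iter; auto intro!: mleF.intros list_all2_map_same; blast)+
qed blast

text \<open>The bound is assumed only from some \<open>m0\<close> on: passing a variable of
  \<open>Z\<close> shifts the round number by one, so a hypothesis about all \<open>m\<close> would
  not be inherited by the subterms.\<close>

lemma pl_least:
  assumes "\<And>m. m \<ge> m0 \<Longrightarrow> mle (mcirc D r ((M k ^^ m) T)) U"
  shows "mle (pl D r xi k T) U"
proof (rule mle_coind[where X = "\<lambda>a U. \<exists>k m0 T. a = pl D r xi k T \<and> (\<forall>m\<ge>m0. mle (mcirc D r ((M k ^^ m) T)) U)"])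
  let ?X = "\<lambda>a U. \<exists>k m0 T. a = pl D r xi k T \<and> (\<forall>m\<ge>m0. mle (mcirc D r ((M k ^^ m) T)) U)"
  fix a U assume "?X a U"
  then obtain k m0 T where a: "a = pl D r xi k T" and m0: "\<And>m. m \<ge> m0 \<Longrightarrow> mleF mle (mcirc D r ((M k ^^ m) T)) U"
    using mle_mleF by blast
  have XI: "?X (pl D r xi k T) U" if "\<And>m. m \<ge> m1 \<Longrightarrow> mle (mcirc D r ((M k ^^ m) T)) U" for k T U m1
    using that by blast
  have XL: "list_all2 (prel ?X) (map (plp D r xi k) qs) qs'"
    if q: "\<And>m. m \<ge> m1 \<Longrightarrow> list_all2 (prel mle) (map (pmap (\<lambda>n x. mcirc D r ((M (k + n) ^^ m) x))) qs) qs'" for qs qs' m1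
  proof -
    have "length qs = length qs'" using list_all2_lengthD[OF q[of m1]] by simp
    moreover have "prel ?X (plp D r xi k (qs ! i)) (qs' ! i)" if i: "i < length qs" for i
    proof -
      have "prel mle (pmap (\<lambda>n x. mcirc D r ((M (k + n) ^^ m) x)) (qs ! i)) (qs' ! i)" if "m \<ge> m1" for m
        using list_all2_nthD[OF q[OF that], of i] i by simp
      then show ?thesis unfolding prel_def by (auto intro!: XI[of m1])
    qed
    ultimately show ?thesis by (simp add: list_all2_conv_all_nth)
  qed
  show "mleF ?X a U"
  proof (cases T)
    case MBot
    then show ?thesis by (auto simp: a intro: mleF.intros)
  next
    case (MNum n)
    then show ?thesis using m0[of m0] by (auto simp: a M_iter elim: mleF.cases intro: mleF.intros)
  next
    case (MCase g es)
    obtain g' es' where U: "U = MCase g' es'"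
      using m0[of m0] by (auto simp: MCase M_iter elim: mleF.cases)
    have "mle (mcirc D r ((M k ^^ m) g)) g'" "mle (mcirc D r ((M k ^^ m) (es i))) (es' i)" if "m \<ge> m0" for m i
      using m0[OF that] by (auto simp: MCase U M_iter elim: mleF.cases)
    then show ?thesis unfolding a MCase U pl_simps by (intro mleF.intros XI[of m0])
  next
    case (MApp p qs)
    obtain p' qs' where U: "U = MApp p' qs'"
      using m0[of m0] by (auto simp: MApp M_iter elim: mleF.cases)
    have 1: "prel mle (pmap (\<lambda>n x. mcirc D r ((M (k + n) ^^ m) x)) p) p'"
      "list_all2 (prel mle) (map (pmap (\<lambda>n x. mcirc D r ((M (k + n) ^^ m) x))) qs) qs'" if "m \<ge> m0" for m
      using m0[OF that] by (auto simp: MApp U M_iter comp_def elim: mleF.cases)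
    have "prel ?X (plp D r xi k p) p'" using 1(1) unfolding prel_def by (auto intro!: XI[of m0])
    then show ?thesis unfolding a MApp U pl_simps using XL[OF 1(2)] by (intro mleF.intros)
  next
    case (MVar x qs)
    show ?thesis
    proof (cases "D \<le> x \<and> x < D + r")
      case False
      obtain qs' where U: "U = MVar x qs'"
        using m0[of m0] False by (auto simp: MVar M_iter elim: mleF.cases)
      have 1: "list_all2 (prel mle) (map (pmap (\<lambda>n x. mcirc D r ((M (k + n) ^^ m) x))) qs) qs'" if "m \<ge> m0" for m
        using m0[OF that] False by (auto simp: MVar U M_iter comp_def elim: mleF.cases)
      show ?thesis unfolding a MVar U pl_simps if_not_P[OF False] by (intro mleF.intros XL[OF 1])
    next
      case True
      let ?p = "mshiftp (D + r) k (embp (xi (x - D)))"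
      have iter: "(M k ^^ Suc m) (MVar x qs) = MApp (pmap (\<lambda>n. M (k + n) ^^ m) ?p)
          (map (pmap (\<lambda>n. M (k + n) ^^ Suc m)) qs)" for m
        by (rule M_iter_Var) (use True in auto)
      have m0': "mleF mle (mcirc D r (MApp (pmap (\<lambda>n. M (k + n) ^^ m) ?p)
          (map (pmap (\<lambda>n. M (k + n) ^^ Suc m)) qs))) U" if "m \<ge> m0" for m
        unfolding iter[symmetric] MVar[symmetric] using m0[of "Suc m"] that by (simp del: funpow.simps)
      obtain p' qs' where U: "U = MApp p' qs'"
        using m0'[of m0] by (auto elim: mleF.cases)
      have 1: "prel mle (pmap (\<lambda>n x. mcirc D r ((M (k + n) ^^ m) x)) ?p) p'"
        "list_all2 (prel mle) (map (pmap (\<lambda>n x. mcirc D r ((M (k + n) ^^ Suc m) x))) qs) qs'" if "m \<ge> m0" for m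
        using m0'[OF that]
        by (auto simp: U comp_def simp del: funpow.simps elim: mleF.cases)
      \<comment> \<open>For the arguments only round numbers of successor form are known, so the
        threshold moves to \<open>Suc m0\<close>.\<close>
      have 2: "list_all2 (prel mle) (map (pmap (\<lambda>n x. mcirc D r ((M (k + n) ^^ m) x))) qs) qs'" if "m \<ge> Suc m0" for m
        using 1(2)[of "m - 1"] that by (cases m) (auto simp del: funpow.simps)
      have "prel ?X (plp D r xi k ?p) p'" using 1(1) unfolding prel_def by (auto intro!: XI[of m0])
      then show ?thesis unfolding a MVar U pl_simps if_P[OF True] using XL[OF 2] by (intro mleF.intros)
    qed
  qed
qed (use assms in blast)

lemma plug_pl: "plug D r e xi = pl D r xi 0 (emb e)"
  unfolding plug_def plug_approx_def
proof (rule the_equality)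
  let ?A = "\<lambda>m. mcirc D r ((msub D r 0 (D + r) (\<lambda>j. embp (xi j)) 0 ^^ m) (emb e))"
  show "(\<forall>m. mle (?A m) (pl D r xi 0 (emb e))) \<and>
      (\<forall>U. (\<forall>m. mle (?A m) U) \<longrightarrow> mle (pl D r xi 0 (emb e)) U)"
    using mle_pl pl_least unfolding M_def by blast
  then show "\<And>T. (\<forall>m. mle (?A m) T) \<and>
      (\<forall>U. (\<forall>m. mle (?A m) U) \<longrightarrow> mle T U) \<Longrightarrow>
      T = pl D r xi 0 (emb e)"
    by (blast intro: mle_antisym)
qed

lemma pl_sh: "pl D r xi (k + j) (mren (sh (D + r) k) T) = mren (sh (D + r) k) (pl D r xi j T)"
proof (rule mexp_fun_eqI[where F = "\<lambda>j T. pl D r xi (k + j) (mren (sh (D + r) k) T)"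
     and G = "\<lambda>j T. mren (sh (D + r) k) (pl D r xi j T)"], goal_cases)
  case (1 j T)
  show ?case
  proof (cases T)
    case (MVar x qs)
    show ?thesis
    proof (cases "D \<le> x \<and> x < D + r")
      case True
      then have "sh (D + r) k x = x" by (simp add: sh_def)
      then show ?thesis unfolding MVar using True
        by (auto intro!: mbis.intros list_all2_map_same simp: mshiftp_pmap sh_sh[symmetric] add.assoc, blast+)
    next
      case False
      then have "\<not> (D \<le> sh (D + r) k x \<and> sh (D + r) k x < D + r)" by (auto simp: sh_def)
      then show ?thesis unfolding MVar using False
        by (simp del: de_Morgan_conj) (rule mbis.intros, auto intro!: list_all2_map_same simp: add.assoc, blast+)
    qed
  qed (auto intro!: mbis.intros list_all2_map_same simp: add.assoc, blast+)
qed

definition plsub :: "(nat + mproc) list" where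
  "plsub = idl D @ map (\<lambda>j. Inr (plp D r xi 0 (embp (xi j)))) [0..<r]"

text \<open>Infinite plugging is one ordinary substitution by procedures that are themselves
  plugged. This brings plugging under the laws of \<open>gs\<close> and under
  compositionality.\<close>

lemma pl_gs: "pl D r xi k T = gs (D + r) plsub k T"
proof (rule mexp_fun_eqI[where F = "pl D r xi" and G = "\<lambda>k. gs (D + r) plsub k"], goal_cases)
  case (1 k T)
  have lk: "lk (D + r) plsub x = (if D \<le> x \<and> x < D + r then Inr (plp D r xi 0 (embp (xi (x - D)))) else Inl x)" for x
    by (auto simp: lk_def plsub_def nth_append)
  show ?case
  proof (cases T)
    case (MVar x qs)
    show ?thesis unfolding MVar
      by (auto simp: lk mshiftp_pmap pl_sh intro!: mbis.intros list_all2_map_same, blast+)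
  qed (auto intro!: mbis.intros list_all2_map_same, blast+)
qed

text \<open>Needed to pass from \<open>eval\<close> to \<open>ev\<close> on the plugged
  term.\<close>

lemma wfm_pl: "wfm b T \<Longrightarrow> wfm b (pl D r xi k T)"
proof -
  have "\<exists>k T. U = pl D r xi k T \<and> wfm b T \<Longrightarrow> wfm b U" for U
  proof (coinduction arbitrary: b U)
    case wfm
    then obtain k T where UT: "U = pl D r xi k T" "wfm b T" by blast
    have e: "wfm Expr (mren \<rho> (emb e))" for \<rho> e by (simp add: wfm_mren)
    show ?case
    proof (cases T)
      case (MVar x qs)
      show ?thesis
      proof (cases "D \<le> x \<and> x < D + r")
        case True
        have "\<exists>k' T. snd (plp D r xi k (mshiftp (D + r) k (embp (xi (x - D))))) = pl D r xi k' T \<and> wfm Expr T"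
          using e by (auto simp: mshiftp_pmap embp_pmap)
        moreover have "\<forall>q\<in>set (map (plp D r xi k) qs). \<exists>k' T. snd q = pl D r xi k' T \<and> wfm Expr T"
          using UT(2) MVar by auto
        moreover have "U = MApp (plp D r xi k (mshiftp (D + r) k (embp (xi (x - D))))) (map (plp D r xi k) qs)" "b = Ground"
          using UT MVar True by auto
        ultimately show ?thesis
          by (intro disjI2 exI[of _ "plp D r xi k (mshiftp (D + r) k (embp (xi (x - D))))"]
              exI[of _ "map (plp D r xi k) qs"]) simp
      next
        case False
        then show ?thesis using UT MVar by auto
      qed
    qed (use UT in auto)
  qed
  then show "wfm b T \<Longrightarrow> wfm b (pl D r xi k T)" by blast
qed

end

section \<open>Eta-expansion\<close>

declare eta.simps [simp del]

lemma idl_add: "idl (d + n) = idl d @ map Inl [d..<d + n]"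
  using upt_add_eq_append[of 0 d n] by simp

text \<open>The shift is composition with the renaming \<open>?r\<close>, which has no entry for the
  levels of \<open>ws\<close>.\<close>

lemma gs_weaken_mid:
  assumes "okl e (us @ ws @ vs)"
  shows "gs e (us @ ws @ vs) k (mren (sh (length us) (length ws)) T) = gs e (us @ vs) k T"
proof -
  let ?a = "length us" and ?m = "length ws" and ?c = "length vs"
  let ?r = "map Inl ([0..<?a] @ [?a + ?m..<?a + ?m + ?c]) :: (nat + mproc) list"
  have "gs (length (us @ ws @ vs)) ?r k T = mren (sh ?a ?m) T"
    by (rule gs_ren) (auto simp: lk_def sh_def nth_append)
  moreover have "map (cmp e (us @ ws @ vs)) ?r = us @ vs"
    by (rule nth_equalityI) (auto simp: lk_def nth_append)
  ultimately show ?thesis using gs_gs[OF assms, of k ?r T] by simp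
qed

lemma fst_eta [simp]: "fst (eta s v D) = args s"
  by (subst eta.simps) simp

abbreviation (input) etl :: "ty list \<Rightarrow> nat \<Rightarrow> mproc list" where
  "etl ss D \<equiv> map (\<lambda>j. embp (eta (ss ! j) (D + j) (D + length ss))) [0..<length ss]"

lemma emb_eta: "emb (snd (eta s v D)) = MCase (MVar v (etl (args s) D)) MNum"
  by (subst eta.simps) (auto simp: embp_pmap)

lemma embp_simps [simp]: "fst (embp p) = fst p" "snd (embp p) = emb (snd p)"
  by (simp_all add: embp_def)

lemma gs_eta_Inl:
  "lk d us v = Inl w \<Longrightarrow> gs d us (k + length (args s)) (emb (snd (eta s v (length us + k)))) = emb (snd (eta s w (d + k)))"
proof (induction s arbitrary: v w k rule: measure_induct_rule[of size])
  case (less s)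
  let ?n = "length (args s)"
  have "gsp d us (k + ?n) (embp (eta (args s ! j) (length us + k + j) (length us + k + ?n)))
      = embp (eta (args s ! j) (d + k + j) (d + k + ?n))" if j: "j < ?n" for j
  proof -
    have "lk d us (length us + k + j) = Inl (d + k + j)" by (simp add: lk_def)
    from less.IH[OF size_args_nth[OF j] this, of "k + ?n"] show ?thesis
      by (simp add: pmap_def embp_def add.assoc)
  qed
  then show ?case unfolding emb_eta using less.prems by (simp del: pmap_simps)
qed

lemma gsp_eta_Inl:
  "lk d us v = Inl w \<Longrightarrow> D = length us + k \<Longrightarrow> gsp d us k (embp (eta s v D)) = embp (eta s w (d + k))"
  using gs_eta_Inl[of d us v w k s] by (simp add: pmap_def embp_def)

lemma mshiftp_eta: "x < d \<Longrightarrow> mshiftp d n (embp (eta s x d)) = embp (eta s x (d + n))"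
  using gsp_eta_Inl[of "d + n" "idl d" x x d 0 s]
  by (simp add: lk_idl mshiftp_pmap pmap_def gs_idl_sh)

lemma gsp_etl: "D = length us + k \<Longrightarrow> map (gsp d us (k + length ss)) (etl ss D) = etl ss (d + k)"
proof -
  assume D: "D = length us + k"
  have "gsp d us (k + length ss) (embp (eta (ss ! j) (D + j) (D + length ss))) = embp (eta (ss ! j) (d + k + j) (d + k + length ss))" for j
    using gsp_eta_Inl[of d us "D + j" "d + k + j" "D + length ss" "k + length ss" "ss ! j"]
    by (simp add: D lk_def add.assoc)
  then show ?thesis by (simp add: comp_def)
qed

text \<open>The head of the eta-expansion becomes a redex, and its contraction feeds the
  eta-expanded bound variables to \<open>C\<close>.\<close>

lemma ev_gs_eta_Inr:
  assumes "lk d us v = Inr (bs, C)" "bs = args s" "D = length us"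
  shows "ev (d + length bs) (gs d us (length bs) (emb (snd (eta s v D))))
    = ev (d + length bs) (gs (d + length bs) (idl d @ map Inr (etl bs d)) 0 C)"
proof -
  let ?n = "length bs"
  have "gs d us ?n (emb (snd (eta s v D))) = MCase (MApp (bs, mren (sh d ?n) C) (etl bs d)) MNum"
    unfolding emb_eta using gsp_etl[of D us 0 d bs] assms by (simp add: mshiftp_pmap)
  then have "ev (d + ?n) (gs d us ?n (emb (snd (eta s v D)))) = ev (d + ?n) (beta (d + ?n) (etl bs d) (mren (sh d ?n) C))"
    by (simp add: ev_App)
  also have "beta (d + ?n) (etl bs d) (mren (sh d ?n) C) = gs (d + ?n) (idl d @ map Inr (etl bs d)) 0 C"
    using gs_weaken_mid[of "d + ?n" "idl d" "map Inl [d..<d + ?n]" "map Inr (etl bs d)" 0 C]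
    by (simp add: idl_add)
  finally show ?thesis .
qed

text \<open>The head stays a variable. Each argument is an eta-expanded variable instantiated by
  some \<open>Q\<close>, which by \<open>ev_gs_eta_Inr\<close> returns \<open>Q\<close> with
  eta-expansions for its own bound variables.\<close>

lemma ev_gs_eta_saturated:
  assumes "lk d us v = Inl w" "v < length us" "D = length us"
    "map fst Qs = map args (args s)"
  shows "ev d (gs d (us @ map Inr Qs) 0 (emb (snd (eta s v D)))) =
    Case w (map (\<lambda>Q. (fst Q, ev (d + length (fst Q)) (gs (d + length (fst Q)) (idl d @ map Inr (etl (fst Q) d)) 0 (snd Q)))) Qs) Num"
proof -
  let ?us = "us @ map Inr Qs"
  have len: "length Qs = length (args s)" using assms(4) map_eq_imp_length_eq by metis
  have "evp d (gsp d ?us 0 (embp (eta (args s ! j) (D + j) (D + length (args s))))) =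
     (fst (Qs ! j), ev (d + length (fst (Qs ! j))) (gs (d + length (fst (Qs ! j))) (idl d @ map Inr (etl (fst (Qs ! j)) d)) 0 (snd (Qs ! j))))"
    if j: "j < length Qs" for j
  proof -
    have fst: "fst (Qs ! j) = args (args s ! j)" using assms(4) j len by (metis nth_map)
    have "lk d ?us (D + j) = Inr (fst (Qs ! j), snd (Qs ! j))" using j by (simp add: lk_def nth_append assms(3))
    from ev_gs_eta_Inr[OF this fst, of "D + length (args s)"]
    show ?thesis by (simp add: fst pmap_def len assms(3))
  qed
  then have "map (\<lambda>j. evp d (gsp d ?us 0 (embp (eta (args s ! j) (D + j) (D + length (args s)))))) [0..<length (args s)]
     = map (\<lambda>Q. (fst Q, ev (d + length (fst Q)) (gs (d + length (fst Q)) (idl d @ map Inr (etl (fst Q) d)) 0 (snd Q)))) Qs"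
    by (intro nth_equalityI) (simp_all add: len)
  then show ?thesis unfolding emb_eta using assms(1,2)
    by (simp add: lk_append_left ev_Case comp_def del: pmap_simps pmap_pmap)
qed

section \<open>Invariance under eta-expansion of variables\<close>

abbreviation evs :: "nat \<Rightarrow> (nat + mproc) list \<Rightarrow> nexp \<Rightarrow> nexp" where
  "evs d us e \<equiv> ev d (gs d us 0 (emb e))"

abbreviation evu :: "nat \<Rightarrow> (nat + mproc) list \<Rightarrow> nat \<Rightarrow> nexp \<Rightarrow> nexp" where
  "evu d us n e \<equiv> ev (d + n) (gs d us n (emb e))"

definition esub :: "ty list \<Rightarrow> nat set \<Rightarrow> (nat + mproc) list" where
  "esub G B = map (\<lambda>x. if x \<in> B then Inr (embp (eta (G ! x) x (length G))) else Inl x) [0..<length G]"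

text \<open>Expanding a head variable also expands the variables bound in its arguments, whereas an
  unexpanded head leaves those alone. A fixed choice of variables is thus not stable when descending
  into the tree; the quantifier over all \<open>B\<close> is.\<close>

definition gd :: "ty list \<Rightarrow> nexp \<Rightarrow> bool" where
  "gd G e \<longleftrightarrow> (\<forall>B. evs (length G) (esub G B) e = e)"

text \<open>This invariance is all that is needed of well-typedness.\<close>
definition good :: "ty list \<Rightarrow> nsp \<Rightarrow> bool" where
  "good G p \<longleftrightarrow> gd (G @ fst p) (snd p)"

lemma good_list:
  assumes "length qs = length ss" "\<And>i. i < length ss \<Longrightarrow> fst (qs ! i) = args (ss ! i) \<and> good G (qs ! i)"
  shows "map fst qs = map args ss" "q \<in> set qs \<Longrightarrow> good G q"
proof -
  show "map fst qs = map args ss" by (rule nth_equalityI) (simp_all add: assms)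
  show "q \<in> set qs \<Longrightarrow> good G q" using assms by (metis in_set_conv_nth)
qed

lemma length_esub [simp]: "length (esub G B) = length G"
  by (simp add: esub_def)

lemma okl_esub [simp]: "okl (length G) (esub G B)"
  by (auto simp: esub_def okl_def split: if_splits)

lemma nth_esub: "x < length G \<Longrightarrow> esub G B ! x = (if x \<in> B then Inr (embp (eta (G ! x) x (length G))) else Inl x)"
  by (simp add: esub_def)

lemma esub_append:
  "esub (G @ bs) B = map (map_sum id (mshiftp (length G) (length bs))) (esub G B)
     @ map (\<lambda>j. if length G + j \<in> B then Inr (embp (eta (bs ! j) (length G + j) (length G + length bs))) else Inl (length G + j)) [0..<length bs]"
  by (rule nth_equalityI) (auto simp: nth_esub nth_append mshiftp_eta)

lemma lift_esub: "lift (length G) (length bs) (esub G B) = esub (G @ bs) (B \<inter> {..<length G})"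
  unfolding lift_def esub_append
  by (rule arg_cong2[where f = append]) (auto intro!: nth_equalityI simp: nth_esub esub_def)

lemma esub_append_eta: "esub (G @ bs) (B \<inter> {..<length G} \<union> {length G..}) =
    map (map_sum id (mshiftp (length G) (length bs))) (esub G B) @ map Inr (etl bs (length G))"
  unfolding esub_append
  by (rule arg_cong2[where f = append]) (auto intro!: nth_equalityI simp: nth_esub)

lemma esub_empty [simp]: "esub G {} = idl (length G)"
  by (simp add: esub_def)

lemma map_cmp_idl_shift: "okl d us \<Longrightarrow> map (cmp (d + n) (idl d)) us = map (map_sum id (mshiftp d n)) us"
proof -
  have "cmp (d + n) (idl d) u = map_sum id (mshiftp d n) u" if "u \<in> set us" "okl d us" for u
    using that by (cases u rule: sum.exhaust) (auto simp: okl_def lk_idl mshiftp_pmap pmap_def gs_idl_sh)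
  then show "okl d us \<Longrightarrow> map (cmp (d + n) (idl d)) us = map (map_sum id (mshiftp d n)) us" by simp
qed

text \<open>Expansion acts componentwise on one layer. The set \<open>F\<close> for the arguments
  contains their bound variables precisely when the head \<open>x\<close> is expanded.\<close>

lemma ev_esub_Case:
  assumes "x < length G" "map fst qs = map args (args (G ! x))"
  shows "\<exists>F. evs (length G) (esub G B) (Case x qs es) =
    Case x (map (\<lambda>q. (fst q, evs (length (G @ fst q)) (esub (G @ fst q) F) (snd q))) qs)
      (\<lambda>i. evs (length G) (esub G B) (es i))"
proof (cases "x \<in> B")
  case False
  have "lk (length G) (esub G B) x = Inl x" using assms(1) False by (simp add: lk_def nth_esub)
  moreover have "map (\<lambda>q. (fst q, ev (length G + length (fst q)) (gs (length G) (esub G B) (length (fst q)) (emb (snd q))))) qs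
    = map (\<lambda>q. (fst q, evs (length (G @ fst q)) (esub (G @ fst q) (B \<inter> {..<length G})) (snd q))) qs"
    by (simp add: gs_lift0[of "length G" "esub G B" "length _"] lift_esub)
  ultimately show ?thesis
    by (intro exI[of _ "B \<inter> {..<length G}"]) (simp add: ev_Case comp_def pmap_def)
next
  case True
  let ?d = "length G" and ?s = "G ! x"
  let ?Q = "map (gsp (length G) (esub G B) 0) (map embp qs)"
  have len: "length qs = length (args ?s)" using assms(2) map_eq_imp_length_eq by metis
  have fst: "map fst ?Q = map args (args ?s)" using assms(2) by (simp add: comp_def)
  have "lk ?d (esub G B) x = Inr (embp (eta ?s x ?d))" using assms(1) True by (simp add: lk_def nth_esub)
  then have "evs ?d (esub G B) (Case x qs es) = nrepl (\<lambda>i. evs ?d (esub G B) (es i))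
     (ev ?d (MApp (embp (eta ?s x ?d)) ?Q))"
    by (simp add: ev_Case embp_pmap comp_def)
  also have "ev ?d (MApp (embp (eta ?s x ?d)) ?Q) = ev ?d (beta ?d ?Q (emb (snd (eta ?s x ?d))))"
    unfolding embp_def by (rule ev_App) (simp add: len)
  also have "\<dots> = Case x (map (\<lambda>Q. (fst Q, ev (?d + length (fst Q)) (gs (?d + length (fst Q)) (idl ?d @ map Inr (etl (fst Q) ?d)) 0 (snd Q)))) ?Q) Num"
    by (rule ev_gs_eta_saturated[OF _ _ _ fst]) (use assms(1) in \<open>auto simp: lk_idl\<close>)
  also have "map (\<lambda>Q. (fst Q, ev (?d + length (fst Q)) (gs (?d + length (fst Q)) (idl ?d @ map Inr (etl (fst Q) ?d)) 0 (snd Q)))) ?Q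
    = map (\<lambda>q. (fst q, evs (length (G @ fst q)) (esub (G @ fst q) (B \<inter> {..<?d} \<union> {?d..})) (snd q))) qs"
    by (simp add: esub_append_eta gs_gs_lift map_cmp_idl_shift)
  finally show ?thesis by auto
qed

text \<open>Goodness for the set of the bound variables alone: a good procedure applied to
  eta-expanded fresh variables returns its body.\<close>

lemma good_eta_cancel:
  assumes "good G q"
  shows "evs (length G + length (fst q)) (idl (length G) @ map Inr (etl (fst q) (length G))) (snd q) = snd q"
proof -
  have "map (map_sum id (mshiftp (length G) (length (fst q)))) (esub G {}) = idl (length G)" by simp
  then have "esub (G @ fst q) ({} \<inter> {..<length G} \<union> {length G..}) = idl (length G) @ map Inr (etl (fst q) (length G))"
    by (simp only: esub_append_eta)
  then show ?thesis using assms unfolding good_def gd_def by (metis length_append)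
qed

lemma gd_Case:
  assumes "x < length G" "map fst qs = map args (args (G ! x))" "\<And>q. q \<in> set qs \<Longrightarrow> good G q" "\<And>i. gd G (es i)"
  shows "gd G (Case x qs es)"
  unfolding gd_def
proof
  fix B
  obtain F where F: "evs (length G) (esub G B) (Case x qs es) =
    Case x (map (\<lambda>q. (fst q, evs (length (G @ fst q)) (esub (G @ fst q) F) (snd q))) qs)
      (\<lambda>i. evs (length G) (esub G B) (es i))"
    using ev_esub_Case[OF assms(1,2)] by blast
  have "map (\<lambda>q. (fst q, evs (length (G @ fst q)) (esub (G @ fst q) F) (snd q))) qs = qs"
    by (rule map_idI) (use assms(3) in \<open>auto simp: good_def gd_def\<close>)
  moreover have "evs (length G) (esub G B) (es i) = es i" for i using assms(4) gd_def by blast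
  ultimately show "evs (length G) (esub G B) (Case x qs es) = Case x qs es"
    unfolding F by simp
qed

lemma gd_Num [simp]: "gd G (Num n)" and gd_Bot [simp]: "gd G Bot"
  by (simp_all add: gd_def)

lemma good_eta: "x < length G \<Longrightarrow> good G (eta (G ! x) x (length G))"
proof (induction "G ! x" arbitrary: G x rule: measure_induct_rule[of size])
  case less
  let ?s = "G ! x" and ?n = "length (args (G ! x))"
  have "good (G @ args ?s) (eta (args ?s ! j) (length G + j) (length G + ?n))" if j: "j < ?n" for j
    using less.hyps[of "G @ args ?s" "length G + j"] size_args_nth[OF j] j by (simp add: nth_append)
  then have "gd (G @ args ?s) (snd (eta ?s x (length G)))"
    by (subst eta.simps, simp, intro gd_Case) (use less.prems in \<open>auto simp: nth_append intro!: nth_equalityI\<close>)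
  then show ?case by (simp add: good_def)
qed

abbreviation inrs :: "nsp list \<Rightarrow> (nat + mproc) list" where
  "inrs \<equiv> map (Inr \<circ> embp)"

text \<open>The eta-expansions that \<open>ev_gs_eta_saturated\<close> leaves on the arguments
  cancel by goodness.\<close>

lemma ev_eta_saturated_good:
  assumes "lk d us v = Inl w" "v < length us" "D = length us" "length G = d"
    "map fst qs = map args (args s)" "\<And>q. q \<in> set qs \<Longrightarrow> good G q"
  shows "evs d (us @ inrs qs) (snd (eta s v D)) = Case w qs Num"
proof -
  have "evs d (us @ map Inr (map embp qs)) (snd (eta s v D)) =
    Case w (map (\<lambda>Q. (fst Q, ev (d + length (fst Q)) (gs (d + length (fst Q)) (idl d @ map Inr (etl (fst Q) d)) 0 (snd Q)))) (map embp qs)) Num"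
    by (rule ev_gs_eta_saturated) (use assms in \<open>auto simp: comp_def\<close>)
  moreover have "map (\<lambda>Q. (fst Q, ev (d + length (fst Q)) (gs (d + length (fst Q)) (idl d @ map Inr (etl (fst Q) d)) 0 (snd Q)))) (map embp qs) = qs"
    unfolding map_map using assms(4,6) good_eta_cancel by (intro map_idI) (auto simp: prod_eq_iff)
  ultimately show ?thesis by simp
qed

text \<open>Here both the head and the arguments of an eta-expanded variable are substituted. The
  head redex fires, and by goodness the instantiated eta-expansions have the same normal forms as
  the \<open>qs\<close>.\<close>

lemma ev_eta_head:
  assumes "lk d us v = Inr (embp p)" "v < length us" "D = length us" "length G = d" "fst p = args s"
    "map fst qs = map args (args s)" "\<And>q. q \<in> set qs \<Longrightarrow> good G q"
  shows "evs d (us @ inrs qs) (snd (eta s v D))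
    = evs d (idl d @ inrs qs) (snd p)"
proof -
  let ?us = "us @ inrs qs"
  let ?Q = "map (gsp d ?us 0) (etl (args s) D)"
  have len: "length qs = length (args s)" using assms(6) map_eq_imp_length_eq by metis
  have "gs d ?us 0 (emb (snd (eta s v D))) = MCase (MApp (embp p) ?Q) MNum"
    unfolding emb_eta using assms(1,2) by (simp add: lk_append_left)
  then have "evs d ?us (snd (eta s v D)) = ev d (beta d ?Q (emb (snd p)))"
    using ev_App[of ?Q "fst p" d "emb (snd p)"] assms(5) len by (simp add: embp_def)
  also have "\<dots> = evs d (idl d @ inrs qs) (snd p)"
  proof -
    have "erel (\<lambda>d T T'. ev d T = ev d T') d (Inr (?Q ! j)) (Inr (embp (qs ! j)))" if j: "j < length qs" for j
    proof -
      have fst: "fst (qs ! j) = args (args s ! j)" using assms(6) j len by (metis nth_map)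
      have "lk d ?us (D + j) = Inr (fst (qs ! j), emb (snd (qs ! j)))" using j by (simp add: lk_def nth_append assms(3) embp_def)
      from ev_gs_eta_Inr[OF this fst, of "D + length (args s)"] good_eta_cancel[OF assms(7)[OF nth_mem[OF j]]]
      show ?thesis using j len assms(3,4) by (simp add: prd_def fst)
    qed
    then have "list_all2 (erel (\<lambda>d T T'. ev d T = ev d T') d) (idl d @ map Inr ?Q) (idl d @ inrs qs)"
      by (intro list_all2_appendI) (auto simp: list_all2_conv_all_nth len)
    from ev_gs_cong[OF _ _ _ this, of 0] show ?thesis by simp
  qed
  finally show ?thesis .
qed

section \<open>Normalising before substitution\<close>

abbreviation ev_rel :: "nat \<Rightarrow> nat + mproc \<Rightarrow> nat + mproc \<Rightarrow> bool" where
  "ev_rel \<equiv> erel (\<lambda>d T T'. ev d T = ev d T')"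

lemma ev_rel_refl [simp]: "ev_rel d u u"
  by (cases u) (auto simp: prd_def)

lemma list_ev_rel_refl [simp]: "list_all2 (ev_rel d) us us"
  by (simp add: list_all2_conv_all_nth)

text \<open>\<open>T\<close> and \<open>emb (ev D T)\<close> have the same normal form, so
  \<open>ev_gs_cong\<close> allows intermediate normalisation to be inserted or removed. Application
  of NSPs normalises each time, which makes this necessary.\<close>

lemma ev_gs_emb_ev:
  assumes "okl d us" "D = length us + n"
  shows "evu d us n (ev D T) = ev (d + n) (gs d us n T)"
  by (rule ev_gs_cong) (use assms in auto)

lemma emb_nren: "emb (nren \<rho> e) = mren \<rho> (emb e)"
proof -
  let ?R = "\<lambda>a b. (\<exists>e. a = emb (nren \<rho> e) \<and> b = mren \<rho> (emb e)) \<or>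
    (\<exists>x qs. a = MVar x (map (\<lambda>q. pmap (\<lambda>_. emb) (pmap (\<lambda>_. nren \<rho>) q)) qs) \<and> b = MVar x (map (\<lambda>q. pmap (\<lambda>_. mren \<rho>) (pmap (\<lambda>_. emb) q)) qs))"
  show ?thesis
  proof (rule mexp_coind[where R = ?R])
    fix a b assume "?R a b"
    then show "mbis (\<lambda>a b. ?R a b \<or> a = b) a b"
    proof (elim disjE exE conjE)
      fix e assume a: "a = emb (nren \<rho> e)" "b = mren \<rho> (emb e)"
      show ?thesis
      proof (cases e)
        case (Case x qs es)
        show ?thesis unfolding a Case
          by simp (rule mbis.intros, auto simp: comp_def)
      qed (auto simp: a intro: mbis.intros)
    next
      fix x qs assume a: "a = MVar x (map (\<lambda>q. pmap (\<lambda>_. emb) (pmap (\<lambda>_. nren \<rho>) q)) qs)"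
        "b = MVar x (map (\<lambda>q. pmap (\<lambda>_. mren \<rho>) (pmap (\<lambda>_. emb) q)) qs)"
      show ?thesis unfolding a by (auto intro!: mbis.intros list_all2_map_same)
    qed
  qed blast
qed

lemma nshift_sh: "nshift n k = nren (sh n k)"
  by (simp add: nshift_def sh_def[abs_def])

lemma emb_nshift: "emb (nshift n k e) = mren (sh n k) (emb e)"
  by (simp add: nshift_sh emb_nren)

lemma nren_nren: "nren \<rho> (nren \<rho>' e) = nren (\<lambda>x. \<rho> (\<rho>' x)) e"
proof (rule nexp_fun_eqI[where F = "\<lambda>_::unit. \<lambda>e. nren \<rho> (nren \<rho>' e)" and G = "\<lambda>_ e. nren (\<lambda>x. \<rho> (\<rho>' x)) e"], goal_cases)
  case (1 _ e)
  show ?case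
    by (cases e) (auto intro!: nbis.intros list_all2_map_same)
qed

lemma nren_id [simp]: "nren (\<lambda>x. x) e = e"
proof (rule nexp_fun_eqI[where F = "\<lambda>_::unit. \<lambda>e. nren (\<lambda>x. x) e" and G = "\<lambda>_ e. e"], goal_cases)
  case (1 _ e)
  show ?case
    by (cases e) (auto intro!: nbis.intros list.rel_refl_strong simp: list.rel_map prel_def)
qed

lemma nshift_0 [simp]: "nshift n 0 e = e"
proof -
  have "(\<lambda>v. if v < n then v else v + 0) = (\<lambda>v. v)" by auto
  then show ?thesis by (simp add: nshift_def del: add_0_right)
qed

lemma nunshift_nshift: "nunshift n k (nshift n k e) = e"
proof -
  have "(\<lambda>x. (\<lambda>v. if v < n then v else v - k) (if x < n then x else x + k)) = (\<lambda>x. x)"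
    by auto
  then show ?thesis unfolding nunshift_def nshift_def nren_nren by simp
qed

lemma ev_shift: "ev (d + k + n) (mren (sh d k) T) = nshift d k (ev (d + n) T)"
proof -
  have "ev (d + k + n) (mren (sh d k) T) = ev (d + k + n) (gs (d + k) (idl d) n T)"
    by (simp add: gs_idl_sh)
  also have "\<dots> = ev (d + k + n) (gs (d + k) (idl d) n (emb (ev (d + n) T)))"
    by (rule ev_gs_emb_ev[symmetric]) auto
  also have "\<dots> = nshift d k (ev (d + n) T)"
    by (simp add: gs_idl_sh flip: emb_nshift)
  finally show ?thesis .
qed

lemma app_gs:
  assumes "fst p = t # ts"
  shows "app D p q = (ts, ev (D + length ts) (gs D (idl D @ [Inr (embp q)]) (length ts) (emb (snd p))))"
proof -
  have "msub D 1 1 D (\<lambda>_. embp q) (length ts) (emb (snd p)) = gs D (idl D @ [Inr (embp q)]) (length ts) (emb (snd p))"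
    by (rule msub_gs) simp_all
  moreover have "wfm Expr (gs D (idl D @ [Inr (embp q)]) (length ts) (emb (snd p)))"
    by (rule wfm_gs) auto
  ultimately show ?thesis using assms by (simp add: app_def eval_ev)
qed

text \<open>An expansion after the substitution is pulled back before it: expanding a variable that
  replaces \<open>x\<close> amounts to expanding \<open>x\<close> first, an inserted procedure
  absorbs expansions by its own goodness, and the bound variables correspond one to one.\<close>

lemma good_subst:
  assumes g: "good G' (bs, e)" and len: "length us = length G'"
    and us: "\<And>x. x < length G' \<Longrightarrow> (\<exists>y<length G. us ! x = Inl y \<and> G ! y = G' ! x) \<or> (\<exists>p. us ! x = Inr (embp p) \<and> good G p)"
  shows "good G (bs, ev (length G + length bs) (gs (length G) us (length bs) (emb e)))"
  unfolding good_def gd_def fst_conv snd_conv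
proof
  fix B
  let ?d = "length G" and ?n = "length bs" and ?D = "length G'"
  have okl: "okl ?d us" using us len by (force simp: okl_def in_set_conv_nth)
  define E where "E = map (\<lambda>j. if ?d + j \<in> B then Inr (embp (eta (bs ! j) (?d + j) (?d + ?n))) else Inl (?d + j)) [0..<?n]"
  define W where "W = map (map_sum id (mshiftp ?d ?n)) (esub G B)"
  have ws: "esub (G @ bs) B = W @ E" by (simp add: esub_append E_def W_def)
  have lW: "length W = ?d" "length E = ?n" by (simp_all add: W_def E_def)
  have okW: "okl (?d + ?n) (W @ E)" using okl_esub[of "G @ bs" B] by (simp add: ws)
  \<comment> \<open>The pullback of \<open>B\<close> along \<open>us\<close>, with the bound
    variables translated from depth \<open>?d\<close> to depth \<open>?D\<close>.\<close>
  define B' where "B' = {x. (x < ?D \<and> (\<exists>y\<in>B. us ! x = Inl y)) \<or> (x \<ge> ?D \<and> ?d + (x - ?D) \<in> B)}"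
  let ?vs = "esub (G' @ bs) B'"
  have e: "ev (?D + ?n) (emb e) = evs (?D + ?n) ?vs e"
    using g by (simp add: good_def gd_def)
  have "evs (?d + ?n) (W @ E) (evu ?d us ?n e)
     = ev (?d + ?n) (gs (?d + ?n) (W @ E) 0 (gs ?d us ?n (emb e)))"
    using ev_gs_emb_ev[OF okW, of _ 0] lW by simp
  also have "gs (?d + ?n) (W @ E) 0 (gs ?d us ?n (emb e)) = gs (?d + ?n) (map (cmp (?d + ?n) W) us @ E) 0 (emb e)"
    by (rule gs_gs_lift[OF lW okW okl])
  also have "ev (?d + ?n) \<dots> = evs (?d + ?n) (map (cmp (?d + ?n) (lift ?d ?n us)) ?vs) e"
  proof -
    have "ev_rel (?d + ?n) ((map (cmp (?d + ?n) W) us @ E) ! x) (map (cmp (?d + ?n) (lift ?d ?n us)) ?vs ! x)"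
      if x: "x < ?D + ?n" for x
    proof (cases "x < ?D")
      case True
      then have v: "?vs ! x = (if x \<in> B' then Inr (embp (eta (G' ! x) x (?D + ?n))) else Inl x)"
        by (simp add: nth_esub nth_append)
      from us[OF True] show ?thesis
      proof (elim disjE exE conjE)
        fix y assume y: "y < ?d" "us ! x = Inl y" "G ! y = G' ! x"
        have lx: "lk (?d + ?n) (lift ?d ?n us) x = Inl y" unfolding lk_lift using y True len by (simp add: lk_def)
        have Wy: "lk (?d + ?n) W y = (if y \<in> B then Inr (embp (eta (G' ! x) y (?d + ?n))) else Inl y)"
          using y by (simp add: lk_def W_def nth_esub mshiftp_eta)
        have B: "x \<in> B' \<longleftrightarrow> y \<in> B" using True y by (auto simp: B'_def)
        have "gsp (?d + ?n) (lift ?d ?n us) 0 (embp (eta (G' ! x) x (?D + ?n))) = embp (eta (G' ! x) y (?d + ?n))"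
          using gsp_eta_Inl[OF lx, of _ 0] len by simp
        then show ?thesis using True len v y x by (simp add: nth_append Wy B lx del: pmap_simps)
      next
        fix p assume p: "us ! x = Inr (embp p)" "good G p"
        let ?m = "length (fst p)"
        have "x \<notin> B'" using True p by (simp add: B'_def)
        have "gs (?d + ?n) W ?m (emb (snd p)) = gs (?d + ?n) (idl ?d) ?m (gs ?d (esub G B) ?m (emb (snd p)))"
          using gs_gs[of "?d + ?n" "idl ?d" ?m "esub G B" "emb (snd p)"] map_cmp_idl_shift[OF okl_esub, where n = ?n]
          by (simp add: W_def)
        moreover have "evu ?d (esub G B) ?m (snd p) = snd p"
          using p(2) gs_lift0[of ?d "esub G B" ?m] lift_esub[of G "fst p" B] by (simp add: good_def gd_def)
        ultimately have "ev (?d + ?n + ?m) (gs (?d + ?n) W ?m (emb (snd p))) = ev (?d + ?n + ?m) (mren (sh ?d ?n) (emb (snd p)))"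
          by (simp add: gs_idl_sh ev_shift)
        then show ?thesis using True len x v \<open>x \<notin> B'\<close> p(1)
          by (simp add: nth_append lk_lift) (simp add: lk_def mshiftp_pmap prd_def)
      qed
    next
      case False
      define j where "j = x - ?D"
      have j: "x = ?D + j" "j < ?n" using False x by (auto simp: j_def)
      have v: "?vs ! x = (if ?d + j \<in> B then Inr (embp (eta (bs ! j) (?D + j) (?D + ?n))) else Inl (?D + j))"
        using j by (simp add: nth_esub nth_append B'_def)
      have lx: "lk (?d + ?n) (lift ?d ?n us) (?D + j) = Inl (?d + j)" unfolding lk_lift using len by (simp add: lk_def)
      have "gsp (?d + ?n) (lift ?d ?n us) 0 (embp (eta (bs ! j) (?D + j) (?D + ?n))) = embp (eta (bs ! j) (?d + j) (?d + ?n))"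
        using gsp_eta_Inl[OF lx, of _ 0] len by simp
      then show ?thesis using j len v by (simp add: nth_append E_def lx del: pmap_simps)
    qed
    then have l: "list_all2 (ev_rel (?d + ?n)) (map (cmp (?d + ?n) W) us @ E) (map (cmp (?d + ?n) (lift ?d ?n us)) ?vs)"
      by (simp add: list_all2_conv_all_nth len lW)
    have o1: "okl (?d + ?n) (map (cmp (?d + ?n) W) us @ E)"
      using okl_cmp[of "?d + ?n" W us] okW okl lW by simp
    have o2: "okl (?d + ?n) (map (cmp (?d + ?n) (lift ?d ?n us)) ?vs)"
      using okl_cmp[OF okl_lift[OF okl], of ?n ?vs] okl_esub[of "G' @ bs" B'] len by simp
    show ?thesis using ev_gs_cong[OF _ o1 o2 l, of 0] by simp
  qed
  also have "gs (?d + ?n) (map (cmp (?d + ?n) (lift ?d ?n us)) ?vs) 0 (emb e) = gs (?d + ?n) (lift ?d ?n us) 0 (gs (?D + ?n) ?vs 0 (emb e))"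
    using gs_gs[OF okl_lift[OF okl], of ?n 0 ?vs "emb e"] len by simp
  also have "ev (?d + ?n) \<dots> = evs (?d + ?n) (lift ?d ?n us) e"
    using ev_gs_cong[of "lift ?d ?n us" 0 "gs (?D + ?n) ?vs 0 (emb e)" "emb e" "?d + ?n" "lift ?d ?n us"] e okl_lift[OF okl] len by simp
  also have "\<dots> = evu ?d us ?n e" by (simp flip: gs_lift0)
  finally show "evs (length (G @ bs)) (esub (G @ bs) B) (evu ?d us ?n e)
     = evu ?d us ?n e" by (simp add: ws)
qed

lemma good_weaken: "good G q \<Longrightarrow> good (G @ H) (fst q, nshift (length G) (length H) (snd q))"
  using good_subst[of G "fst q" "snd q" "idl (length G)" "G @ H"]
  by (simp add: nth_append gs_idl_sh ev_shift)

section \<open>The recursive body of the fixed point operator\<close>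

lemma Fb_unfold: "Fb ss g D = Case g ((ss, Fb ss g (D + length ss))
       # map (\<lambda>j. eta (ss ! j) (D + j) (D + length ss)) [0..<length ss]) Num"
  by (subst Fb.code) simp

lemma emb_Fb: "emb (Fb ss g D) = MCase (MVar g ((ss, emb (Fb ss g (D + length ss))) # etl ss D)) MNum"
  by (subst Fb_unfold) (auto simp: embp_pmap)

lemma gs_Fb_Inl:
  assumes "lk d us v = Inl w"
  shows "gs d us (k + length ss) (emb (Fb ss v (length us + k))) = emb (Fb ss w (d + k))"
proof -
  let ?n = "length ss"
  let ?F = "\<lambda>k. gs d us (k + ?n) (emb (Fb ss v (length us + k)))" and ?G = "\<lambda>k. emb (Fb ss w (d + k))"
  let ?R = "\<lambda>a b. (\<exists>k. a = ?F k \<and> b = ?G k) \<or>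
    (\<exists>k. a = MVar w ((ss, ?F (k + ?n)) # etl ss (d + k)) \<and> b = MVar w ((ss, ?G (k + ?n)) # etl ss (d + k)))"
  have F: "?F k = MCase (MVar w ((ss, ?F (k + ?n)) # etl ss (d + k))) MNum" for k
    using gsp_etl[of "length us + k" us k d ss] assms by (subst emb_Fb) (simp add: add.assoc)
  have G: "?G k = MCase (MVar w ((ss, ?G (k + ?n)) # etl ss (d + k))) MNum" for k
    by (subst emb_Fb) (simp add: add.assoc)
  show ?thesis
  proof (rule mexp_coind[where R = ?R])
    fix a b assume "?R a b"
    then show "mbis (\<lambda>a b. ?R a b \<or> a = b) a b"
    proof (elim disjE exE conjE)
      fix k assume a: "a = ?F k" "b = ?G k"
      show ?thesis unfolding a F[of k] G[of k] by (rule mbis.intros) blast+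
    next
      fix k assume a: "a = MVar w ((ss, ?F (k + ?n)) # etl ss (d + k))" "b = MVar w ((ss, ?G (k + ?n)) # etl ss (d + k))"
      have "?R (?F (k + ?n)) (?G (k + ?n))" by blast
      then show ?thesis unfolding a
        by (intro mbis.intros list.rel_intros) (auto simp: prel_def intro!: list.rel_refl_strong)
    qed
  qed blast
qed

text \<open>Every copy of the body is a renaming of the one with \<open>g\<close> as its only
  environment variable, so the rest of the surrounding list is irrelevant.\<close>

lemma gs_Fb_Inr:
  assumes "lk d us v = Inr p" "v < length us" "okl d us" "D = length us"
  shows "gs d us (length ss) (emb (Fb ss v D)) = gs d [Inr p] (length ss) (emb (Fb ss 0 1))"
proof -
  have "emb (Fb ss v D) = gs D [Inl v] (length ss) (emb (Fb ss 0 1))"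
    using gs_Fb_Inl[of D "[Inl v]" 0 v 0 ss] by (simp add: lk_def)
  then show ?thesis using gs_gs[OF assms(3), of "length ss" "[Inl v]" "emb (Fb ss 0 1)"] assms by simp
qed

text \<open>The tree is infinite, hence a coinduction over all contexts, sets and depths:
  \<open>ev_esub_Case\<close> exposes one layer, whose first argument is the same body deeper down
  and whose other arguments are eta-expansions, already known to be good.\<close>

lemma gd_Fb:
  assumes "g < length G" "G ! g = Arr s s" "length G = D + length (args s)"
    "\<And>j. j < length (args s) \<Longrightarrow> G ! (D + j) = args s ! j"
  shows "gd G (Fb (args s) g D)"
  unfolding gd_def
proof
  fix B
  let ?ss = "args s" and ?n = "length (args s)"
  let ?P = "\<lambda>G D. g < length G \<and> G ! g = Arr s s \<and> length G = D + ?n \<and> (\<forall>j<?n. G ! (D + j) = ?ss ! j)"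
  let ?R = "\<lambda>a b. \<exists>G B D. a = evs (length G) (esub G B) (Fb ?ss g D) \<and> b = Fb ?ss g D \<and> ?P G D"
  show "evs (length G) (esub G B) (Fb ?ss g D) = Fb ?ss g D"
  proof (rule nexp_coind[where R = ?R])
    fix a b assume "?R a b"
    then obtain G B D where a: "a = evs (length G) (esub G B) (Fb ?ss g D)"
      and b: "b = Fb ?ss g D" and P: "?P G D" by blast
    let ?eta = "map (\<lambda>j. eta (?ss ! j) (D + j) (D + ?n)) [0..<?n]"
    let ?qs = "(?ss, Fb ?ss g (D + ?n)) # ?eta"
    have fst: "map fst ?qs = map args (args (G ! g))" using P by (auto intro!: nth_equalityI)
    obtain F where F: "evs (length G) (esub G B) (Case g ?qs Num) =
      Case g (map (\<lambda>q. (fst q, evs (length (G @ fst q)) (esub (G @ fst q) F) (snd q))) ?qs)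
        (\<lambda>i. evs (length G) (esub G B) (Num i))"
      using ev_esub_Case[OF _ fst, of B Num] P by blast
    have "good G q" if "q \<in> set ?eta" for q
    proof -
      obtain j where "j < ?n" "q = eta (?ss ! j) (D + j) (D + ?n)" using \<open>q \<in> set ?eta\<close> by auto
      then show ?thesis using good_eta[of "D + j" G] P by simp
    qed
    then have eta: "(fst q, evs (length (G @ fst q)) (esub (G @ fst q) F) (snd q)) = q"
      if "q \<in> set ?eta" for q
      using that unfolding good_def gd_def by (simp add: prod_eq_iff)
    have "?P (G @ ?ss) (D + ?n)" using P by (simp add: nth_append)
    then have "?R (evs (length (G @ ?ss)) (esub (G @ ?ss) F) (Fb ?ss g (D + ?n))) (Fb ?ss g (D + ?n))"
      by blast
    moreover have "map (\<lambda>q. (fst q, evs (length (G @ fst q)) (esub (G @ fst q) F) (snd q))) ?eta = ?eta"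
      by (rule map_idI) (rule eta)
    note eq = this
    have L: "list_all2 (prel (\<lambda>a b. ?R a b \<or> a = b)) xs xs" for xs
      by (rule list.rel_refl_strong) (simp add: prel_def)
    ultimately show "nbis (\<lambda>a b. ?R a b \<or> a = b) a b"
      unfolding a b Fb_unfold[of ?ss g D] F list.map
      unfolding eq by (intro nbis.intros list.rel_intros L) (simp_all add: prel_def)
  qed (use assms in blast)
qed

lemma gd_Case_N: "x < length G \<Longrightarrow> G ! x = N \<Longrightarrow> (\<And>i. gd G (es i)) \<Longrightarrow> gd G (Case x [] es)"
  by (rule gd_Case) auto

lemma interp_good: "ptyped k G M s \<Longrightarrow> fst (interp G M) = args s \<and> good G (interp G M)"
proof (induction rule: ptyped.induct)
  case (1 x G k)
  then show ?case using good_eta[of x G] by simp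
next
  case (6 s k G)
  have "gd (G @ Arr s s # args s) (Fb (args s) (length G) (length G + 1))"
    by (rule gd_Fb) (auto simp: nth_append)
  then show ?case by (simp add: good_def)
next
  case (8 k G s M t)
  then show ?case by (auto simp: lam1_def good_def)
next
  case (9 k G M s t M')
  obtain e where p: "interp G M = (s # args t, e)" using "9.IH" by (cases "interp G M") auto
  have "good (G @ [s]) (args t, e)" using "9.IH" p by (simp add: good_def)
  then have "good G (args t, ev (length G + length (args t))
      (gs (length G) (idl (length G) @ [Inr (embp (interp G M'))]) (length (args t)) (emb e)))"
    by (rule good_subst) (use "9.IH" in \<open>auto simp: nth_append less_Suc_eq simp del: split_paired_Ex\<close>)
  then show ?case by (simp add: p app_gs)
qed (auto simp: good_def nth_append intro!: gd_Case_N split: option.split)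

section \<open>Recursion as plugging\<close>

locale fixpoint_unfolding =
  fixes G :: "ty list" and ss :: "ty list" and e :: nexp and qs :: "nsp list" and r :: nat
  assumes r_eq: "r = length ss + 1"
    and good_e: "good G (arrs ss # ss, e)"
    and fst_qs: "map fst qs = map args ss"
    and good_qs: "\<And>q. q \<in> set qs \<Longrightarrow> good G q"
begin

abbreviation "d \<equiv> length G"
abbreviation "n \<equiv> length ss"
abbreviation "\<delta> \<equiv> length G + r"

definition Pg :: "nat \<Rightarrow> mproc" where
  "Pg \<Delta> = mshiftp d (\<Delta> - d) (embp (arrs ss # ss, e))"

text \<open>\<open>F[g]\<close> with the procedure inserted for \<open>g\<close>. As a procedure it
  lives at depth \<open>\<Delta>\<close>, its body at depth \<open>\<Delta> + n\<close>; the depth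
  is a parameter because each unfolding goes \<open>n\<close> levels down.\<close>

definition Fd :: "nat \<Rightarrow> mexp" where
  "Fd \<Delta> = gs \<Delta> [Inr (Pg \<Delta>)] n (emb (Fb ss 0 1))"

lemma Pg_eq: "Pg \<Delta> = (arrs ss # ss, mren (sh d (\<Delta> - d)) (emb e))"
  by (simp add: Pg_def mshiftp_pmap embp_def)

lemma length_qs: "length qs = n"
  using fst_qs map_eq_imp_length_eq by metis

lemma mshiftp_Pg: "d \<le> \<Delta> \<Longrightarrow> mshiftp \<Delta> m (Pg \<Delta>) = Pg (\<Delta> + m)"
  using sh_sh'[of d "\<Delta> - d" m "emb e"] by (simp add: Pg_eq mshiftp_pmap add.commute)

lemma Fd_unfold: "d \<le> \<Delta> \<Longrightarrow> Fd \<Delta> = MCase (MApp (Pg (\<Delta> + n)) ((ss, Fd (\<Delta> + n)) # etl ss \<Delta>)) MNum"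
proof -
  assume \<Delta>: "d \<le> \<Delta>"
  let ?us = "[Inr (Pg \<Delta>)]"
  have "gs \<Delta> ?us (n + n) (emb (Fb ss 0 (1 + n))) = gs (\<Delta> + n) (lift \<Delta> n ?us) n (emb (Fb ss 0 (1 + n)))"
    by (rule gs_lift)
  also have "\<dots> = gs (\<Delta> + n) [Inr (Pg (\<Delta> + n))] n (emb (Fb ss 0 1))"
    by (rule gs_Fb_Inr) (use mshiftp_Pg[OF \<Delta>] okl_lift[of \<Delta> ?us n] in \<open>simp_all add: lk_lift\<close>, simp_all add: lk_def)
  finally have "gs \<Delta> ?us (n + n) (emb (Fb ss 0 (1 + n))) = Fd (\<Delta> + n)" by (simp add: Fd_def)
  then show ?thesis unfolding Fd_def[of \<Delta>] using gsp_etl[of 1 ?us 0 \<Delta> ss] mshiftp_Pg[OF \<Delta>]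
    by (subst emb_Fb) (simp add: lk_def)
qed

lemma beta_Pg:
  assumes "d \<le> \<Delta>"
  shows "beta \<Delta> Qs (snd (Pg \<Delta>)) = gs \<Delta> (idl d @ map Inr Qs) 0 (emb e)"
proof -
  have "idl \<Delta> = idl d @ map Inl [d..<\<Delta>]" using idl_add[of d "\<Delta> - d"] assms by simp
  then show ?thesis
    using gs_weaken_mid[of \<Delta> "idl d" "map Inl [d..<\<Delta>]" "map Inr Qs" 0 "emb e"] assms(1)
    by (simp add: Pg_eq)
qed

text \<open>The body \<open>e\<close> after \<open>F\<close> has passed eta-expansions for the
  variables \<open>x\<close>. Its normal form is still \<open>e\<close> by goodness, so in
  \<open>sim_sub\<close> it may stand opposite to \<open>e\<close> itself.\<close>

definition Beta :: mexp where
  "Beta = gs (d + 1 + n) (idl (d + 1) @ map Inr (etl ss (d + 1))) 0 (emb e)"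

lemma ev_Beta: "ev (d + 1 + n) Beta = e"
proof -
  have "good (G @ [arrs ss]) (ss, e)" using good_e by (simp add: good_def)
  from good_eta_cancel[OF this] show ?thesis by (simp add: Beta_def)
qed

text \<open>Contracting the head redex of \<open>Fd \<Delta>\<close> inserts \<open>F\<close> for
  \<open>z\<close> and eta-expansions for \<open>x\<close>; separating the two leaves an instance of
  \<open>Beta\<close> in which only \<open>z\<close> is substituted by a procedure.\<close>

lemma guard_Fd:
  assumes "d \<le> \<Delta>"
  shows "guard (\<Delta> + n) (Fd \<Delta>) (gs (\<Delta> + n) (idl d @ Inr (ss, Fd (\<Delta> + n)) # map Inl [\<Delta>..<\<Delta> + n]) 0 Beta)"
proof -
  let ?Q = "(ss, Fd (\<Delta> + n)) # etl ss \<Delta>"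
  let ?vs = "idl d @ Inr (ss, Fd (\<Delta> + n)) # map Inl [\<Delta>..<\<Delta> + n]"
  have "guard (\<Delta> + n) (Fd \<Delta>) (beta (\<Delta> + n) ?Q (snd (Pg (\<Delta> + n))))"
    unfolding guard_def Fd_unfold[OF assms] by (rule disjI2) (auto simp: Pg_eq)
  also have "beta (\<Delta> + n) ?Q (snd (Pg (\<Delta> + n))) = gs (\<Delta> + n) (idl d @ map Inr ?Q) 0 (emb e)"
    by (rule beta_Pg) (use assms in auto)
  also have "\<dots> = gs (\<Delta> + n) ?vs 0 Beta"
  proof -
    have "okl (\<Delta> + n) ?vs" using assms by auto
    moreover have "length ?vs = d + 1 + n" by simp
    moreover have "map (cmp (\<Delta> + n) ?vs) (idl (d + 1)) = idl d @ [Inr (ss, Fd (\<Delta> + n))]"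
      by (rule nth_equalityI) (auto simp: lk_def nth_append less_Suc_eq)
    moreover have "map (cmp (\<Delta> + n) ?vs) (map Inr (etl ss (d + 1))) = map Inr (etl ss \<Delta>)"
    proof -
      have "gsp (\<Delta> + n) ?vs 0 (embp (eta (ss ! j) (d + 1 + j) (d + 1 + n))) = embp (eta (ss ! j) (\<Delta> + j) (\<Delta> + n))"
        if "j < n" for j
        using gsp_eta_Inl[of "\<Delta> + n" ?vs "d + 1 + j" "\<Delta> + j" "d + 1 + n" 0 "ss ! j"] that
        by (simp add: lk_def nth_append)
      then show ?thesis by (simp del: pmap_simps)
    qed
    ultimately show ?thesis unfolding Beta_def
      using gs_gs[of "\<Delta> + n" ?vs 0 "idl (d + 1) @ map Inr (etl ss (d + 1))" "emb e"]
      by (simp only: map_append list.map append_assoc append_Cons append_Nil)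
  qed
  finally show ?thesis .
qed

definition xi :: "nat \<Rightarrow> nsp" where
  "xi = (\<lambda>j. if j = 0 then (ss, nshift (d + 1) n e)
             else (fst (qs ! (j - 1)), nshift d r (snd (qs ! (j - 1)))))"

definition w0 :: mexp where
  "w0 = pl d r xi n (emb (nshift (d + 1) n e))"

definition Q :: "mproc list" where
  "Q = map (\<lambda>q. mshiftp d r (embp q)) qs"

text \<open>The arguments mention only levels below \<open>d\<close>, so plugging leaves them
  unchanged. The entry for \<open>z\<close> is the only recursive one, and \<open>w0\<close> is its
  body.\<close>

lemma plsub_eq: "plsub d r xi = idl d @ Inr (ss, w0) # map Inr Q"
proof -
  let ?f = "\<lambda>j. Inr (plp d r xi 0 (embp (xi j))) :: nat + mproc"
  have U: "plsub d r xi = idl d @ ?f 0 # map (\<lambda>j. ?f (Suc j)) [0..<n]"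
    unfolding plsub_def r_eq by (simp add: upt_conv_Cons map_Suc_upt[symmetric] comp_def del: upt_Suc)
  have okl: "okl \<delta> (idl d @ ?f 0 # map (\<lambda>j. ?f (Suc j)) [0..<n])" by simp
  have "?f 0 = Inr (ss, w0)" by (simp add: w0_def xi_def embp_def)
  moreover have "?f (Suc j) = Inr (Q ! j)" if "j < n" for j
  proof -
    have "pl d r xi m (mren (sh d r) T) = mren (sh d r) T" for m T
    proof -
      let ?v = "?f 0 # map (\<lambda>j. ?f (Suc j)) [0..<n]"
      have len: "length (idl d) = d" "length ?v = r" by (simp_all add: r_eq)
      have "pl d r xi m (mren (sh d r) T) = gs \<delta> (idl d @ ?v) m (mren (sh d r) T)"
        by (subst pl_gs) (simp only: U)
      also have "\<dots> = gs \<delta> (idl d) m T" using gs_weaken[OF okl, of m T] unfolding len .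
      finally show ?thesis by (simp only: gs_idl_sh)
    qed
    then show ?thesis using that length_qs
      by (simp add: xi_def Q_def embp_def emb_nshift mshiftp_pmap)
  qed
  moreover have "map (\<lambda>j. Inr (Q ! j)) [0..<n] = map Inr Q"
    using length_qs by (intro nth_equalityI) (auto simp: Q_def)
  ultimately show ?thesis unfolding U by (metis (no_types, lifting) atLeastLessThan_iff map_cong set_upt)
qed

lemma length_Q: "length Q = n"
  by (simp add: Q_def length_qs)

text \<open>In the procedure assigned to \<open>z\<close> the \<open>x\<close> are bound again, so
  its body was shifted past the outer \<open>x\<close>. The arguments \<open>Q\<close> therefore
  drop out, and what remains is the recursive equation for \<open>W\<close>.\<close>

lemma w0_eq: "w0 = gs (\<delta> + n) (idl d @ Inr (ss, mren (sh \<delta> n) w0) # map Inl [\<delta>..<\<delta> + n]) 0 (emb e)"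
proof -
  let ?U = "idl d @ Inr (ss, w0) # map Inr Q"
  have "w0 = gs \<delta> ?U n (mren (sh (d + 1) n) (emb e))"
    by (subst w0_def) (simp only: pl_gs plsub_eq emb_nshift)
  also have "\<dots> = gs (\<delta> + n) ((idl d @ [Inr (ss, mren (sh \<delta> n) w0)]) @ map (\<lambda>q. Inr (mshiftp \<delta> n q)) Q @ map Inl [\<delta>..<\<delta> + n]) 0 (mren (sh (d + 1) n) (emb e))"
    unfolding gs_lift0[of \<delta> ?U n] lift_def by (simp add: comp_def mshiftp_pmap)
  also have "\<dots> = gs (\<delta> + n) ((idl d @ [Inr (ss, mren (sh \<delta> n) w0)]) @ map Inl [\<delta>..<\<delta> + n]) 0 (emb e)"
    using gs_weaken_mid[of "\<delta> + n" "idl d @ [Inr (ss, mren (sh \<delta> n) w0)]" "map (\<lambda>q. Inr (mshiftp \<delta> n q)) Q" "map Inl [\<delta>..<\<delta> + n]" 0 "emb e"]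
    by (simp add: length_Q)
  finally show ?thesis by simp
qed

definition wd :: "nat \<Rightarrow> mexp" where
  "wd \<Delta> = mren (sh \<delta> (\<Delta> - \<delta>)) w0"

lemma wd_unfold:
  assumes "\<delta> \<le> \<Delta>"
  shows "wd \<Delta> = gs (\<Delta> + n) (idl d @ Inr (ss, wd (\<Delta> + n)) # map Inl [\<Delta>..<\<Delta> + n]) 0 (emb e)"
proof -
  let ?K = "\<Delta> - \<delta>"
  let ?L = "lift \<Delta> n (idl \<delta>)"
  let ?V = "idl d @ Inr (ss, mren (sh \<delta> n) w0) # map Inl [\<delta>..<\<delta> + n]"
  have ren: "gs (\<Delta> + n) ?L m T = mren (sh \<delta> ?K) T" for m T
    using gs_lift[of \<Delta> "idl \<delta>" n m T] gs_idl_sh[of \<delta> ?K "n + m" T] assms by simp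
  have okL: "okl (\<Delta> + n) ?L" using assms by (intro okl_lift) auto
  have L: "?L = idl \<delta> @ map Inl [\<Delta>..<\<Delta> + n]" by (simp add: lift_def)
  have "wd \<Delta> = gs (\<Delta> + n) ?L 0 (gs (\<delta> + n) ?V 0 (emb e))"
    unfolding ren wd_def using w0_eq by simp
  also have "\<dots> = gs (\<Delta> + n) (map (cmp (\<Delta> + n) ?L) ?V) 0 (emb e)"
    using gs_gs[OF okL, of 0 ?V "emb e"] by simp
  also have "map (cmp (\<Delta> + n) ?L) ?V = idl d @ Inr (ss, wd (\<Delta> + n)) # map Inl [\<Delta>..<\<Delta> + n]"
  proof -
    have "map (cmp (\<Delta> + n) ?L) (idl d) = idl d"
      unfolding L by (rule nth_equalityI) (auto simp: lk_def nth_append)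
    moreover have "cmp (\<Delta> + n) ?L (Inr (ss, mren (sh \<delta> n) w0)) = Inr (ss, wd (\<Delta> + n))"
      using assms by (simp add: ren sh_sh wd_def)
    moreover have "map (cmp (\<Delta> + n) ?L) (map Inl [\<delta>..<\<delta> + n]) = map Inl [\<Delta>..<\<Delta> + n]"
      unfolding L by (rule nth_equalityI) (auto simp: lk_def nth_append)
    ultimately show ?thesis by simp
  qed
  finally show ?thesis .
qed

text \<open>Both sides are instances of terms with normal form \<open>e\<close>, by lists that
  differ only in the entry for \<open>z\<close>, where the same pair recurs \<open>n\<close> levels
  deeper. The beta redex on the left is absorbed by \<open>guard\<close>.\<close>

lemma sim_Fd_wd: "\<delta> \<le> \<Delta> \<Longrightarrow> sim (\<Delta> + n) (Fd \<Delta>) (wd \<Delta>)"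
proof (rule sim_coind[where X = "\<lambda>D T T'. \<exists>\<Delta>\<ge>\<delta>. D = \<Delta> + n \<and> T = Fd \<Delta> \<and> T' = wd \<Delta>"])
  let ?X = "\<lambda>D T T'. (\<exists>\<Delta>\<ge>\<delta>. D = \<Delta> + n \<and> T = Fd \<Delta> \<and> T' = wd \<Delta>) \<or> sim D T T'"
  fix D T T' assume "\<exists>\<Delta>\<ge>\<delta>. D = \<Delta> + n \<and> T = Fd \<Delta> \<and> T' = wd \<Delta>"
  then obtain \<Delta> where \<Delta>: "\<delta> \<le> \<Delta>" and eq: "D = \<Delta> + n" "T = Fd \<Delta>" "T' = wd \<Delta>" by blast
  let ?us = "\<lambda>T. idl d @ Inr (ss, T) # map Inl [\<Delta>..<\<Delta> + n] :: (nat + mproc) list"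
  have "?X (\<Delta> + n + n) (Fd (\<Delta> + n)) (wd (\<Delta> + n))"
    by (rule disjI1, rule exI[of _ "\<Delta> + n"]) (use \<Delta> in simp)
  then have "list_all2 (erel ?X (\<Delta> + n)) (?us (Fd (\<Delta> + n))) (?us (wd (\<Delta> + n)))"
    by (intro list_all2_appendI list.rel_intros) (simp_all add: list_all2_conv_all_nth prd_def)
  moreover have "guard (\<Delta> + n) (wd \<Delta>) (gs (\<Delta> + n) (?us (wd (\<Delta> + n))) 0 (emb e))"
    using wd_unfold[OF \<Delta>] by (simp add: guard_def)
  moreover have "guard (\<Delta> + n) (Fd \<Delta>) (gs (\<Delta> + n) (?us (Fd (\<Delta> + n))) 0 Beta)"
    by (rule guard_Fd) (use \<Delta> in simp)
  moreover have "ev (length (?us (Fd (\<Delta> + n)))) Beta = ev (length (?us (Fd (\<Delta> + n)))) (emb e)"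
    using ev_Beta by simp
  moreover have "okl (\<Delta> + n) (?us T)" for T using \<Delta> by auto
  ultimately show "simF ?X D T T'" unfolding eq by (intro simF_sub)
qed blast

text \<open>The list \<open>us\<close> is arbitrary because the body of the fixed point refers to no
  environment variable except \<open>g\<close>. It is the identity when rule 6 is realised by a
  program and a list of reducible procedures in the interpretation of \<open>Y\<close>.\<close>

theorem ev_Fb_plug:
  assumes "length us = D" "okl d us"
  shows "evs d (us @ Inr (embp (arrs ss # ss, e)) # inrs qs) (Fb ss D (D + 1))
    = nunshift d r (eval \<delta> (plug d r e xi))"
proof -
  let ?us = "us @ Inr (embp (arrs ss # ss, e)) # inrs qs"
  let ?vs = "map (map_sum id (mshiftp d r)) us @ Inr (Pg \<delta>) # map Inr Q"
  let ?E = "map (gsp \<delta> ?vs 0) (etl ss (D + 1))"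
  have okus: "okl d ?us" using assms by simp
  have "map (map_sum id (mshiftp d r)) ?us = ?vs"
    by (simp add: Pg_def Q_def comp_def)
  then have vs: "map (cmp \<delta> (idl d)) ?us = ?vs" using map_cmp_idl_shift[OF okus, of r] by simp
  have "okl \<delta> (map (cmp \<delta> (idl d)) ?us)" by (rule okl_cmp) (use okus in auto)
  then have okvs: "okl \<delta> ?vs" unfolding vs .
  \<comment> \<open>The computation takes place at depth \<open>\<delta>\<close>, where the plugged
    term lives; \<open>nunshift\<close> returns to depth \<open>d\<close> at the end.\<close>
  have "nshift d r (evs d ?us (Fb ss D (D + 1))) = ev \<delta> (mren (sh d r) (gs d ?us 0 (emb (Fb ss D (D + 1)))))"
    using ev_shift[of d r 0] by simp
  also have "mren (sh d r) (gs d ?us 0 (emb (Fb ss D (D + 1)))) = gs \<delta> ?vs 0 (emb (Fb ss D (D + 1)))"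
    using gs_gs[of \<delta> "idl d" 0 ?us "emb (Fb ss D (D + 1))"] unfolding vs by (simp add: gs_idl_sh)
  also have "gs \<delta> ?vs 0 (emb (Fb ss D (D + 1))) = MCase (MApp (Pg \<delta>) ((ss, Fd \<delta>) # ?E)) MNum"
  proof -
    have lk: "lk \<delta> ?vs D = Inr (Pg \<delta>)" by (simp add: lk_def nth_append assms)
    have "gs \<delta> ?vs n (emb (Fb ss D (D + 1 + n))) = Fd \<delta>"
      unfolding Fd_def by (rule gs_Fb_Inr[OF lk _ okvs]) (simp_all add: assms length_Q)
    then show ?thesis by (subst emb_Fb) (simp add: lk)
  qed
  also have "ev \<delta> \<dots> = ev \<delta> (beta \<delta> ((ss, Fd \<delta>) # ?E) (snd (Pg \<delta>)))"
    by (simp add: Pg_eq ev_App)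
  also have "\<dots> = evs \<delta> (idl d @ map Inr ((ss, Fd \<delta>) # ?E)) e"
    by (subst beta_Pg) simp_all
  also have "\<dots> = evs \<delta> (plsub d r xi) e"
  proof -
    have "ev_rel \<delta> (Inr (ss, Fd \<delta>)) (Inr (ss, w0))"
      using sim_imp_ev_eq[OF sim_Fd_wd[of \<delta>]] by (simp add: prd_def wd_def sh_0)
    \<comment> \<open>\<open>F\<close> hands over the eta-expansions of its bound variables; with
      \<open>?q\<close> substituted these normalise to \<open>?q\<close> again, since
      \<open>?q\<close> is good.\<close>
    moreover have "ev_rel \<delta> (Inr (?E ! j)) (Inr (Q ! j))" if j: "j < n" for j
    proof -
      let ?q = "qs ! j"
      have fst: "fst ?q = args (ss ! j)" using fst_qs j length_qs by (metis nth_map)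
      have Qj: "Q ! j = (fst ?q, emb (nshift d r (snd ?q)))" using j length_qs
        by (simp add: Q_def mshiftp_pmap embp_def emb_nshift)
      have lk: "lk \<delta> ?vs (D + 1 + j) = Inr (Q ! j)"
        using j by (simp add: lk_def nth_append assms length_Q)
      have "good (G @ arrs ss # ss) (fst ?q, nshift d r (snd ?q))"
        using good_weaken[OF good_qs[of ?q], of "arrs ss # ss"] j length_qs by (simp add: r_eq)
      moreover have "length (G @ arrs ss # ss) = \<delta>" by (simp add: r_eq)
      ultimately have "evs (\<delta> + length (fst ?q)) (idl \<delta> @ map Inr (etl (fst ?q) \<delta>)) (nshift d r (snd ?q)) = nshift d r (snd ?q)"
        using good_eta_cancel by fastforce
      then
      have "ev (\<delta> + length (fst ?q)) (gs \<delta> ?vs (length (fst ?q)) (emb (snd (eta (ss ! j) (D + 1 + j) (D + 1 + n))))) = nshift d r (snd ?q)"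
        using ev_gs_eta_Inr[OF lk[unfolded Qj] fst, of "D + 1 + n"] by (simp add: assms length_Q)
      then show ?thesis using j by (simp add: prd_def Qj fst)
    qed
    ultimately have "list_all2 (ev_rel \<delta>) (idl d @ map Inr ((ss, Fd \<delta>) # ?E)) (plsub d r xi)"
      unfolding plsub_eq list.map
      by (intro list_all2_appendI list.rel_intros) (simp_all add: list_all2_conv_all_nth length_Q)
    from ev_gs_cong[OF _ _ _ this, of 0] show ?thesis by (simp add: plsub_eq)
  qed
  also have "\<dots> = eval \<delta> (plug d r e xi)"
    using eval_ev[OF wfm_pl[OF wfm_emb], of \<delta> d r xi 0 e] by (simp only: plug_pl pl_gs)
  finally have "nunshift d r (nshift d r (evs d ?us (Fb ss D (D + 1)))) = nunshift d r (eval \<delta> (plug d r e xi))"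
    by (rule arg_cong)
  then show ?thesis by (simp only: nunshift_nshift)
qed

end

section \<open>Generated procedures are denotable\<close>

lemma args_foldr: "args (foldr Arr ss t) = ss @ args t"
  by (induction ss) auto

lemma args_arrs [simp]: "args (arrs ss) = ss"
  by (simp add: arrs_def args_foldr)

lemma arrs_args [simp]: "arrs (args s) = s"
  by (induction s) (auto simp: arrs_def)

lemma ptyped_apps:
  "ptyped k G M (foldr Arr ss t) \<Longrightarrow> list_all2 (ptyped k G) Ms ss \<Longrightarrow> ptyped k G (foldl PApp M Ms) t"
proof (induction Ms arbitrary: M ss)
  case (Cons P Ms)
  then obtain s ss' where "ss = s # ss'" by (cases ss) auto
  then show ?case using Cons by (auto intro: ptyped.intros)
qed simp

lemma ptyped_lams: "ptyped k (G @ ss) M t \<Longrightarrow> ptyped k G (foldr PLam ss M) (foldr Arr ss t)"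
  by (induction ss arbitrary: G) (auto intro!: ptyped.intros)

lemma interp_lams: "interp G (foldr PLam ss M) = (ss @ fst (interp (G @ ss) M), snd (interp (G @ ss) M))"
  by (induction ss arbitrary: G) (auto simp: lam1_def)

lemma gs_gs_lift_under:
  assumes "length us = d" "length vs = n" "okl e (us @ vs)" "okl d ws"
  shows "gs e (us @ vs) m (gs d ws (n + m) T) = gs e (map (cmp e us) ws @ vs) m T"
  using gs_gs[OF assms(3), of m "lift d n ws" T] assms
  by (simp add: gs_lift[of d ws n] map_cmp_lift)

text \<open>Every application normalises; \<open>ev_gs_emb_ev\<close> removes the intermediate
  normal forms, and the successive substitutions fuse into one.\<close>

lemma interp_apps:
  "fst (interp G M) = bs1 @ bs2 \<Longrightarrow> length Ms = length bs1 \<Longrightarrow>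
   interp G (foldl PApp M Ms) = (bs2, ev (length G + length bs2)
     (gs (length G) (idl (length G) @ map (Inr \<circ> embp \<circ> interp G) Ms) (length bs2) (emb (snd (interp G M)))))"
proof (induction Ms arbitrary: M bs1)
  case Nil
  then show ?case by (simp add: prod_eq_iff)
next
  case (Cons P Ms)
  let ?d = "length G" and ?m = "length bs2" and ?e = "emb (snd (interp G M))"
  obtain b bs where bs1: "bs1 = b # bs" "length Ms = length bs" using Cons.prems by (cases bs1) auto
  have app: "interp G (PApp M P) = (bs @ bs2, ev (?d + length (bs @ bs2))
      (gs ?d (idl ?d @ [Inr (embp (interp G P))]) (length (bs @ bs2)) ?e))"
    using Cons.prems bs1 by (simp add: app_gs)
  let ?Q = "map (Inr \<circ> embp \<circ> interp G) Ms"
  have "interp G (foldl PApp (PApp M P) Ms) = (bs2, evu ?d (idl ?d @ ?Q) ?m (snd (interp G (PApp M P))))"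
    by (rule Cons.IH[of _ bs]) (use app bs1 in auto)
  also have "evu ?d (idl ?d @ ?Q) ?m (snd (interp G (PApp M P)))
      = ev (?d + ?m) (gs ?d (idl ?d @ ?Q) ?m (gs ?d (idl ?d @ [Inr (embp (interp G P))]) (length bs + ?m) ?e))"
    unfolding app snd_conv by (subst ev_gs_emb_ev) (use bs1 in auto)
  also have "gs ?d (idl ?d @ ?Q) ?m (gs ?d (idl ?d @ [Inr (embp (interp G P))]) (length bs + ?m) ?e)
      = gs ?d ((idl ?d @ [Inr (embp (interp G P))]) @ ?Q) ?m ?e"
  proof -
    have "map (cmp ?d (idl ?d)) (idl ?d @ [Inr (embp (interp G P))]) = idl ?d @ [Inr (embp (interp G P))]"
      by (rule map_cmp_idl_id) simp
    then show ?thesis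
      using gs_gs_lift_under[of "idl ?d" ?d ?Q "length bs" ?d "idl ?d @ [Inr (embp (interp G P))]" ?m ?e] bs1
      by (simp del: map_append list.map(2))
  qed
  finally show ?case by (simp add: comp_def)
qed

lemma denotable_good: "denotable k G s p \<Longrightarrow> fst p = args s \<and> good G p"
  unfolding denotable_def using interp_good by blast

lemma denotable_apps:
  assumes "denotable k G (foldr Arr ts t) p" "length qs = length ts"
    "\<And>i. i < length ts \<Longrightarrow> denotable k G (ts ! i) (qs ! i)"
  shows "denotable k G t (args t, ev (length G + length (args t))
     (gs (length G) (idl (length G) @ inrs qs) (length (args t)) (emb (snd p))))"
proof -
  obtain M where M: "ptyped k G M (foldr Arr ts t)" "interp G M = p" using assms(1) by (auto simp: denotable_def)
  obtain f where f: "\<And>i. i < length ts \<Longrightarrow> ptyped k G (f i) (ts ! i) \<and> interp G (f i) = qs ! i"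
    using assms(3) unfolding denotable_def by metis
  let ?Ms = "map f [0..<length ts]"
  have "ptyped k G (foldl PApp M ?Ms) t"
    by (rule ptyped_apps[OF M(1)]) (use f in \<open>auto simp: list_all2_conv_all_nth\<close>)
  moreover have "map (interp G) ?Ms = qs" using f assms(2) by (intro nth_equalityI) auto
  then have eq: "map (Inr \<circ> embp \<circ> interp G) ?Ms = inrs qs" by (metis map_map)
  have "fst (interp G M) = ts @ args t" using denotable_good[OF assms(1)] M(2) by (simp add: args_foldr)
  from interp_apps[OF this, of ?Ms]
  have "interp G (foldl PApp M ?Ms) = (args t, ev (length G + length (args t))
     (gs (length G) (idl (length G) @ inrs qs) (length (args t)) (emb (snd p))))"
    unfolding eq M(2) by simp
  ultimately show ?thesis unfolding denotable_def by blast
qed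

lemma denotable_list:
  assumes "length qs = length ss" "\<And>i. i < length ss \<Longrightarrow> denotable k G (ss ! i) (qs ! i)"
  shows "map fst qs = map args ss" "q \<in> set qs \<Longrightarrow> good G q"
  using good_list[OF assms(1) denotable_good[OF assms(2)]] by blast+

lemma ev_gs_ground:
  assumes "lk d us x = Inr (embp q)" "fst q = []"
  shows "evu d us n (Case x [] es) = nrepl (\<lambda>i. evu d us n (es i)) (nshift d n (snd q))"
proof -
  have "mshiftp d n (embp q) = ([], mren (sh d n) (emb (snd q)))"
    using assms(2) by (simp add: mshiftp_pmap pmap_def)
  then show ?thesis using assms ev_shift[of d n 0 "emb (snd q)"] ev_App[of "[]" "[]" "d + n"]
    by (simp add: ev_Case)
qed

lemma interp_PC:
  assumes "interp G X = ([], x)"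
  shows "interp G (PApp (PC f) X) = ([], nrepl (fnum f) x)"
proof -
  let ?D = "length G" and ?es = "\<lambda>i. case f i of None \<Rightarrow> Bot | Some m \<Rightarrow> Num m"
  let ?us = "idl ?D @ [Inr (embp ([], x))]"
  have "interp G (PApp (PC f) X) = ([], evs ?D ?us (Case ?D [] ?es))"
    using assms by (simp add: app_gs)
  also have "evs ?D ?us (Case ?D [] ?es) = nrepl (\<lambda>i. evs ?D ?us (?es i)) x"
    using ev_gs_ground[of ?D ?us ?D "([], x)" 0 ?es] by (simp add: lk_def nth_append)
  also have "(\<lambda>i. evs ?D ?us (?es i)) = fnum f"
    by (auto simp: fnum_def split: option.split)
  finally show ?thesis .
qed

lemma interp_PIfz:
  assumes "interp G X = ([], x)" "interp G A = ([], a)" "interp G B = ([], b)"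
  shows "interp G (foldl PApp PIfz [X, A, B]) = ([], nrepl (\<lambda>i. if i = 0 then a else b) x)"
proof -
  let ?D = "length G" and ?es = "\<lambda>i::nat. if i = 0 then Case (length G + 1) [] Num else Case (length G + 2) [] Num"
  let ?us = "idl ?D @ [Inr (embp ([], x)), Inr (embp ([], a)), Inr (embp ([], b))]"
  have "fst (interp G PIfz) = [N, N, N] @ []" by simp
  from interp_apps[OF this, of "[X, A, B]"] assms
  have "interp G (foldl PApp PIfz [X, A, B]) = ([], evs ?D ?us (Case ?D [] ?es))"
    by (simp del: foldl_Cons emb_simps gs_simps)
  also have "evs ?D ?us (Case ?D [] ?es) = nrepl (\<lambda>i. evs ?D ?us (?es i)) x"
    using ev_gs_ground[of ?D ?us ?D "([], x)" 0 ?es] by (simp add: lk_def nth_append)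
  also have "(\<lambda>i. evs ?D ?us (?es i)) = (\<lambda>i. if i = 0 then a else b)"
  proof
    fix i
    have "evs ?D ?us (Case (?D + 1) [] Num) = a"
      using ev_gs_ground[of ?D ?us "?D + 1" "([], a)" 0 Num] by (simp add: lk_def nth_append)
    moreover have "evs ?D ?us (Case (?D + 2) [] Num) = b"
      using ev_gs_ground[of ?D ?us "?D + 2" "([], b)" 0 Num] by (simp add: lk_def nth_append)
    ultimately show "evs ?D ?us (?es i) = (if i = 0 then a else b)"
      by (simp only: split: if_split) simp
  qed
  finally show ?thesis .
qed

section \<open>Programs for the rules\<close>

lemma eta_N: "eta N v D = ([], Case v [] Num)"
  by (subst eta.simps) simp

lemma ptyped_eta_app:
  assumes "v < length G" "v' + length (args (G ! v)) \<le> length G"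
    "\<And>j. j < length (args (G ! v)) \<Longrightarrow> G ! (v' + j) = args (G ! v) ! j"
  shows "ptyped k G (foldl PApp (PVar v) (map PVar [v'..<v' + length (args (G ! v))])) N"
proof (rule ptyped_apps[where ss = "args (G ! v)"])
  show "ptyped k G (PVar v) (foldr Arr (args (G ! v)) N)"
    using ptyped.intros(1)[OF assms(1), of k] arrs_args[of "G ! v"] by (simp add: arrs_def)
  have "ptyped k G (PVar (v' + j)) (args (G ! v) ! j)" if "j < length (args (G ! v))" for j
    using ptyped.intros(1)[of "v' + j" G k] assms(2,3) that by simp
  then show "list_all2 (ptyped k G) (map PVar [v'..<v' + length (args (G ! v))]) (args (G ! v))"
    by (auto simp: list_all2_conv_all_nth)
qed

text \<open>Interpretation eta-expands the head and each argument; by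
  \<open>ev_eta_saturated_good\<close> the result collapses to the body of a single
  eta-expansion.\<close>

lemma interp_eta_app:
  assumes "v < length G'" "length G = length G' + length (args (G ! v))"
    "\<And>j. j < length (args (G ! v)) \<Longrightarrow> G ! (length G' + j) = args (G ! v) ! j"
  shows "interp G (foldl PApp (PVar v) (map PVar [length G'..<length G' + length (args (G ! v))]))
     = ([], snd (eta (G ! v) v (length G')))"
proof -
  let ?s = "G ! v" and ?n = "length (args (G ! v))"
  let ?etas = "map (\<lambda>j. eta (args ?s ! j) (length G' + j) (length G)) [0..<?n]"
  have "map (interp G) (map PVar [length G'..<length G' + ?n]) = ?etas"
    using assms(3) by (intro nth_equalityI) auto
  then have m: "map (Inr \<circ> embp \<circ> interp G) (map PVar [length G'..<length G' + ?n]) = inrs ?etas"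
    by (metis map_map)
  have "interp G (foldl PApp (PVar v) (map PVar [length G'..<length G' + ?n]))
    = ([], evs (length G) (idl (length G) @ inrs ?etas) (snd (eta ?s v (length G))))"
    using interp_apps[of G "PVar v" "args ?s" "[]" "map PVar [length G'..<length G' + ?n]"] unfolding m by simp
  also have "evs (length G) (idl (length G) @ inrs ?etas) (snd (eta ?s v (length G))) = Case v ?etas Num"
  proof (rule ev_eta_saturated_good[OF _ _ _ refl])
    show "lk (length G) (idl (length G)) v = Inl v" using assms by (simp add: lk_idl)
    show "map fst ?etas = map args (args ?s)" by (auto intro!: nth_equalityI)
    fix q assume "q \<in> set ?etas"
    then obtain j where "j < ?n" "q = eta (args ?s ! j) (length G' + j) (length G)" by auto
    then show "good G q" using good_eta[of "length G' + j" G] assms by simp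
  qed (use assms in auto)
  also have "Case v ?etas Num = snd (eta ?s v (length G'))"
    by (subst (2) eta.simps) (simp add: assms(2))
  finally show ?thesis .
qed

lemma ev_eta_good:
  assumes "lk (length G) us v = Inr (embp p)" "fst p = args s" "good G p" "D = length us"
  shows "ev (length G + length (args s)) (gs (length G) us (length (args s)) (emb (snd (eta s v D)))) = snd p"
  using ev_gs_eta_Inr[of "length G" us v "fst p" "emb (snd p)" s D] good_eta_cancel[OF assms(3)] assms
  by (simp add: embp_def)

lemma nrepl_subst:
  assumes "okl d us" "D = length us + n"
  shows "evu d us n (nrepl g x) = nrepl (\<lambda>i. evu d us n (g i)) (evu d us n x)"
proof -
  have "nrepl g x = ev D (MCase (emb x) (\<lambda>i. emb (g i)))" by (simp add: ev_Case)
  then have "evu d us n (nrepl g x) = ev (d + n) (gs d us n (MCase (emb x) (\<lambda>i. emb (g i))))"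
    using ev_gs_emb_ev[OF assms] by simp
  then show ?thesis by (simp add: ev_Case)
qed

text \<open>The program is the variable applied to programs for the \<open>qs\<close>; the
  eta-expansion in its interpretation cancels.\<close>

lemma denotable_rule1:
  assumes "x < length G" "G ! x = arrs ss" "length qs = length ss"
    "\<And>i. i < length ss \<Longrightarrow> denotable k G (ss ! i) (qs ! i)"
  shows "denotable k G N ([], Case x qs Num)"
proof -
  have "denotable k G (foldr Arr ss N) (eta (arrs ss) x (length G))"
    using ptyped.intros(1)[OF assms(1), of k] assms(2) unfolding denotable_def
    by (intro exI[of _ "PVar x"]) (simp add: arrs_def)
  from denotable_apps[OF this assms(3,4)]
  have "denotable k G N ([], evs (length G) (idl (length G) @ inrs qs) (snd (eta (arrs ss) x (length G))))"
    by simp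
  moreover have "evs (length G) (idl (length G) @ inrs qs) (snd (eta (arrs ss) x (length G))) = Case x qs Num"
  proof (rule ev_eta_saturated_good[OF _ _ _ refl])
    show "lk (length G) (idl (length G)) x = Inl x" using assms by (simp add: lk_idl)
    show "map fst qs = map args (args (arrs ss))" using denotable_list(1)[OF assms(3,4)] by simp
    show "good G q" if "q \<in> set qs" for q using denotable_list(2)[OF assms(3,4)] that by blast
  qed (use assms in auto)
  ultimately show ?thesis by simp
qed

text \<open>The program \<lambda>y x. C_f (y x), applied to a program for \<open>p\<close>: the
  constant acts at ground type and thereby on the rightward leaves of the body of
  \<open>p\<close>.\<close>

lemma denotable_rule4:
  assumes "denotable k G s p"
  shows "denotable k G s (rsub (length G) p (fnum f))"
proof -
  let ?d = "length G" and ?n = "length (args s)"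
  let ?G = "G @ [s] @ args s"
  let ?X = "foldl PApp (PVar ?d) (map PVar [length (G @ [s])..<length (G @ [s]) + length (args (?G ! ?d))])"
  let ?M = "PApp (PC f) ?X"
  have Gd: "?G ! ?d = s" by (simp add: nth_append)
  have X: "ptyped k ?G ?X N" by (rule ptyped_eta_app) (auto simp: Gd nth_append)
  have iX: "interp ?G ?X = ([], snd (eta s ?d (?d + 1)))"
    using interp_eta_app[of ?d "G @ [s]" ?G] by (simp add: Gd nth_append)
  have "interp ?G ?M = ([], nrepl (fnum f) (snd (eta s ?d (?d + 1))))" by (rule interp_PC[OF iX])
  moreover have "ptyped k ?G ?M N" using X by (auto intro: ptyped.intros)
  ultimately have "denotable k G (foldr Arr [s] s) (s # args s, nrepl (fnum f) (snd (eta s ?d (?d + 1))))"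
    using ptyped_lams[of k G "[s] @ args s" ?M N] interp_lams[of G "[s] @ args s" ?M] arrs_args[of s]
    unfolding denotable_def by (intro exI[of _ "foldr PLam ([s] @ args s) ?M"]) (simp add: arrs_def)
  from denotable_apps[OF this, of "[p]"] assms
  have den: "denotable k G s (args s, evu ?d (idl ?d @ [Inr (embp p)]) ?n (nrepl (fnum f) (snd (eta s ?d (?d + 1)))))"
    by simp
  have "evu ?d (idl ?d @ [Inr (embp p)]) ?n (fnum f i) = fnum f i" for i
    by (simp add: fnum_def split: option.split)
  moreover have "evu ?d (idl ?d @ [Inr (embp p)]) ?n (snd (eta s ?d (?d + 1))) = snd p"
    by (rule ev_eta_good) (use denotable_good[OF assms] in \<open>auto simp: lk_def nth_append\<close>)
  ultimately have "evu ?d (idl ?d @ [Inr (embp p)]) ?n (nrepl (fnum f) (snd (eta s ?d (?d + 1)))) = nrepl (fnum f) (snd p)"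
    by (subst nrepl_subst) simp_all
  moreover have "nshift ?d m (fnum f i) = fnum f i" for m i
    by (simp add: fnum_def nshift_def split: option.split)
  ultimately show ?thesis using den denotable_good[OF assms] by (simp add: rsub_def)
qed

text \<open>The program \<lambda>y u v x. ifzero (y x) u v. The branches are bound before the
  arguments \<open>x\<close>, so that applying it to \<open>p\<close>, \<open>a\<close> and
  \<open>b\<close> leaves a procedure of type \<open>s\<close>.\<close>

lemma denotable_rule5:
  assumes "denotable k G s p" "denotable k G N ([], a)" "denotable k G N ([], b)"
  shows "denotable k G s (rsub (length G) p (\<lambda>i. if i = 0 then a else b))"
proof -
  let ?d = "length G" and ?n = "length (args s)"
  let ?G' = "G @ [s, N, N]"
  let ?G = "G @ [s, N, N] @ args s"
  let ?X = "foldl PApp (PVar ?d) (map PVar [length ?G'..<length ?G' + length (args (?G ! ?d))])"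
  let ?M = "foldl PApp PIfz [?X, PVar (?d + 1), PVar (?d + 2)]"
  let ?g = "\<lambda>i::nat. if i = 0 then Case (?d + 1) [] Num else Case (?d + 2) [] Num"
  have Gd: "?G ! ?d = s" "?G ! (?d + 1) = N" "?G ! (?d + 2) = N" by (simp_all add: nth_append)
  have X: "ptyped k ?G ?X N" by (rule ptyped_eta_app) (auto simp: Gd nth_append)
  have iX: "interp ?G ?X = ([], snd (eta s ?d (?d + 3)))"
    using interp_eta_app[of ?d ?G' ?G] by (simp add: Gd nth_append numeral_3_eq_3)
  have "interp ?G ?M = ([], nrepl ?g (snd (eta s ?d (?d + 3))))"
    by (rule interp_PIfz[OF iX]) (simp_all only: interp.simps Gd eta_N)
  moreover have "ptyped k ?G ?M N"
  proof (rule ptyped_apps[where ss = "[N, N, N]"])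
    show "list_all2 (ptyped k ?G) [?X, PVar (?d + 1), PVar (?d + 2)] [N, N, N]"
      using X ptyped.intros(1)[of "?d + 1" ?G k] ptyped.intros(1)[of "?d + 2" ?G k] Gd by simp
  qed (simp add: ptyped.intros)
  ultimately have A: "denotable k G (foldr Arr [s, N, N] s) ([s, N, N] @ args s, nrepl ?g (snd (eta s ?d (?d + 3))))"
    using ptyped_lams[of k G "[s, N, N] @ args s" ?M N] interp_lams[of G "[s, N, N] @ args s" ?M] arrs_args[of s]
    unfolding denotable_def by (intro exI[of _ "foldr PLam ([s, N, N] @ args s) ?M"]) (simp add: arrs_def)
  have B: "denotable k G ([s, N, N] ! i) ([p, ([], a), ([], b)] ! i)" if "i < length [s, N, N]" for i
    using assms that by (auto simp: less_Suc_eq numeral_2_eq_2)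
  have den: "denotable k G s (args s, evu ?d (idl ?d @ inrs [p, ([], a), ([], b)]) ?n (nrepl ?g (snd (eta s ?d (?d + 3)))))"
    using denotable_apps[OF A _ B] by simp
  let ?us = "idl ?d @ inrs [p, ([], a), ([], b)]"
  have "(\<lambda>i. evu ?d ?us ?n (?g i)) = (\<lambda>i. nshift ?d ?n (if i = 0 then a else b))"
  proof
    fix i
    have "evu ?d ?us ?n (Case (?d + 1) [] Num) = nshift ?d ?n a"
      using ev_gs_ground[of ?d ?us "?d + 1" "([], a)" ?n Num] by (simp add: lk_def nth_append)
    moreover have "evu ?d ?us ?n (Case (?d + 2) [] Num) = nshift ?d ?n b"
      using ev_gs_ground[of ?d ?us "?d + 2" "([], b)" ?n Num] by (simp add: lk_def nth_append)
    ultimately show "evu ?d ?us ?n (?g i) = nshift ?d ?n (if i = 0 then a else b)"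
      by (simp only: split: if_split) simp
  qed
  moreover have "evu ?d ?us ?n (snd (eta s ?d (?d + 3))) = snd p"
    by (rule ev_eta_good) (use denotable_good[OF assms(1)] in \<open>auto simp: lk_def nth_append\<close>)
  moreover have "okl ?d ?us" by simp
  ultimately have "evu ?d ?us ?n (nrepl ?g (snd (eta s ?d (?d + 3)))) = nrepl (\<lambda>i. nshift ?d ?n (if i = 0 then a else b)) (snd p)"
    by (simp only: nrepl_subst[OF _ refl])
  then show ?thesis using den denotable_good[OF assms(1)] by (simp only: rsub_def)
qed

text \<open>The program is Y applied to programs for the procedure \<lambda>z x. e and the
  arguments; \<open>ev_Fb_plug\<close> identifies its normal form with the plugged one.\<close>

lemma denotable_rule6:
  assumes "denotable k G (Arr (arrs ss) (arrs ss)) (arrs ss # ss, e)" "lv (arrs ss) \<le> k"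
    "length qs = length ss" "\<And>i. i < length ss \<Longrightarrow> denotable k G (ss ! i) (qs ! i)"
  shows "denotable k G N ([], nunshift (length G) (length ss + 1) (eval (length G + length ss + 1)
     (plug (length G) (length ss + 1) e (\<lambda>j. if j = 0 then (ss, nshift (length G + 1) (length ss) e)
        else (fst (qs ! (j - 1)), nshift (length G) (length ss + 1) (snd (qs ! (j - 1))))))))"
proof -
  interpret fixpoint_unfolding G ss e qs "length ss + 1"
  proof
    show "map fst qs = map args ss" by (rule denotable_list(1)[OF assms(3,4)])
    show "good G q" if "q \<in> set qs" for q using denotable_list(2)[OF assms(3,4)] that by blast
  qed (use denotable_good[OF assms(1)] in auto)
  have A: "denotable k G (foldr Arr (Arr (arrs ss) (arrs ss) # ss) N) (Arr (arrs ss) (arrs ss) # ss, Fb ss (length G) (length G + 1))"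
    using ptyped.intros(6)[OF assms(2), of G] unfolding denotable_def
    by (intro exI[of _ "PY (arrs ss)"]) (simp add: arrs_def[symmetric])
  have B: "denotable k G ((Arr (arrs ss) (arrs ss) # ss) ! i) (((arrs ss # ss, e) # qs) ! i)"
    if "i < length (Arr (arrs ss) (arrs ss) # ss)" for i
    using assms(1,4) that by (cases i) auto
  have "denotable k G N ([], evs (length G) (idl (length G) @ Inr (embp (arrs ss # ss, e)) # inrs qs) (Fb ss (length G) (length G + 1)))"
    using denotable_apps[OF A _ B] assms(3) by simp
  then show ?thesis using ev_Fb_plug[of "idl (length G)" "length G"]
    unfolding xi_def by (simp add: add.assoc)
qed

lemma gen_imp_denotable: "gen k G s p \<Longrightarrow> denotable k G s p"
proof (induction rule: gen.induct)
  case (rule1 x G ss qs)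
  then show ?case by (intro denotable_rule1) auto
next
  case (rule2 G s t p)
  then obtain M where "ptyped k (G @ [s]) M t" "interp (G @ [s]) M = p" by (auto simp: denotable_def)
  then show ?case unfolding denotable_def by (intro exI[of _ "PLam s M"]) (auto intro: ptyped.intros)
next
  case (rule3 G n)
  then show ?case unfolding denotable_def by (intro exI[of _ "PNum n"]) (auto intro: ptyped.intros)
next
  case (rule4 G s p f)
  then show ?case by (intro denotable_rule4)
next
  case (rule5 G s p d e)
  then show ?case by (intro denotable_rule5)
next
  case (rule6 G ss e qs)
  then show ?case by (intro denotable_rule6)
qed

section \<open>Denotable procedures are generated\<close>

text \<open>Quantifying over extensions \<open>H\<close> of the environment makes weakening of \<open>Red\<close> immediate, so that weakening
  of \<open>gen\<close> is never needed.\<close>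
function Red :: "nat \<Rightarrow> ty \<Rightarrow> ty list \<Rightarrow> nsp \<Rightarrow> bool" where
  "Red k s G q \<longleftrightarrow> fst q = args s \<and> good G q \<and>
     (\<forall>H qs. length qs = length (args s) \<longrightarrow> (\<forall>i. i < length (args s) \<longrightarrow> Red k (args s ! i) (G @ H) (qs ! i)) \<longrightarrow>
        gen k (G @ H) N ([], evs (length (G @ H)) (idl (length G) @ inrs qs) (snd q)))"
  by pat_completeness auto
termination
  by (relation "measure (\<lambda>(_, s, _). size s)") (auto intro: size_args_nth)

declare Red.simps [simp del]

definition wk :: "nat \<Rightarrow> nat \<Rightarrow> nsp \<Rightarrow> nsp" where
  "wk d h q = (fst q, nshift d h (snd q))"

lemma mshiftp_embp: "mshiftp d h (embp q) = embp (wk d h q)"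
  by (simp add: wk_def mshiftp_pmap embp_def emb_nshift)

lemma Red_good: "Red k s G q \<Longrightarrow> fst q = args s" "Red k s G q \<Longrightarrow> good G q"
  by (subst (asm) Red.simps, simp)+

lemma Red_list:
  assumes "length qs = length ss" "\<And>i. i < length ss \<Longrightarrow> Red k (ss ! i) G (qs ! i)"
  shows "map fst qs = map args ss" "q \<in> set qs \<Longrightarrow> good G q"
proof -
  have "fst (qs ! i) = args (ss ! i) \<and> good G (qs ! i)" if "i < length ss" for i
    using Red_good[OF assms(2)[OF that]] by blast
  note * = good_list[OF assms(1) this]
  show "map fst qs = map args ss" "q \<in> set qs \<Longrightarrow> good G q" using * by blast+
qed

lemma RedI:
  assumes "fst q = args s" "good G q"
    "\<And>H qs. length qs = length (args s) \<Longrightarrow> (\<And>i. i < length (args s) \<Longrightarrow> Red k (args s ! i) (G @ H) (qs ! i)) \<Longrightarrow>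
        gen k (G @ H) N ([], evs (length (G @ H)) (idl (length G) @ inrs qs) (snd q))"
  shows "Red k s G q"
  by (subst Red.simps) (use assms in blast)

lemma RedD:
  assumes "Red k s G q" "length qs = length (args s)" "\<And>i. i < length (args s) \<Longrightarrow> Red k (args s ! i) (G @ H) (qs ! i)"
  shows "gen k (G @ H) N ([], evs (length (G @ H)) (idl (length G) @ inrs qs) (snd q))"
  using assms by (subst (asm) (1) Red.simps) blast

text \<open>The weakened procedure does not mention the levels of \<open>H\<close>, so its instances
  over a further extension \<open>H'\<close> are instances of the original over
  \<open>H @ H'\<close>.\<close>

lemma Red_weaken:
  assumes "Red k s G q"
  shows "Red k s (G @ H) (wk (length G) (length H) q)"
proof (rule RedI)
  fix H' qs assume qs: "length qs = length (args s)"
    and red: "\<And>i. i < length (args s) \<Longrightarrow> Red k (args s ! i) ((G @ H) @ H') (qs ! i)"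
  let ?d = "length G" and ?h = "length H" and ?D = "length ((G @ H) @ H')"
  let ?Q = "inrs qs"
  have "gs ?D (idl (length (G @ H)) @ ?Q) 0 (emb (snd (wk ?d ?h q))) = gs ?D (idl ?d @ ?Q) 0 (emb (snd q))"
    using gs_weaken_mid[of ?D "idl ?d" "map Inl [?d..<?d + ?h]" ?Q 0 "emb (snd q)"]
    by (simp add: wk_def emb_nshift idl_add)
  then show "gen k ((G @ H) @ H') N ([], evs ?D (idl (length (G @ H)) @ ?Q) (snd (wk ?d ?h q)))"
    using RedD[OF assms qs, of "H @ H'"] red by simp
next
  show "good (G @ H) (wk (length G) (length H) q)"
    using good_weaken[OF Red_good(2)[OF assms], of H] by (simp only: wk_def)
qed (use Red_good(1)[OF assms] in \<open>simp add: wk_def\<close>)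

lemma gen_lams: "gen k (G @ ss) t p \<Longrightarrow> gen k G (foldr Arr ss t) (ss @ fst p, snd p)"
proof (induction ss arbitrary: G)
  case (Cons s ss)
  then have "gen k (G @ [s]) (foldr Arr ss t) (ss @ fst p, snd p)" by simp
  from gen.rule2[OF this] show ?case by (simp add: lam1_def)
qed simp

text \<open>Simultaneous induction on the type, since reflection reifies arguments and reification
  reflects fresh variables. Goodness is part of \<open>Red\<close> so that applying \<open>q\<close>
  to these eta-expanded variables gives back its body.\<close>

lemma reflect_reify:
  "(x < length G \<longrightarrow> G ! x = s \<longrightarrow> Red k s G (eta s x (length G))) \<and> (Red k s G q \<longrightarrow> gen k G s q)"
proof (induction s arbitrary: x G q rule: measure_induct_rule[of size])
  case (less s)
  have reflect: "Red k (args s ! j) G' (eta (args s ! j) x (length G'))" if "j < length (args s)" "x < length G'" "G' ! x = args s ! j" for j x G'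
    using less.IH[OF size_args_nth[OF that(1)]] that by blast
  have reify: "gen k G' (args s ! j) q" if "j < length (args s)" "Red k (args s ! j) G' q" for j G' q
    using less.IH[OF size_args_nth[OF that(1)]] that by blast
  show ?case
  proof (intro conjI impI)
    assume x: "x < length G" "G ! x = s"
    show "Red k s G (eta s x (length G))"
    proof (rule RedI)
      fix H qs assume qs: "length qs = length (args s)"
        and red: "\<And>i. i < length (args s) \<Longrightarrow> Red k (args s ! i) (G @ H) (qs ! i)"
      have "evs (length (G @ H)) (idl (length G) @ inrs qs) (snd (eta s x (length G)))
        = Case x qs Num"
        by (rule ev_eta_saturated_good[OF _ _ _ refl Red_list(1)[OF qs red] Red_list(2)[OF qs red]])
          (use x in \<open>auto simp: lk_idl\<close>)
      moreover have "gen k (G @ H) N ([], Case x qs Num)"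
        by (rule gen.rule1[where ss = "args s"]) (use x qs reify[OF _ red] in \<open>auto simp: nth_append\<close>)
      ultimately show "gen k (G @ H) N ([], evs (length (G @ H)) (idl (length G) @ inrs qs) (snd (eta s x (length G))))"
        by simp
    qed (use good_eta[OF x(1)] x in auto)
  next
    assume q: "Red k s G q"
    let ?G = "G @ args s" and ?n = "length (args s)"
    let ?qs = "map (\<lambda>j. eta (args s ! j) (length G + j) (length ?G)) [0..<?n]"
    have red: "Red k (args s ! i) ?G (?qs ! i)" if "i < ?n" for i
      using reflect[OF that, of "length G + i" ?G] that by (simp add: nth_append)
    have "gen k ?G N ([], evs (length ?G) (idl (length G) @ inrs ?qs) (snd q))"
      by (rule RedD[OF q]) (use red in auto)
    moreover have "evs (length ?G) (idl (length G) @ inrs ?qs) (snd q) = snd q"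
      using good_eta_cancel[OF Red_good(2)[OF q]] Red_good(1)[OF q] by (simp add: comp_def)
    ultimately have "gen k G (foldr Arr (args s) N) (args s, snd q)"
      using gen_lams[of k G "args s" N "([], snd q)"] by simp
    moreover have "(args s, snd q) = q" using Red_good(1)[OF q] by (simp add: prod_eq_iff)
    ultimately show "gen k G s q" using arrs_args[of s] by (simp add: arrs_def)
  qed
qed

lemmas reflect = reflect_reify[THEN conjunct1, rule_format]
  and reify = reflect_reify[THEN conjunct2, rule_format]

text \<open>Environment variables and binders are all replaced by reducible procedures, so the
  conclusion is of ground type only. The target context \<open>G\<close> is arbitrary, which already
  covers its extensions.\<close>

definition Comp :: "nat \<Rightarrow> ty list \<Rightarrow> ty \<Rightarrow> nsp \<Rightarrow> bool" where
  "Comp k G' s p \<longleftrightarrow> (\<forall>G \<gamma> qs. length \<gamma> = length G' \<longrightarrow> (\<forall>i<length G'. Red k (G' ! i) G (\<gamma> ! i)) \<longrightarrow>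
     length qs = length (args s) \<longrightarrow> (\<forall>i<length (args s). Red k (args s ! i) G (qs ! i)) \<longrightarrow>
     gen k G N ([], evs (length G) (inrs (\<gamma> @ qs)) (snd p)))"

lemma CompD:
  assumes "Comp k G' s p" "length \<gamma> = length G'" "\<And>i. i < length G' \<Longrightarrow> Red k (G' ! i) G (\<gamma> ! i)"
    "length qs = length (args s)" "\<And>i. i < length (args s) \<Longrightarrow> Red k (args s ! i) G (qs ! i)"
  shows "gen k G N ([], evs (length G) (inrs (\<gamma> @ qs)) (snd p))"
  using assms unfolding Comp_def by blast

text \<open>Normalising the instance by \<open>\<gamma>\<close> before supplying further arguments
  makes no difference, and after weakening \<open>\<gamma>\<close> the arguments are just more
  entries of the same substitution.\<close>

lemma Comp_Red:
  assumes "Comp k G' s p" "fst p = args s" "good G' p" "length \<gamma> = length G'"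
    "\<And>i. i < length G' \<Longrightarrow> Red k (G' ! i) G (\<gamma> ! i)"
  shows "Red k s G (args s, ev (length G + length (args s)) (gs (length G) (inrs \<gamma>) (length (args s)) (emb (snd p))))"
proof (rule RedI)
  let ?d = "length G" and ?n = "length (args s)" and ?\<Gamma> = "inrs \<gamma>"
  show "good G (args s, evu ?d ?\<Gamma> ?n (snd p))"
  proof (rule good_subst)
    show "good G' (args s, snd p)" using assms(2,3) by (metis prod.collapse)
    fix x assume x: "x < length G'"
    then have "?\<Gamma> ! x = Inr (embp (\<gamma> ! x)) \<and> good G (\<gamma> ! x)"
      using Red_good(2)[OF assms(5)] assms(4) by simp
    then show "(\<exists>y<?d. ?\<Gamma> ! x = Inl y \<and> G ! y = G' ! x) \<or> (\<exists>p. ?\<Gamma> ! x = Inr (embp p) \<and> good G p)"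
      by blast
  qed (use assms(4) in simp)
next
  let ?d = "length G" and ?n = "length (args s)" and ?\<Gamma> = "inrs \<gamma>"
  fix H qs assume qs: "length qs = ?n" and red: "\<And>i. i < ?n \<Longrightarrow> Red k (args s ! i) (G @ H) (qs ! i)"
  let ?D = "length (G @ H)" and ?Q = "inrs qs"
  have "evs ?D (idl ?d @ ?Q) (evu ?d ?\<Gamma> ?n (snd p))
     = ev ?D (gs ?D (idl ?d @ ?Q) 0 (gs ?d ?\<Gamma> ?n (emb (snd p))))"
    using ev_gs_emb_ev[of ?D "idl ?d @ ?Q" "?d + ?n" 0] qs by simp
  also have "gs ?D (idl ?d @ ?Q) 0 (gs ?d ?\<Gamma> ?n (emb (snd p))) = gs ?D (map (cmp ?D (idl ?d)) ?\<Gamma> @ ?Q) 0 (emb (snd p))"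
    by (rule gs_gs_lift) (use qs in auto)
  also have "map (cmp ?D (idl ?d)) ?\<Gamma> = inrs (map (wk ?d (length H)) \<gamma>)"
    using map_cmp_idl_shift[of ?d ?\<Gamma> "length H"] by (simp add: mshiftp_embp)
  finally show "gen k (G @ H) N ([], evs ?D (idl ?d @ ?Q) (snd (args s, evu ?d ?\<Gamma> ?n (snd p))))"
    using CompD[OF assms(1), of "map (wk ?d (length H)) \<gamma>" "G @ H" qs] assms(4) qs red Red_weaken[OF assms(5)]
    by (simp add: comp_def)
qed simp

text \<open>Covers \<open>suc\<close>, \<open>pre\<close> and \<open>C_f\<close>: each acts by leaf
  replacement, and the second assumption makes its branches immune to substitution.\<close>

lemma Comp_ground:
  assumes "\<And>G b. gen k G N ([], b) \<Longrightarrow> gen k G N ([], nrepl es b)" "\<And>i. es i = Bot \<or> (\<exists>n. es i = Num n)"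
  shows "Comp k G' (Arr N N) ([N], Case (length G') [] es)"
  unfolding Comp_def
proof (intro allI impI)
  fix G :: "ty list" and \<gamma> qs :: "nsp list"
  assume a: "length \<gamma> = length G'" "length qs = length (args (Arr N N))"
    "\<forall>i<length (args (Arr N N)). Red k (args (Arr N N) ! i) G (qs ! i)"
  let ?us = "inrs (\<gamma> @ qs)"
  obtain q where q: "qs = [q]" "Red k N G q" using a by (cases qs) auto
  have fq: "fst q = []" using Red_good(1)[OF q(2)] by simp
  have "evs (length G) ?us (es i) = es i" for i using assms(2)[of i] by auto
  then have "evs (length G) ?us (Case (length G') [] es) = nrepl es (snd q)"
    using ev_gs_ground[of "length G" ?us "length G'" q 0 es] a fq by (simp add: lk_def nth_append q)
  moreover have "gen k G N ([], snd q)" using reify[OF q(2)] fq by (metis prod.collapse)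
  ultimately show "gen k G N ([], evs (length G) ?us (snd ([N], Case (length G') [] es)))"
    using assms(1) by simp
qed

lemma gen_nrepl_fnum: "gen k G N ([], b) \<Longrightarrow> gen k G N ([], nrepl (fnum f) b)"
  using gen.rule4[of k G N "([], b)" f] by (simp add: rsub_def)

text \<open>Abstraction only moves an argument from \<open>qs\<close> to \<open>\<gamma>\<close>.
  Numerals use rule 3, the unary constants rule 4, \<open>ifzero\<close> rule 5 and \<open>Y\<close>
  rule 6; a variable uses the reducibility of its entry in \<open>\<gamma>\<close>.\<close>

lemma fundamental: "ptyped k G' M s \<Longrightarrow> Comp k G' s (interp G' M)"
proof (induction rule: ptyped.induct)
  case (1 x G' k)
  show ?case unfolding Comp_def
  proof (intro allI impI)
    fix G :: "ty list" and \<gamma> qs :: "nsp list"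
    assume a: "length \<gamma> = length G'" "\<forall>i<length G'. Red k (G' ! i) G (\<gamma> ! i)"
      "length qs = length (args (G' ! x))" "\<forall>i<length (args (G' ! x)). Red k (args (G' ! x) ! i) G (qs ! i)"
    have x: "Red k (G' ! x) G (\<gamma> ! x)" using a 1 by blast
    have "evs (length G) (inrs \<gamma> @ inrs qs) (snd (eta (G' ! x) x (length G')))
       = evs (length G) (idl (length G) @ inrs qs) (snd (\<gamma> ! x))"
      by (rule ev_eta_head[OF _ _ _ refl Red_good(1)[OF x] Red_list(1)[OF a(3)] Red_list(2)[OF a(3)]])
        (use a 1 in \<open>auto simp: lk_def\<close>)
    moreover have "gen k (G @ []) N ([], evs (length (G @ [])) (idl (length G) @ inrs qs) (snd (\<gamma> ! x)))"
      by (rule RedD[OF x a(3)]) (use a in simp)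
    ultimately show "gen k G N ([], evs (length G) (inrs (\<gamma> @ qs)) (snd (interp G' (PVar x))))"
      by simp
  qed
next
  case (2 k G' n)
  then show ?case by (auto simp: Comp_def intro: gen.rule3)
next
  case (3 k G')
  have "fnum (\<lambda>i. Some (i + 1)) = (\<lambda>i. Num (i + 1))" by (auto simp: fnum_def)
  then show ?case using gen_nrepl_fnum[of k _ _ "\<lambda>i. Some (i + 1)"] by (auto intro!: Comp_ground)
next
  case (4 k G')
  have "fnum (\<lambda>i. Some (i - 1)) = (\<lambda>i. Num (i - 1))" by (auto simp: fnum_def)
  then show ?case using gen_nrepl_fnum[of k _ _ "\<lambda>i. Some (i - 1)"] by (auto intro!: Comp_ground)
next
  case (7 k G' f)
  have "fnum f = (\<lambda>i. case f i of None \<Rightarrow> Bot | Some m \<Rightarrow> Num m)" by (auto simp: fnum_def)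
  moreover have "fnum f i = Bot \<or> (\<exists>n. fnum f i = Num n)" for i by (cases "f i") (auto simp: fnum_def)
  ultimately show ?case using Comp_ground[of k "fnum f" G'] gen_nrepl_fnum[of k _ _ f] by simp
next
  case (5 k G')
  show ?case unfolding Comp_def
  proof (intro allI impI)
    fix G :: "ty list" and \<gamma> qs :: "nsp list"
    let ?ts = "args (Arr N (Arr N (Arr N N)))"
    assume a: "length \<gamma> = length G'" "length qs = length ?ts" "\<forall>i<length ?ts. Red k (?ts ! i) G (qs ! i)"
    let ?us = "inrs (\<gamma> @ qs)" and ?D = "length G'" and ?d = "length G"
    obtain q0 q1 q2 where q: "qs = [q0, q1, q2]" using a(2) by (auto simp: length_Suc_conv)
    have red: "Red k N G q0" "Red k N G q1" "Red k N G q2"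
      using a(3)[rule_format, of 0] a(3)[rule_format, of 1] a(3)[rule_format, of 2] by (simp_all add: q)
    have fq: "fst q0 = []" "fst q1 = []" "fst q2 = []" using red Red_good(1) by auto
    have g: "gen k G N ([], snd q0)" "gen k G N ([], snd q1)" "gen k G N ([], snd q2)"
      using red reify fq by (metis prod.collapse)+
    let ?es = "\<lambda>i::nat. if i = 0 then Case (?D + 1) [] Num else Case (?D + 2) [] Num"
    have "evs ?d ?us (Case (?D + 1) [] Num) = snd q1"
      using ev_gs_ground[of ?d ?us "?D + 1" q1 0 Num] fq a(1) by (simp add: lk_def nth_append q)
    moreover have "evs ?d ?us (Case (?D + 2) [] Num) = snd q2"
      using ev_gs_ground[of ?d ?us "?D + 2" q2 0 Num] fq a(1) by (simp add: lk_def nth_append q)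
    ultimately have "evs ?d ?us (?es i) = (if i = 0 then snd q1 else snd q2)" for i
      by (simp only: split: if_split) simp
    then have es: "(\<lambda>i. evs ?d ?us (?es i)) = (\<lambda>i. if i = 0 then snd q1 else snd q2)" by (rule ext)
    have "lk ?d ?us ?D = Inr (embp q0)" using a(1) by (simp add: lk_def nth_append q)
    from ev_gs_ground[OF this fq(1), of 0 ?es]
    have "evs ?d ?us (Case ?D [] ?es) = nrepl (\<lambda>i. if i = 0 then snd q1 else snd q2) (snd q0)"
      by (simp only: add_0_right es nshift_0)
    moreover have "gen k G N ([], nrepl (\<lambda>i. if i = 0 then snd q1 else snd q2) (snd q0))"
      using gen.rule5[OF g] by (simp add: rsub_def)
    ultimately show "gen k G N ([], evs ?d ?us (snd (interp G' PIfz)))"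
      by (simp only: interp.simps snd_conv)
  qed
next
  case (6 s k G')
  show ?case unfolding Comp_def
  proof (intro allI impI)
    fix G :: "ty list" and \<gamma> qs :: "nsp list"
    let ?ts = "args (Arr (Arr s s) s)"
    assume a: "length \<gamma> = length G'" "length qs = length ?ts" "\<forall>i<length ?ts. Red k (?ts ! i) G (qs ! i)"
    obtain g xs where q: "qs = g # xs" using a(2) by (cases qs) auto
    have g: "Red k (Arr s s) G g" using a(3)[rule_format, of 0] by (simp add: q)
    have xs: "length xs = length (args s)" "\<And>i. i < length (args s) \<Longrightarrow> Red k (args s ! i) G (xs ! i)"
      using a(2) a(3)[rule_format, of "Suc _"] by (auto simp: q)
    obtain e where e: "g = (s # args s, e)" using Red_good(1)[OF g] by (cases g) auto
    interpret fixpoint_unfolding G "args s" e xs "length (args s) + 1"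
    proof
      show "good G (arrs (args s) # args s, e)" using Red_good(2)[OF g] e by simp
      show "map fst xs = map args (args s)" by (rule Red_list(1)[OF xs])
      show "good G q" if "q \<in> set xs" for q using Red_list(2)[OF xs] that by blast
    qed simp
    \<comment> \<open>Rule 6 asks for derivations of \<open>g\<close> and of its arguments;
      reification supplies them from reducibility.\<close>
    have "gen k G N ([], nunshift (length G) (length (args s) + 1) (eval (length G + length (args s) + 1)
       (plug (length G) (length (args s) + 1) e (\<lambda>j. if j = 0 then (args s, nshift (length G + 1) (length (args s)) e)
          else (fst (xs ! (j - 1)), nshift (length G) (length (args s) + 1) (snd (xs ! (j - 1))))))))"
      by (rule gen.rule6) (use reify[OF g] e 6 xs reify[OF xs(2)] in auto)
    then show "gen k G N ([], evs (length G) (inrs (\<gamma> @ qs)) (snd (interp G' (PY s))))"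
      using ev_Fb_plug[of "inrs \<gamma>" "length G'"] a(1) unfolding xi_def by (simp add: add.assoc q e)
  qed
next
  case (8 k G' s M t)
  show ?case unfolding Comp_def
  proof (intro allI impI)
    fix G :: "ty list" and \<gamma> qs :: "nsp list"
    assume a: "length \<gamma> = length G'" "\<forall>i<length G'. Red k (G' ! i) G (\<gamma> ! i)"
      "length qs = length (args (Arr s t))" "\<forall>i<length (args (Arr s t)). Red k (args (Arr s t) ! i) G (qs ! i)"
    obtain q xs where q: "qs = q # xs" using a(3) by (cases qs) auto
    have "gen k G N ([], evs (length G) (inrs ((\<gamma> @ [q]) @ xs)) (snd (interp (G' @ [s]) M)))"
    proof (rule CompD[OF "8.IH"])
      show "Red k ((G' @ [s]) ! i) G ((\<gamma> @ [q]) ! i)" if "i < length (G' @ [s])" for i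
        using a(1,2) a(4)[rule_format, of 0] that by (auto simp: nth_append q less_Suc_eq)
      show "Red k (args t ! i) G (xs ! i)" if "i < length (args t)" for i
        using a(4)[rule_format, of "Suc i"] that by (simp add: q)
    qed (use a q in auto)
    then show "gen k G N ([], evs (length G) (inrs (\<gamma> @ qs)) (snd (interp G' (PLam s M))))"
      by (simp add: q lam1_def)
  qed
next
  case (9 k G' M s t M')
  show ?case unfolding Comp_def
  proof (intro allI impI)
    fix G :: "ty list" and \<gamma> qs :: "nsp list"
    assume a: "length \<gamma> = length G'" "\<forall>i<length G'. Red k (G' ! i) G (\<gamma> ! i)"
      "length qs = length (args t)" "\<forall>i<length (args t). Red k (args t ! i) G (qs ! i)"
    let ?d = "length G" and ?D = "length G'" and ?m = "length (args t)" and ?q = "interp G' M'"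
    let ?\<Gamma> = "inrs \<gamma> :: (nat + mproc) list" and ?Q = "inrs qs :: (nat + mproc) list"
    have M: "fst (interp G' M) = s # args t" using interp_good[OF "9.hyps"(1)] by simp
    have M': "fst ?q = args s" "good G' ?q" using interp_good[OF "9.hyps"(2)] by auto
    \<comment> \<open>Reducibility speaks of normal forms only, so the instance of the argument is
      normalised here and exchanged below by \<open>ev_gs_cong\<close>.\<close>
    define q' where "q' = (args s, ev (?d + length (args s)) (gs ?d ?\<Gamma> (length (args s)) (emb (snd ?q))))"
    have q': "Red k s G q'" unfolding q'_def
      by (rule Comp_Red[OF "9.IH"(2) M' a(1)]) (use a in simp)
    let ?e = "emb (snd (interp G' M))"
    have "evs ?d (?\<Gamma> @ ?Q) (snd (interp G' (PApp M M')))
       = ev ?d (gs ?d (?\<Gamma> @ ?Q) 0 (gs ?D (idl ?D @ [Inr (embp ?q)]) ?m ?e))"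
      using ev_gs_emb_ev[of ?d "?\<Gamma> @ ?Q" "?D + ?m" 0] a(1,3) by (simp add: app_gs[OF M])
    also have "gs ?d (?\<Gamma> @ ?Q) 0 (gs ?D (idl ?D @ [Inr (embp ?q)]) ?m ?e)
       = gs ?d (map (cmp ?d ?\<Gamma>) (idl ?D @ [Inr (embp ?q)]) @ ?Q) 0 ?e"
      by (rule gs_gs_lift) (use a in auto)
    also have "map (cmp ?d ?\<Gamma>) (idl ?D @ [Inr (embp ?q)]) = ?\<Gamma> @ [Inr (gsp ?d ?\<Gamma> 0 (embp ?q))]"
      using map_cmp_idl[of ?\<Gamma> ?D ?d] a(1) by simp
    also have "ev ?d (gs ?d ((?\<Gamma> @ [Inr (gsp ?d ?\<Gamma> 0 (embp ?q))]) @ ?Q) 0 ?e) = ev ?d (gs ?d ((?\<Gamma> @ [Inr (embp q')]) @ ?Q) 0 ?e)"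
    proof -
      have "ev_rel ?d (Inr (gsp ?d ?\<Gamma> 0 (embp ?q))) (Inr (embp q'))"
        by (simp add: prd_def q'_def M')
      then have "list_all2 (ev_rel ?d) ((?\<Gamma> @ [Inr (gsp ?d ?\<Gamma> 0 (embp ?q))]) @ ?Q) ((?\<Gamma> @ [Inr (embp q')]) @ ?Q)"
        by (intro list_all2_appendI list_ev_rel_refl) auto
      from ev_gs_cong[OF _ _ _ this, of 0 ?e ?e] show ?thesis by simp
    qed
    also have "(?\<Gamma> @ [Inr (embp q')]) @ ?Q = inrs (\<gamma> @ q' # qs)" by simp
    finally have eq: "evs ?d (?\<Gamma> @ ?Q) (snd (interp G' (PApp M M'))) = ev ?d (gs ?d (inrs (\<gamma> @ q' # qs)) 0 ?e)" .
    have "gen k G N ([], ev ?d (gs ?d (inrs (\<gamma> @ q' # qs)) 0 ?e))"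
      by (rule CompD[OF "9.IH"(1) a(1)]) (use a q' in \<open>auto simp: nth_Cons split: nat.split\<close>)
    then show "gen k G N ([], evs ?d (inrs (\<gamma> @ qs)) (snd (interp G' (PApp M M'))))"
      unfolding map_append eq .
  qed
qed

text \<open>The closing substitution sends every environment variable to its eta-expansion, which is
  reducible by reflection; goodness of \<open>p\<close> says that this changes nothing.\<close>

lemma denotable_imp_gen:
  assumes "denotable k G s p" shows "gen k G s p"
proof -
  obtain M where M: "ptyped k G M s" "interp G M = p" using assms by (auto simp: denotable_def)
  have p: "fst p = args s" "good G p" using denotable_good[OF assms] by auto
  let ?d = "length G" and ?n = "length (args s)"
  let ?\<gamma> = "map (\<lambda>x. eta (G ! x) x ?d) [0..<?d]"
  have "Red k s G (args s, evu ?d (inrs ?\<gamma>) ?n (snd p))"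
    by (rule Comp_Red[OF fundamental[OF M(1), unfolded M(2)] p]) (auto intro: reflect)
  moreover have "inrs ?\<gamma> = esub G UNIV" by (simp add: esub_def)
  moreover have "evu ?d (esub G UNIV) ?n (snd p) = snd p"
    using p gs_lift0[of ?d "esub G UNIV" ?n] lift_esub[of G "args s" UNIV] by (simp add: good_def gd_def)
  moreover have "(args s, snd p) = p" using p by (simp add: prod_eq_iff)
  ultimately have "Red k s G p" by simp
  then show ?thesis by (rule reify)
qed

theorem theorem3p8:
  fixes k :: nat and G :: "ty list" and s :: ty and p :: nsp
  assumes "k \<ge> 1"
  shows "denotable k G s p \<longleftrightarrow> gen k G s p"
  using gen_imp_denotable denotable_imp_gen by blast

end
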